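(* Let $n\ge 1$, let $f:[1,\infty)^n\to\mathbb{R}$ be a non-negative and monotonically increasing function, and let $\lambda>0$. There is a truthful (randomized) digital goods auction for $n$ bidders that achieves a competitive ratio of $\lambda$ with respect to $f$ if and only if for every measurable upward closed set $S\subseteq[1,\infty)^n$, $$\int_{S} f(v)\, w(v)\,\mathrm{d}v\;\le\;\lambda\cdot\sum_{i=1}^n\;\int_{S\downarrow_i} w(v_{-i})\,\mathrm{d}v_{-i},$$ where $w(v)=\prod_{k=1}^n \frac{1}{v_k^2}$, $w(v_{-i})=\prod_{k\neq i}\frac{1}{v_k^2}$, and $S\downarrow_i$ is the projection of $S$ along the $i$-th coordinate.
   Context: Digital goods auction: an auctioneer sells identical items in unlimited supply to $n$ bidders; bidder $i$ wants one unit and has a private value $v_i\in[1,\infty)$. Each bidder submits a sealed bid; the auctioneer decides who receives an item and what each winner pays (non-winners pay $0$). The revenue is the total payment. An auction is truthful if bidding one's true value is a dominant strategy for every bidder; a randomized auction is (universally) truthful if it is a probability distribution over deterministic truthful auctions. Truthful auctions are identified with bid-independent ones: a deterministic truthful auction is given by functions $g_1,\dots,g_n$, where bidder $i$ is offered the threshold price $p_i=g_i(v_{-i})\in[0,\infty]$ depending only on the bids $v_{-i}=(v_1,\dots,v_{i-1},v_{i+1},\dots,v_n)$ of the other bidders; bidder $i$ wins and pays $p_i$ if $v_i\ge p_i$, and otherwise loses and pays $0$. In a randomized truthful auction the functions $g_i$ may additionally depend on random coins independent of the bids, and all prices are assumed to be jointly (Lebesgue) measurable functions of bids and coins. $\mathbf{E}[\mathcal{A}(v)]$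 denotes the expected revenue of auction $\mathcal{A}$ on bid vector $v$. The auction $\mathcal{A}$ has competitive ratio $\lambda$ with respect to $f$ if $f(v)\le\lambda\cdot\mathbf{E}[\mathcal{A}(v)]$ for every $v\in[1,\infty)^n$. Monotonically increasing means: $u_k\le v_k$ for all $k$ implies $f(u)\le f(v)$. A set $S\subseteq[1,\infty)^n$ is upward closed if $u\in S$, $v\in[1,\infty)^n$ and $u_k\le v_k$ for all $k$ imply $v\in S$. The projection is $S\downarrow_i=\{v_{-i} : \exists\, v_i \text{ such that } (v_{-i},v_i)\in S\}\subseteq[1,\infty)^{n-1}$. *)

theory Defs
  imports "HOL-Probability.Probability"
begin

text \<open>
  Vectors indexed by a set \<open>J\<close> of bidders are extensional functions in
  \<open>PiE J (\<lambda>_. {1..})\<close>. For two such vectors the pointwise order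
  on functions is the coordinatewise order on \<open>J\<close>, because both are
  \<open>undefined\<close> outside \<open>J\<close>.
\<close>

definition bid_vectors :: "nat set \<Rightarrow> (nat \<Rightarrow> real) set" where
  "bid_vectors J = PiE J (\<lambda>_. {1..})"

text \<open>
  Borel-Lebesgue measure on \<open>bid_vectors J\<close>; its \<open>completion\<close> is
  Lebesgue measure. The completion matters: monotone functions and upward closed sets in
  dimension at least two are Lebesgue measurable, but need not be Borel. For empty \<open>J\<close>
  this is the unit mass at the empty vector.
\<close>

definition bid_measure :: "nat set \<Rightarrow> (nat \<Rightarrow> real) measure" where
  "bid_measure J = PiM J (\<lambda>_. restrict_space lborel {1..})"

lemma space_bid_measure: "space (completion (bid_measure J)) = bid_vectors J"
  by (simp add: bid_measure_def bid_vectors_def space_PiM space_restrict_space)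

definition weight :: "nat set \<Rightarrow> (nat \<Rightarrow> real) \<Rightarrow> real" where
  "weight J v = (\<Prod>k\<in>J. 1 / (v k)\<^sup>2)"

definition drop_bid :: "nat \<Rightarrow> nat \<Rightarrow> (nat \<Rightarrow> real) \<Rightarrow> (nat \<Rightarrow> real)" where
  "drop_bid n i v = restrict v ({1..n} - {i})"

definition upward_closed :: "nat \<Rightarrow> (nat \<Rightarrow> real) set \<Rightarrow> bool" where
  "upward_closed n S \<longleftrightarrow>
     S \<subseteq> bid_vectors {1..n} \<and> (\<forall>u\<in>S. \<forall>v\<in>bid_vectors {1..n}. u \<le> v \<longrightarrow> v \<in> S)"

definition projection :: "nat \<Rightarrow> nat \<Rightarrow> (nat \<Rightarrow> real) set \<Rightarrow> (nat \<Rightarrow> real) set" where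
  "projection n i S = {u \<in> bid_vectors ({1..n} - {i}). \<exists>x. u(i := x) \<in> S}"

text \<open>
  A deterministic truthful auction is given by its threshold functions \<open>p\<close>:
  bidder \<open>i\<close> is offered the price \<open>p i (drop_bid n i v)\<close>.
\<close>

type_synonym thresholds = "nat \<Rightarrow> (nat \<Rightarrow> real) \<Rightarrow> ennreal"

definition wins :: "nat \<Rightarrow> thresholds \<Rightarrow> (nat \<Rightarrow> real) \<Rightarrow> nat \<Rightarrow> bool" where
  "wins n p v i \<longleftrightarrow> p i (drop_bid n i v) \<le> ennreal (v i)"

definition payment :: "nat \<Rightarrow> thresholds \<Rightarrow> (nat \<Rightarrow> real) \<Rightarrow> nat \<Rightarrow> ennreal" where
  "payment n p v i = (if wins n p v i then p i (drop_bid n i v) else 0)"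

definition revenue :: "nat \<Rightarrow> thresholds \<Rightarrow> (nat \<Rightarrow> real) \<Rightarrow> ennreal" where
  "revenue n p v = (\<Sum>i=1..n. payment n p v i)"

definition utility :: "nat \<Rightarrow> thresholds \<Rightarrow> (nat \<Rightarrow> real) \<Rightarrow> nat \<Rightarrow> real \<Rightarrow> real" where
  "utility n p v i t = (if wins n p v i then t else 0) - enn2real (payment n p v i)"

lemma truthful_bid_dominant:
  assumes "v \<in> bid_vectors {1..n}" "i \<in> {1..n}" "b \<ge> 1"
  shows "utility n p (v(i := b)) i (v i) \<le> utility n p v i (v i)"
proof -
  have eq: "drop_bid n i (v(i := b)) = drop_bid n i v"
    by (auto simp: drop_bid_def restrict_def)
  have "v i \<ge> 1"
    using assms by (auto simp: bid_vectors_def PiE_iff)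
  then show ?thesis
    using assms(3) unfolding utility_def payment_def wins_def eq
    by (cases "p i (drop_bid n i v)") (auto simp: top_unique)
qed

text \<open>
  A randomized truthful auction: \<open>g c\<close> is the deterministic truthful auction run when
  the coins from the probability space \<open>C\<close> come up \<open>c\<close>. Lebesgue
  measurability in bids and coins jointly controls the dependence on the coins for almost all
  bids only, so measurability in the coins is also required at each fixed bid vector; this makes
  the expected revenue meaningful for every bid vector.
\<close>

definition randomized_truthful_auction :: "nat \<Rightarrow> 'c measure \<Rightarrow> ('c \<Rightarrow> thresholds) \<Rightarrow> bool" where
  "randomized_truthful_auction n C g \<longleftrightarrow>
     prob_space C \<and>
     (\<forall>i\<in>{1..n}.
        (\<lambda>(u, c). g c i u) \<in> borel_measurable (completion (bid_measure ({1..n} - {i}) \<Otimes>\<^sub>M C)) \<and>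
        (\<forall>u\<in>bid_vectors ({1..n} - {i}). (\<lambda>c. g c i u) \<in> borel_measurable C))"

definition expected_revenue :: "nat \<Rightarrow> 'c measure \<Rightarrow> ('c \<Rightarrow> thresholds) \<Rightarrow> (nat \<Rightarrow> real) \<Rightarrow> ennreal" where
  "expected_revenue n C g v = (\<integral>\<^sup>+ c. revenue n (g c) v \<partial>C)"

definition has_competitive_ratio ::
  "nat \<Rightarrow> 'c measure \<Rightarrow> ('c \<Rightarrow> thresholds) \<Rightarrow> ((nat \<Rightarrow> real) \<Rightarrow> real) \<Rightarrow> real \<Rightarrow> bool" where
  "has_competitive_ratio n C g f r \<longleftrightarrow>
     (\<forall>v\<in>bid_vectors {1..n}. ennreal (f v) \<le> ennreal r * expected_revenue n C g v)"

end

theory Submission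
  imports Defs "HOL-Real_Asymp.Real_Asymp"
begin

text \<open>
  A threshold \<open>p\<close> earns at most \<open>\<integral>\<^bsub>p\<^esub> p / x\<^sup>2 dx \<le> 1\<close> on a line, integrated against the equal revenue
  density \<open>1 / x\<^sup>2\<close>; integrating the competitive guarantee over \<open>S\<close> therefore charges at most
  the weight of each projection of \<open>S\<close>.

  Conversely, an auction amounts to expected payments \<open>q\<^sub>i u x\<close> that increase in the own bid \<open>x\<close> and
  satisfy \<open>\<integral> q\<^sub>i u x / x\<^sup>2 dx \<le> 1\<close>; they have to sum to at least \<open>F = f / r\<close>. On a finite grid
  let \<open>q\<^sub>i = F b\<^sub>i / (\<Sum>\<^sub>j b\<^sub>j)\<close>, where \<open>b\<^sub>i \<in> [\<delta>, 1]\<close> depends on the bids of the others only and is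
  lowered until no line is overloaded, but not below \<open>\<delta>\<close>. All quantities in this iteration
  are monotone in the bids, so its limit is monotone and the sets \<open>{\<Sum>\<^sub>j b\<^sub>j < \<eta>}\<close> are upward closed.
  The integral bound for these sets, over the scales \<open>\<eta> = 1, \<rho>, \<rho>\<^sup>2, \<dots>\<close>, telescopes and makes the overload
  tend to \<open>0\<close> with \<open>\<delta>\<close>.

  The grid solutions have a limit that is feasible at every bid vector by Tychonoff's theorem. For
  its measurability they are chosen as near-minimizers of a strictly convex functional, which
  converge almost everywhere on all slices with rational own bid.
\<close>

text \<open>If the bound held for all sets of cells, Hall's theorem for flows from cells to lines
  would already give shares without overload. It is available for upward closed sets only, and
  payments have to increase in the own bid besides. The proportional split meets both demands:
  \<open>F\<close> increases and the \<open>b\<close> decrease in the bids.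

  Why the overload vanishes: at the fixed point every line with \<open>b < 1\<close> is full, and
  only lines at the floor \<delta> can be overfull. Let g(\<theta>) be the weight of the lines with
  \<open>b < \<theta>\<close>. If \<theta> is much smaller than \<eta>, these lines earn almost
  everything on cells where the sum of the \<open>b\<close> is below \<eta>, and the integral bound
  caps all earnings there by g(\<eta>). Being full, the lines absorb g(\<theta>) of this, so the
  overload is at most g(\<eta>) - g(\<theta>) plus an error of order \<theta> / \<eta>. Since g is
  bounded, averaging over L scales leaves O(1 / L). The floor has to lie below all L scales, which
  is why \<delta> is fixed last.\<close>

declare One_nat_def [simp del]

section \<open>Revenue shares on a finite grid\<close>

lemma sum_PiE_split:
  fixes g :: "('a \<Rightarrow> 'b) \<Rightarrow> 'c::comm_monoid_add"
  assumes "i \<in> I"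
  shows "(\<Sum>c\<in>PiE I (\<lambda>_. G). g c) = (\<Sum>u\<in>PiE (I - {i}) (\<lambda>_. G). \<Sum>x\<in>G. g (u(i := x)))"
proof -
  have *: "PiE I (\<lambda>_. G) = (\<lambda>(x, u). u(i := x)) ` (G \<times> PiE (I - {i}) (\<lambda>_. G))"
    using PiE_insert_eq[of i "I - {i}" "\<lambda>_. G"] assms by (simp add: insert_absorb)
  have inj: "inj_on (\<lambda>(x, u). u(i := x)) (G \<times> PiE (I - {i}) (\<lambda>_. G))"
    using inj_combinator[of i "I - {i}" "\<lambda>_. G"] by simp
  have "(\<Sum>c\<in>PiE I (\<lambda>_. G). g c) = (\<Sum>(x, u)\<in>G \<times> PiE (I - {i}) (\<lambda>_. G). g (u(i := x)))"
    unfolding * by (subst sum.reindex[OF inj]) (simp add: case_prod_unfold comp_def)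
  also have "\<dots> = (\<Sum>x\<in>G. \<Sum>u\<in>PiE (I - {i}) (\<lambda>_. G). g (u(i := x)))"
    by (rule sum.cartesian_product[symmetric])
  also have "\<dots> = (\<Sum>u\<in>PiE (I - {i}) (\<lambda>_. G). \<Sum>x\<in>G. g (u(i := x)))"
    by (rule sum.swap)
  finally show ?thesis .
qed

text \<open>The demands \<open>F\<close> live on all index functions and not only on
  \<open>cells\<close>, so that the monotonicity arguments can use the full pointwise order without
  membership conditions.\<close>

locale grid_market =
  fixes I :: "nat set" and G :: "nat set" and \<omega> :: "nat \<Rightarrow> real" and F :: "(nat \<Rightarrow> nat) \<Rightarrow> real"
  assumes finite_I: "finite I" and I_ne: "I \<noteq> {}" and finite_G: "finite G"
    and \<omega>_pos: "\<And>x. x \<in> G \<Longrightarrow> 0 < \<omega> x" and \<omega>_sum: "sum \<omega> G \<le> 1"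
    and F_nonneg: "\<And>c. 0 \<le> F c" and F_mono: "mono F"
begin

definition W :: "nat set \<Rightarrow> (nat \<Rightarrow> nat) \<Rightarrow> real" where
  "W J u = (\<Prod>k\<in>J. \<omega> (u k))"

abbreviation cells :: "nat set \<Rightarrow> (nat \<Rightarrow> nat) set" where
  "cells J \<equiv> PiE J (\<lambda>_. G)"

definition Z :: "(nat \<Rightarrow> (nat \<Rightarrow> nat) \<Rightarrow> real) \<Rightarrow> (nat \<Rightarrow> nat) \<Rightarrow> real" where
  "Z b c = (\<Sum>j\<in>I. b j (restrict c (I - {j})))"

definition R :: "(nat \<Rightarrow> (nat \<Rightarrow> nat) \<Rightarrow> real) \<Rightarrow> nat \<Rightarrow> (nat \<Rightarrow> nat) \<Rightarrow> real" where
  "R b i u = (\<Sum>x\<in>G. \<omega> x * (F (u(i := x)) / Z b (u(i := x))))"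

text \<open>
  The load of the line \<open>(i, u)\<close> is \<open>b i u * R b i u\<close>, so \<open>1 / max 1 R\<close> is the largest value in \<open>[0, 1]\<close>
  that does not overload it.
\<close>

definition rescale :: "real \<Rightarrow> (nat \<Rightarrow> (nat \<Rightarrow> nat) \<Rightarrow> real) \<Rightarrow> nat \<Rightarrow> (nat \<Rightarrow> nat) \<Rightarrow> real" where
  "rescale \<delta> b i u = max \<delta> (1 / max 1 (R b i u))"

text \<open>Merges \<open>b' \<le> b\<close> with antitonicity: for \<open>b' = b\<close> it says
  that \<open>b\<close> is antitone, for consecutive iterates also that the iteration decreases. One
  lemma on \<open>rescale\<close> then serves both inductions.\<close>

definition antitone_below ::
  "(nat \<Rightarrow> (nat \<Rightarrow> nat) \<Rightarrow> real) \<Rightarrow> (nat \<Rightarrow> (nat \<Rightarrow> nat) \<Rightarrow> real) \<Rightarrow> bool" where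
  "antitone_below b' b \<longleftrightarrow> (\<forall>j u v. u \<le> v \<longrightarrow> b' j v \<le> b j u)"

lemma finite_cells: "finite J \<Longrightarrow> finite (cells J)"
  using finite_G by (simp add: finite_PiE)

lemma W_pos: "u \<in> cells J \<Longrightarrow> 0 < W J u"
  unfolding W_def by (intro prod_pos) (auto intro: \<omega>_pos)

lemma W_update:
  assumes "i \<in> I" "u \<in> cells (I - {i})"
  shows "W I (u(i := x)) = W (I - {i}) u * \<omega> x"
proof -
  have "W I (u(i := x)) = \<omega> x * (\<Prod>k\<in>I - {i}. \<omega> ((u(i := x)) k))"
    unfolding W_def using finite_I assms(1) by (subst prod.remove[of _ i]) auto
  also have "(\<Prod>k\<in>I - {i}. \<omega> ((u(i := x)) k)) = W (I - {i}) u"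
    unfolding W_def by (intro prod.cong) auto
  finally show ?thesis by (simp only: mult.commute)
qed

lemma restrict_update:
  assumes "u \<in> cells (I - {i})"
  shows "restrict (u(i := x)) (I - {i}) = u"
  using assms by (auto simp: restrict_def PiE_def extensional_def fun_eq_iff)

lemma rescale_bounds: "\<delta> \<le> 1 \<Longrightarrow> \<delta> \<le> rescale \<delta> b i u \<and> rescale \<delta> b i u \<le> 1"
  unfolding rescale_def by (auto simp: field_simps)

lemma Z_ge:
  assumes "\<And>i u. \<delta> \<le> b i u" "\<delta> > 0"
  shows "\<delta> \<le> Z b c" and "j \<in> I \<Longrightarrow> b j (restrict c (I - {j})) \<le> Z b c"
proof -
  show *: "b j (restrict c (I - {j})) \<le> Z b c" if "j \<in> I" for j
    unfolding Z_def using finite_I that assms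
    by (intro member_le_sum) (auto intro: order_trans[OF less_imp_le])
  from I_ne obtain j where "j \<in> I" by auto
  then show "\<delta> \<le> Z b c" using * assms(1) order_trans by blast
qed

lemma restrict_le: "c \<le> d \<Longrightarrow> restrict c A \<le> restrict (d :: nat \<Rightarrow> nat) A"
  by (auto simp: le_fun_def restrict_def)

lemma Z_antitone:
  assumes "antitone_below b' b" "c \<le> d"
  shows "Z b' d \<le> Z b c"
  using assms restrict_le[OF assms(2)] unfolding Z_def antitone_below_def by (intro sum_mono) blast

text \<open>Passing to higher bids and to \<open>b'\<close> raises \<open>F\<close> and lowers the
  total \<open>Z\<close>; hence \<open>R\<close> grows and its truncated reciprocal falls. The floor
  \<delta> keeps \<open>Z\<close> positive, so that the quotients compare.\<close>

lemma rescale_antitone: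
  assumes ab: "antitone_below b' b" and lb: "\<And>i u. \<delta> \<le> b' i u" and "\<delta> > 0"
  shows "antitone_below (rescale \<delta> b') (rescale \<delta> b)"
  unfolding antitone_below_def
proof (intro allI impI)
  fix i and u v :: "nat \<Rightarrow> nat" assume "u \<le> v"
  have "R b i u \<le> R b' i v"
    unfolding R_def
  proof (intro sum_mono mult_left_mono)
    fix x assume x: "x \<in> G"
    have le: "u(i := x) \<le> v(i := x)" using \<open>u \<le> v\<close> by (auto simp: le_fun_def)
    have "0 < Z b' (v(i := x))" using Z_ge(1)[of \<delta> b'] lb \<open>\<delta> > 0\<close> by (smt (verit))
    then show "F (u(i := x)) / Z b (u(i := x)) \<le> F (v(i := x)) / Z b' (v(i := x))"
      using Z_antitone[OF ab le] monoD[OF F_mono le] F_nonneg by (intro frac_le) auto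
  qed (simp add: \<omega>_pos less_imp_le)
  then have "1 / max 1 (R b' i v) \<le> 1 / max 1 (R b i u)" by (intro divide_left_mono) auto
  then show "rescale \<delta> b' i v \<le> rescale \<delta> b i u" unfolding rescale_def by (simp add: max.coboundedI2)
qed

text \<open>The iteration starts from the largest value 1 and decreases, hence converges at every
  argument. The floor keeps the limit of \<open>Z\<close> away from 0, so \<open>R\<close> passes to
  the limit and the limit is a fixed point.\<close>

lemma fixpoint_exists:
  assumes "0 < \<delta>" "\<delta> \<le> 1"
  obtains b where "\<And>i u. \<delta> \<le> b i u" "antitone_below b b"
    "\<And>i u. b i u = rescale \<delta> b i u"
proof -
  define B where "B k = (rescale \<delta> ^^ k) (\<lambda>_ _. 1)" for k
  have B_Suc: "B (Suc k) = rescale \<delta> (B k)" for k by (simp add: B_def)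
  have bnd: "\<delta> \<le> B k i u \<and> B k i u \<le> 1" for k i u
    by (cases k) (use assms in \<open>simp_all add: B_def rescale_bounds\<close>)
  have anti: "antitone_below (B k) (B k)" for k
  proof (induction k)
    case 0 show ?case by (simp add: B_def antitone_below_def)
  next
    case (Suc k) then show ?case unfolding B_Suc using bnd assms by (intro rescale_antitone) auto
  qed
  have decr: "antitone_below (B (Suc k)) (B k)" for k
  proof (induction k)
    case 0 show ?case using bnd by (simp add: B_def antitone_below_def rescale_bounds assms)
  next
    case (Suc k) then show ?case unfolding B_Suc[of k] B_Suc[of "Suc k"]
      using bnd[of "Suc k"] assms by (intro rescale_antitone) (auto simp: B_Suc)
  qed
  have "decseq (\<lambda>k. B k i u)" for i u
    using decr by (intro decseq_SucI) (auto simp: antitone_below_def)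
  then have "\<exists>l. (\<lambda>k. B k i u) \<longlonglongrightarrow> l" for i u
    using bnd by (metis decseq_convergent)
  then obtain b where lim: "\<And>i u. (\<lambda>k. B k i u) \<longlonglongrightarrow> b i u" by metis
  have lb: "\<delta> \<le> b i u" for i u
    using bnd by (auto intro!: LIMSEQ_le_const[OF lim])
  have anti_b: "antitone_below b b"
    unfolding antitone_below_def using anti by (auto intro!: LIMSEQ_le[OF lim lim] simp: antitone_below_def)
  have Zlim: "(\<lambda>k. Z (B k) c) \<longlonglongrightarrow> Z b c" for c
    unfolding Z_def by (intro tendsto_sum lim)
  have "Z b c \<noteq> 0" for c using Z_ge(1)[of \<delta> b c] lb assms by auto
  then have "(\<lambda>k. R (B k) i u) \<longlonglongrightarrow> R b i u" for i u
    unfolding R_def by (intro tendsto_intros Zlim)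
  then have "(\<lambda>k. B (Suc k) i u) \<longlonglongrightarrow> rescale \<delta> b i u" for i u
    unfolding B_Suc rescale_def by (intro tendsto_intros) auto
  then have "b i u = rescale \<delta> b i u" for i u
    using LIMSEQ_unique LIMSEQ_Suc[OF lim] by blast
  then show ?thesis using that lb anti_b by blast
qed

section \<open>Shares and loads of the lines of the grid\<close>

definition share :: "(nat \<Rightarrow> (nat \<Rightarrow> nat) \<Rightarrow> real) \<Rightarrow> nat \<Rightarrow> (nat \<Rightarrow> nat) \<Rightarrow> nat \<Rightarrow> real" where
  "share b i u x = F (u(i := x)) * b i u / Z b (u(i := x))"

definition load :: "(nat \<Rightarrow> (nat \<Rightarrow> nat) \<Rightarrow> real) \<Rightarrow> nat \<Rightarrow> (nat \<Rightarrow> nat) \<Rightarrow> real" where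
  "load b i u = (\<Sum>x\<in>G. \<omega> x * share b i u x)"

text \<open>The discrete counterpart of \<open>projection\<close>.\<close>

definition face :: "nat \<Rightarrow> (nat \<Rightarrow> nat) set \<Rightarrow> (nat \<Rightarrow> nat) set" where
  "face i T = {u \<in> cells (I - {i}). \<exists>x\<in>G. u(i := x) \<in> T}"

lemma load_eq: "load b i u = b i u * R b i u"
  unfolding load_def share_def R_def by (simp add: sum_distrib_left field_simps)

end

lemma telescoping_bound:
  fixes g :: "nat \<Rightarrow> real"
  assumes "\<And>l. l < L \<Longrightarrow> V \<le> g l - g (Suc l) + e" "g 0 \<le> \<Gamma>" "0 \<le> g L"
  shows "real L * V \<le> \<Gamma> + real L * e"
proof -
  have "real L * V = (\<Sum>l<L. V)" by simp
  also have "\<dots> \<le> (\<Sum>l<L. g l - g (Suc l) + e)" by (intro sum_mono assms(1)) simp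
  also have "\<dots> = g 0 - g L + real L * e"
    by (simp add: sum.distrib sum_lessThan_telescope')
  finally show ?thesis using assms by simp
qed

text \<open>\<open>hall\<close> is the integral bound for unions of cells. It covers upward closed
  sets only, so every set it is applied to has to come from a monotone quantity.\<close>

locale grid_market_hall = grid_market +
  assumes hall: "\<And>T. T \<subseteq> cells I \<Longrightarrow> (\<And>c d. c \<in> T \<Longrightarrow> d \<in> cells I \<Longrightarrow> c \<le> d \<Longrightarrow> d \<in> T) \<Longrightarrow>
      (\<Sum>c\<in>T. F c * W I c) \<le> (\<Sum>i\<in>I. \<Sum>u\<in>face i T. W (I - {i}) u)"
begin

context
  fixes b \<delta> assumes \<delta>: "0 < \<delta>" "\<delta> \<le> 1" and b_lb: "\<And>i u. \<delta> \<le> b i u" and b_anti: "antitone_below b b" and b_fix: "\<And>i u. b i u = rescale \<delta> b i u"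
begin

lemma Z_pos: "0 < Z b c"
  using Z_ge(1)[of \<delta> b c] b_lb \<delta> by simp

lemma b_pos: "0 < b i u"
  using b_lb[of i u] \<delta> by simp

lemma share_nonneg: "0 \<le> share b i u x"
  unfolding share_def using F_nonneg b_pos Z_pos by (simp add: less_imp_le)

text \<open>Along the line \<open>F\<close> grows and \<open>Z\<close> shrinks while
  \<open>b i u\<close> stays fixed. This is the monotonicity in the own bid without which no random
  price could realize the payments.\<close>

lemma share_mono: "mono (share b i u)"
proof (rule monoI)
  fix x y :: nat assume "x \<le> y"
  then have le: "u(i := x) \<le> u(i := y)" by (auto simp: le_fun_def)
  show "share b i u x \<le> share b i u y"
    unfolding share_def using Z_antitone[OF b_anti le] monoD[OF F_mono le] Z_pos b_pos F_nonneg
    by (intro frac_le mult_right_mono mult_nonneg_nonneg) (auto simp: less_imp_le)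
qed

lemma share_sum:
  assumes "c \<in> cells I"
  shows "(\<Sum>i\<in>I. share b i (restrict c (I - {i})) (c i)) = F c"
proof -
  have "(restrict c (I - {i}))(i := c i) = c" if "i \<in> I" for i
    using assms that by (auto simp: fun_eq_iff restrict_def PiE_def extensional_def)
  then have "(\<Sum>i\<in>I. share b i (restrict c (I - {i})) (c i))
      = (\<Sum>i\<in>I. F c / Z b c * b i (restrict c (I - {i})))"
    unfolding share_def by (intro sum.cong) auto
  also have "\<dots> = F c / Z b c * Z b c" by (simp add: Z_def sum_distrib_left)
  finally show ?thesis using Z_pos[of c] by simp
qed

text \<open>A value below 1 is at least \<open>1 / R\<close> with \<open>R > 1\<close>: it equals
  \<open>1 / R\<close>, or the floor stopped it before it got there.\<close>

lemma load_ge_1: "b i u < 1 \<Longrightarrow> 1 \<le> load b i u"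
proof -
  assume "b i u < 1"
  then have 1: "1 / max 1 (R b i u) \<le> b i u" "1 / max 1 (R b i u) < 1"
    using b_fix[of i u] unfolding rescale_def by linarith+
  then have "R b i u > 1" by (cases "R b i u \<le> 1") auto
  then show ?thesis using 1 by (simp add: load_eq field_simps)
qed

text \<open>Off the floor, the value is exactly the largest one that does not overload the
  line.\<close>

lemma load_le_1: "\<delta> < b i u \<Longrightarrow> load b i u \<le> 1"
proof -
  assume "\<delta> < b i u"
  then have "b i u = 1 / max 1 (R b i u)"
    using b_fix[of i u] unfolding rescale_def by linarith
  then have "load b i u = R b i u / max 1 (R b i u)" by (simp add: load_eq)
  moreover have "0 < max 1 (R b i u)" by (simp add: less_max_iff_disj)
  ultimately show ?thesis by (simp add: pos_divide_le_eq)
qed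

definition overload :: real where
  "overload = (\<Sum>i\<in>I. \<Sum>u\<in>cells (I - {i}). W (I - {i}) u * max 0 (load b i u - 1))"

definition scarce :: "nat \<Rightarrow> real \<Rightarrow> (nat \<Rightarrow> nat) set" where
  "scarce i \<theta> = {u \<in> cells (I - {i}). b i u < \<theta>}"

definition scarce_weight :: "real \<Rightarrow> real" where
  "scarce_weight \<theta> = (\<Sum>i\<in>I. \<Sum>u\<in>scarce i \<theta>. W (I - {i}) u)"

lemma scarce_finite: "finite (scarce i \<theta>)"
  unfolding scarce_def using finite_cells finite_I by simp

text \<open>Compares two scales. A line with \<open>b < \<theta>\<close> earns at most
  \<open>\<theta> / \<eta> * B\<close> on a cell with \<open>Z \<ge> \<eta>\<close>. The revenue on
  the remaining cells \<open>T\<close> is bounded by \<open>hall\<close>, and every line that meets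
  \<open>T\<close> satisfies \<open>b \<le> Z < \<eta>\<close>, so the faces of \<open>T\<close>
  weigh at most \<open>scarce_weight \<eta>\<close>. Subtracting capacity 1 for each line with
  \<open>b < \<theta>\<close> leaves the stated difference.\<close>

lemma overload_step:
  assumes \<theta>: "\<delta> < \<theta>" "\<theta> \<le> 1" and \<eta>: "0 < \<eta>"
    and B: "\<And>c. c \<in> cells I \<Longrightarrow> F c \<le> B" "0 \<le> B"
  shows "overload \<le> scarce_weight \<eta> - scarce_weight \<theta> + \<theta> / \<eta> * B * scarce_weight \<theta>"
proof -
  define T where "T = {c \<in> cells I. Z b c < \<eta>}"
  have Wn: "0 \<le> W (I - {i}) u" if "u \<in> cells (I - {i})" for i u using W_pos[OF that] by simp
  have T: "T \<subseteq> cells I" "finite T" using finite_cells[OF finite_I] by (auto simp: T_def)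
  \<comment> \<open>Lines with \<open>b \<ge> \<theta> > \<delta>\<close> are not overloaded; the
    others have \<open>b < 1\<close>, hence load at least 1, and the truncation at 0
    disappears.\<close>
  have "overload \<le> (\<Sum>i\<in>I. \<Sum>u\<in>scarce i \<theta>. W (I - {i}) u * (load b i u - 1))"
    unfolding overload_def
  proof (intro sum_mono)
    fix i assume "i \<in> I"
    have "(\<Sum>u\<in>cells (I - {i}). W (I - {i}) u * max 0 (load b i u - 1))
      = (\<Sum>u\<in>scarce i \<theta>. W (I - {i}) u * max 0 (load b i u - 1))"
    proof (intro sum.mono_neutral_right finite_cells ballI)
      fix u assume "u \<in> cells (I - {i}) - scarce i \<theta>"
      then have "\<not> b i u < \<theta>" unfolding scarce_def by blast
      then have "\<delta> < b i u" using \<theta>(1) by linarith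
      then show "W (I - {i}) u * max 0 (load b i u - 1) = 0" using load_le_1[of i u] by simp
    qed (use finite_I in \<open>auto simp: scarce_def\<close>)
    also have "\<dots> = (\<Sum>u\<in>scarce i \<theta>. W (I - {i}) u * (load b i u - 1))"
      using load_ge_1 \<theta> by (intro sum.cong) (auto simp: scarce_def max_def)
    finally show "(\<Sum>u\<in>cells (I - {i}). W (I - {i}) u * max 0 (load b i u - 1))
      \<le> (\<Sum>u\<in>scarce i \<theta>. W (I - {i}) u * (load b i u - 1))" by simp
  qed
  moreover have "(\<Sum>i\<in>I. \<Sum>u\<in>scarce i \<theta>. W (I - {i}) u * (load b i u - \<theta> / \<eta> * B)) \<le> scarce_weight \<eta>"
  proof -
    have "(\<Sum>i\<in>I. \<Sum>u\<in>scarce i \<theta>. W (I - {i}) u * (load b i u - \<theta> / \<eta> * B))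
      \<le> (\<Sum>i\<in>I. \<Sum>u\<in>cells (I - {i}). \<Sum>x\<in>G.
            if u(i := x) \<in> T then share b i u x * W I (u(i := x)) else 0)"
    proof (intro sum_mono)
      fix i assume i: "i \<in> I"
      have "(\<Sum>u\<in>scarce i \<theta>. W (I - {i}) u * (load b i u - \<theta> / \<eta> * B))
         \<le> (\<Sum>u\<in>scarce i \<theta>. \<Sum>x\<in>G. if u(i := x) \<in> T then share b i u x * W I (u(i := x)) else 0)"
      proof (intro sum_mono)
        fix u assume u: "u \<in> scarce i \<theta>"
        then have uc: "u \<in> cells (I - {i})" and ub: "b i u < \<theta>" by (auto simp: scarce_def)
        have "load b i u - \<theta> / \<eta> * B \<le> load b i u - (\<Sum>x\<in>G. \<omega> x * (\<theta> / \<eta> * B))"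
        proof -
          have "(\<Sum>x\<in>G. \<omega> x * (\<theta> / \<eta> * B)) = sum \<omega> G * (\<theta> / \<eta> * B)"
            by (simp only: sum_distrib_right)
          also have "\<dots> \<le> 1 * (\<theta> / \<eta> * B)" using \<omega>_sum B \<theta> \<eta> \<delta> by (intro mult_right_mono) auto
          finally show ?thesis by simp
        qed
        also have "\<dots> = (\<Sum>x\<in>G. \<omega> x * (share b i u x - \<theta> / \<eta> * B))"
          by (simp add: load_def sum_subtractf right_diff_distrib)
        also have "\<dots> \<le> (\<Sum>x\<in>G. \<omega> x * (if u(i := x) \<in> T then share b i u x else 0))"
        proof (intro sum_mono mult_left_mono)
          fix x assume x: "x \<in> G"
          have c: "u(i := x) \<in> cells I" using uc x i by (auto simp: PiE_def extensional_def Pi_def)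
          show "share b i u x - \<theta> / \<eta> * B \<le> (if u(i := x) \<in> T then share b i u x else 0)"
          proof (cases "u(i := x) \<in> T")
            case True then show ?thesis using \<theta> \<eta> \<delta> B by simp
          next
            case False
            then have "\<eta> \<le> Z b (u(i := x))" using c by (simp add: T_def)
            then have "share b i u x \<le> (B * \<theta>) / \<eta>"
              unfolding share_def using B(1)[OF c] ub \<eta> b_pos[of i u] F_nonneg B(2)
              by (intro frac_le mult_mono) auto
            then show ?thesis using False by (simp add: mult.commute)
          qed
        qed (simp add: \<omega>_pos less_imp_le)
        finally have "W (I - {i}) u * (load b i u - \<theta> / \<eta> * B)
            \<le> W (I - {i}) u * (\<Sum>x\<in>G. \<omega> x * (if u(i := x) \<in> T then share b i u x else 0))"
          by (intro mult_left_mono Wn uc)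
        also have "\<dots> = (\<Sum>x\<in>G. if u(i := x) \<in> T then share b i u x * W I (u(i := x)) else 0)"
          unfolding sum_distrib_left by (intro sum.cong) (auto simp: W_update[OF i uc])
        finally show "W (I - {i}) u * (load b i u - \<theta> / \<eta> * B)
            \<le> (\<Sum>x\<in>G. if u(i := x) \<in> T then share b i u x * W I (u(i := x)) else 0)" .
      qed
      also have "\<dots> \<le> (\<Sum>u\<in>cells (I - {i}). \<Sum>x\<in>G. if u(i := x) \<in> T then share b i u x * W I (u(i := x)) else 0)"
        using T finite_I share_nonneg by (intro sum_mono2 finite_cells sum_nonneg) 
          (auto simp: scarce_def intro!: mult_nonneg_nonneg less_imp_le[OF W_pos])
      finally show "(\<Sum>u\<in>scarce i \<theta>. W (I - {i}) u * (load b i u - \<theta> / \<eta> * B)) \<le> \<dots>" .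
    qed
    \<comment> \<open>Regrouping lines into cells lets the shares of all bidders at a cell of
      \<open>T\<close> add up to \<open>F\<close>.\<close>
    also have "\<dots> = (\<Sum>i\<in>I. \<Sum>c\<in>cells I. if c \<in> T then share b i (restrict c (I - {i})) (c i) * W I c else 0)"
    proof (rule sum.cong[OF refl])
      fix i assume i: "i \<in> I"
      show "(\<Sum>u\<in>cells (I - {i}). \<Sum>x\<in>G. if u(i := x) \<in> T then share b i u x * W I (u(i := x)) else 0)
        = (\<Sum>c\<in>cells I. if c \<in> T then share b i (restrict c (I - {i})) (c i) * W I c else 0)"
        by (subst sum_PiE_split[OF i]) (intro sum.cong refl, simp add: restrict_update)
    qed
    also have "\<dots> = (\<Sum>c\<in>cells I. if c \<in> T then F c * W I c else 0)"
      by (subst sum.swap) (intro sum.cong refl, auto simp: share_sum simp flip: sum_distrib_right)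
    also have "\<dots> = (\<Sum>c\<in>T. F c * W I c)"
      using T finite_cells[OF finite_I] by (subst sum.inter_restrict[symmetric]) (auto simp: Int_absorb1)
    \<comment> \<open>\<open>T\<close> is upward closed because \<open>Z\<close> is
      antitone.\<close>
    also have "\<dots> \<le> (\<Sum>i\<in>I. \<Sum>u\<in>face i T. W (I - {i}) u)"
      using Z_antitone[OF b_anti] by (intro hall) (auto simp: T_def intro: le_less_trans)
    also have "\<dots> \<le> scarce_weight \<eta>"
      unfolding scarce_weight_def
    proof (intro sum_mono sum_mono2 scarce_finite)
      fix i assume i: "i \<in> I"
      show "face i T \<subseteq> scarce i \<eta>"
      proof
        fix u assume "u \<in> face i T"
        then obtain x where u: "u \<in> cells (I - {i})" and x: "Z b (u(i := x)) < \<eta>"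
          by (auto simp: face_def T_def)
        have "b i u \<le> Z b (u(i := x))"
          using Z_ge(2)[OF b_lb \<delta>(1) i, where c = "u(i := x)"] by (simp add: restrict_update[OF u])
        then show "u \<in> scarce i \<eta>" using u x by (simp add: scarce_def)
      qed
    qed (auto simp: scarce_def Wn)
    finally show ?thesis .
  qed
  moreover have "(\<Sum>i\<in>I. \<Sum>u\<in>scarce i \<theta>. W (I - {i}) u * (load b i u - \<theta> / \<eta> * B))
      = (\<Sum>i\<in>I. \<Sum>u\<in>scarce i \<theta>. W (I - {i}) u * (load b i u - 1))
        + scarce_weight \<theta> - \<theta> / \<eta> * B * scarce_weight \<theta>"
  proof -
    have "W (I - {i}) u * (load b i u - \<theta> / \<eta> * B)
      = W (I - {i}) u * (load b i u - 1) + W (I - {i}) u - \<theta> / \<eta> * B * W (I - {i}) u" for i u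
      by (simp add: algebra_simps)
    then show ?thesis
      by (simp only: sum.distrib sum_subtractf scarce_weight_def sum_distrib_left)
  qed
  ultimately show ?thesis by linarith
qed

end

text \<open>With \<open>\<eta> = \<rho> ^ l\<close> and \<open>\<theta> = \<rho> ^ Suc l\<close>,
  \<open>overload_step\<close> telescopes to
  \<open>overload \<le> \<Gamma> / L + \<rho> * B * \<Gamma>\<close>. Dividing this total by the
  least weight \<open>w\<close> of a line bounds the excess on every single line.\<close>

theorem balanced_shares_exist:
  assumes "0 < \<epsilon>"
  obtains q :: "nat \<Rightarrow> (nat \<Rightarrow> nat) \<Rightarrow> nat \<Rightarrow> real" where
    "\<And>i u x. 0 \<le> q i u x" "\<And>i u. mono (q i u)"
    "\<And>c. c \<in> cells I \<Longrightarrow> (\<Sum>i\<in>I. q i (restrict c (I - {i})) (c i)) = F c"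
    "\<And>i u. i \<in> I \<Longrightarrow> u \<in> cells (I - {i}) \<Longrightarrow> (\<Sum>x\<in>G. \<omega> x * q i u x) \<le> 1 + \<epsilon>"
proof -
  define B where "B = Max (insert 0 (F ` cells I))"
  have B: "F c \<le> B" if "c \<in> cells I" for c
    unfolding B_def using that finite_cells[OF finite_I] by (intro Max_ge) auto
  have B0: "0 \<le> B" unfolding B_def using finite_cells[OF finite_I] by (intro Max_ge) auto
  define \<Gamma> where "\<Gamma> = 1 + (\<Sum>i\<in>I. \<Sum>u\<in>cells (I - {i}). W (I - {i}) u)"
  have Wn: "0 \<le> W (I - {i}) u" if "u \<in> cells (I - {i})" for i u using W_pos[OF that] by simp
  have \<Gamma>: "1 \<le> \<Gamma>" unfolding \<Gamma>_def by (auto intro!: sum_nonneg Wn)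
  define w where "w = Min (insert 1 (\<Union>i\<in>I. W (I - {i}) ` cells (I - {i})))"
  have fin: "finite (insert 1 (\<Union>i\<in>I. W (I - {i}) ` cells (I - {i})))"
    using finite_I by (auto intro!: finite_cells)
  have w: "0 < w" unfolding w_def using fin W_pos by (subst Min_gr_iff) auto
  have w_le: "w \<le> W (I - {i}) u" if "i \<in> I" "u \<in> cells (I - {i})" for i u
    unfolding w_def using fin that by (intro Min_le) auto
  \<comment> \<open>Makes the error \<open>\<rho> * B * \<Gamma>\<close> at most
    \<open>\<epsilon> * w / 2\<close>; \<open>B + 1\<close> covers the case \<open>B = 0\<close>,
    and \<open>1/2\<close> keeps \<rho> below 1.\<close>
  define \<rho> where "\<rho> = min (1/2) (\<epsilon> * w / (2 * (B + 1) * \<Gamma>))"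
  have \<rho>: "0 < \<rho>" "\<rho> < 1" "\<rho> * B * \<Gamma> \<le> \<epsilon> * w / 2"
  proof -
    show "0 < \<rho>" "\<rho> < 1" using assms w B0 \<Gamma> by (auto simp: \<rho>_def)
    then have "\<rho> * B * \<Gamma> \<le> \<rho> * (B + 1) * \<Gamma>" using \<Gamma> by (intro mult_right_mono) auto
    also have "\<dots> \<le> (\<epsilon> * w / (2 * (B + 1) * \<Gamma>)) * (B + 1) * \<Gamma>"
      using B0 \<Gamma> by (intro mult_right_mono) (auto simp: \<rho>_def)
    also have "\<dots> = \<epsilon> * w * ((B + 1) * \<Gamma>) / (2 * ((B + 1) * \<Gamma>))" by (simp add: mult_ac)
    also have "\<dots> = \<epsilon> * w / 2"
    proof -
      have "(B + 1) * \<Gamma> \<noteq> 0" using B0 \<Gamma> by simp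
      then show ?thesis by (simp only: times_divide_times_eq[symmetric] mult.commute[of 2]) simp
    qed
    finally show "\<rho> * B * \<Gamma> \<le> \<epsilon> * w / 2" .
  qed
  \<comment> \<open>The other half of the tolerance:
    \<open>\<Gamma> / L < \<epsilon> * w / 2\<close>.\<close>
  obtain L :: nat where L: "2 * \<Gamma> / (\<epsilon> * w) < real L" using reals_Archimedean2 by blast
  have L0: "0 < real L" using L \<Gamma> assms w by (smt (verit) divide_pos_pos mult_pos_pos)
  \<comment> \<open>One power beyond the last scale, so that \<open>\<rho> ^ Suc l\<close> is
    strictly above the floor for all \<open>l < L\<close>.\<close>
  define \<delta> where "\<delta> = \<rho> ^ (L + 1)"
  have \<delta>: "0 < \<delta>" "\<delta> \<le> 1" unfolding \<delta>_def using \<rho> power_le_one[of \<rho> "L + 1"] by auto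
  obtain b where b: "\<And>i u. \<delta> \<le> b i u" "antitone_below b b"
    "\<And>i u. b i u = rescale \<delta> b i u" by (rule fixpoint_exists[OF \<delta>]) blast
  note facts = \<delta> b(1) b(2) b(3)
  let ?V = "overload b" and ?g = "scarce_weight b"
  have sc: "0 \<le> ?g \<theta>" "?g \<theta> \<le> \<Gamma>" for \<theta>
  proof -
    show "0 \<le> ?g \<theta>"
      unfolding scarce_weight_def[OF facts] by (intro sum_nonneg Wn) (auto simp: scarce_def[OF facts])
    have "?g \<theta> \<le> (\<Sum>i\<in>I. \<Sum>u\<in>cells (I - {i}). W (I - {i}) u)"
      unfolding scarce_weight_def[OF facts] using finite_I
      by (intro sum_mono sum_mono2 finite_cells Wn) (auto simp: scarce_def[OF facts])
    then show "?g \<theta> \<le> \<Gamma>" by (simp add: \<Gamma>_def)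
  qed
  have "real L * ?V \<le> \<Gamma> + real L * (\<rho> * B * \<Gamma>)"
  proof (rule telescoping_bound[where g = "\<lambda>l. ?g (\<rho> ^ l)"])
    fix l assume "l < L"
    then have "\<delta> < \<rho> ^ Suc l" unfolding \<delta>_def using \<rho> by (intro power_strict_decreasing) auto
    moreover have "\<rho> ^ Suc l \<le> 1" using \<rho> by (intro power_le_one) auto
    ultimately have "?V \<le> ?g (\<rho> ^ l) - ?g (\<rho> ^ Suc l) + \<rho> ^ Suc l / \<rho> ^ l * B * ?g (\<rho> ^ Suc l)"
      using \<rho> B B0 by (intro overload_step[OF facts]) auto
    also have "\<rho> ^ Suc l / \<rho> ^ l * B * ?g (\<rho> ^ Suc l) \<le> \<rho> * B * \<Gamma>"
      using \<rho> B0 sc by (simp add: mult_left_mono)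
    finally show "?V \<le> ?g (\<rho> ^ l) - ?g (\<rho> ^ Suc l) + \<rho> * B * \<Gamma>" by simp
  qed (auto simp: sc)
  also have "\<dots> \<le> real L * (\<epsilon> * w)"
  proof -
    have "\<Gamma> \<le> real L * (\<epsilon> * w / 2)" using L assms w by (simp add: field_simps)
    moreover have "real L * (\<rho> * B * \<Gamma>) \<le> real L * (\<epsilon> * w / 2)" using \<rho> L0 by (intro mult_left_mono) auto
    ultimately show ?thesis by (simp add: field_simps)
  qed
  finally have V: "?V \<le> \<epsilon> * w" using L0 by simp
  show ?thesis
  proof (rule that[of "share b"])
    fix i u assume i: "i \<in> I" and u: "u \<in> cells (I - {i})"
    have "w * (load b i u - 1) \<le> w * max 0 (load b i u - 1)"
      using w by (intro mult_left_mono) auto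
    also have "\<dots> \<le> W (I - {i}) u * max 0 (load b i u - 1)" using w_le[OF i u] by (intro mult_right_mono) auto
    also have "\<dots> \<le> (\<Sum>u\<in>cells (I - {i}). W (I - {i}) u * max 0 (load b i u - 1))"
      using u finite_I Wn by (intro member_le_sum finite_cells) auto
    also have "\<dots> \<le> ?V" unfolding overload_def[OF facts]
      using i finite_I Wn by (intro member_le_sum[of i I "\<lambda>i. \<Sum>u\<in>cells (I - {i}). W (I - {i}) u * max 0 (load b i u - 1)"])
        (auto intro!: sum_nonneg)
    also have "\<dots> \<le> w * \<epsilon>" using V by (simp add: mult.commute)
    finally have "load b i u - 1 \<le> \<epsilon>" using w by simp
    then show "(\<Sum>x\<in>G. \<omega> x * share b i u x) \<le> 1 + \<epsilon>" by (simp add: load_def)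
  qed (use share_nonneg[OF facts] share_mono[OF facts] share_sum[OF facts] in auto)
qed

end

section \<open>The bid measure\<close>

abbreviation half_line :: "real measure" where
  "half_line \<equiv> restrict_space lborel {1..}"

interpretation half_line: sigma_finite_measure half_line
  by (intro sigma_finite_measure_restrict_space) (auto intro: sigma_finite_lborel)

interpretation half_lines: product_sigma_finite "\<lambda>_ :: nat. half_line"
  by unfold_locales

lemma space_bids [simp]: "space (bid_measure J) = bid_vectors J"
  by (simp add: bid_measure_def bid_vectors_def space_PiM space_restrict_space)

lemma sigma_finite_bids: "finite J \<Longrightarrow> sigma_finite_measure (bid_measure J)"
  unfolding bid_measure_def by (rule half_lines.sigma_finite)

lemma measurable_bid: "k \<in> J \<Longrightarrow> (\<lambda>v. v k) \<in> borel_measurable (bid_measure J)"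
  unfolding bid_measure_def
  by (rule measurable_compose[OF measurable_component_singleton])
     (auto intro: measurable_restrict_space1)

lemma measurable_weight [measurable]: "weight J \<in> borel_measurable (bid_measure J)"
  unfolding weight_def
  by (intro borel_measurable_prod borel_measurable_divide borel_measurable_const borel_measurable_power measurable_bid)

lemma weight_pos: "v \<in> bid_vectors J \<Longrightarrow> 0 < weight J v"
  unfolding weight_def bid_vectors_def by (intro prod_pos) (auto simp: PiE_iff dest!: bspec)

lemma weight_update:
  assumes "finite J" "i \<in> J"
  shows "weight J (u(i := x)) = weight (J - {i}) u * (1 / x\<^sup>2)"
proof -
  have "weight J (u(i := x)) = 1 / x\<^sup>2 * (\<Prod>k\<in>J - {i}. 1 / ((u(i := x)) k)\<^sup>2)"
    unfolding weight_def using assms by (subst prod.remove[of _ i]) auto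
  also have "(\<Prod>k\<in>J - {i}. 1 / ((u(i := x)) k)\<^sup>2) = weight (J - {i}) u"
    unfolding weight_def by (intro prod.cong) auto
  finally show ?thesis by (simp only: mult.commute)
qed

lemma drop_bid_update:
  "u \<in> bid_vectors ({1..n} - {i}) \<Longrightarrow> drop_bid n i (u(i := x)) = u"
  by (auto simp: drop_bid_def restrict_def bid_vectors_def PiE_def extensional_def fun_eq_iff)

lemma drop_bid_in: "v \<in> bid_vectors {1..n} \<Longrightarrow> drop_bid n i v \<in> bid_vectors ({1..n} - {i})"
  by (auto simp: drop_bid_def bid_vectors_def)

lemma measurable_drop_bid [measurable]:
  "drop_bid n i \<in> bid_measure {1..n} \<rightarrow>\<^sub>M bid_measure ({1..n} - {i})"
  unfolding drop_bid_def bid_measure_def by (intro measurable_restrict_subset) auto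

lemma measurable_update_bid:
  assumes "i \<in> {1..n}"
  shows "(\<lambda>(u, x). u(i := x)) \<in> bid_measure ({1..n} - {i}) \<Otimes>\<^sub>M half_line \<rightarrow>\<^sub>M bid_measure {1..n}"
proof -
  have "insert i ({1..n} - {i}) = {1..n}" using assms by auto
  then show ?thesis
    using measurable_add_dim[of i "{1..n} - {i}" "\<lambda>_. half_line"] by (simp add: bid_measure_def)
qed

lemma nn_integral_bids_split:
  assumes "i \<in> {1..n}" "h \<in> borel_measurable (bid_measure {1..n})"
  shows "(\<integral>\<^sup>+ v. h v \<partial>bid_measure {1..n})
    = (\<integral>\<^sup>+ u. (\<integral>\<^sup>+ x. h (u(i := x)) \<partial>half_line) \<partial>bid_measure ({1..n} - {i}))"
proof -
  have "insert i ({1..n} - {i}) = {1..n}" using assms by auto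
  then show ?thesis
    using half_lines.product_nn_integral_insert[of "{1..n} - {i}" i h] assms(2)
    by (simp add: bid_measure_def)
qed

text \<open>By Fubini, a cylinder over a null set is null.\<close>

lemma AE_bids_drop:
  assumes "i \<in> {1..n}" "AE u in bid_measure ({1..n} - {i}). P u"
  shows "AE v in bid_measure {1..n}. P (drop_bid n i v)"
proof -
  from assms(2) obtain N where N: "N \<in> null_sets (bid_measure ({1..n} - {i}))"
    "{u \<in> bid_vectors ({1..n} - {i}). \<not> P u} \<subseteq> N"
    by (auto simp: eventually_ae_filter)
  let ?N = "drop_bid n i -` N \<inter> bid_vectors {1..n}"
  have N': "N \<in> sets (bid_measure ({1..n} - {i}))" using N by auto
  have sets: "?N \<in> sets (bid_measure {1..n})"
    using measurable_sets[OF measurable_drop_bid N'] by simp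
  have "emeasure (bid_measure {1..n}) ?N = (\<integral>\<^sup>+ v. indicator ?N v \<partial>bid_measure {1..n})"
    using sets by simp
  also have "\<dots> = (\<integral>\<^sup>+ u. (\<integral>\<^sup>+ x. indicator ?N (u(i := x)) \<partial>half_line) \<partial>bid_measure ({1..n} - {i}))"
    using sets assms by (subst nn_integral_bids_split[of i]) auto
  also have "\<dots> = (\<integral>\<^sup>+ u. 0 \<partial>bid_measure ({1..n} - {i}))"
  proof (rule nn_integral_cong_AE)
    show "AE u in bid_measure ({1..n} - {i}). (\<integral>\<^sup>+ x. indicator ?N (u(i := x)) \<partial>half_line) = 0"
      using AE_not_in[OF N(1)] AE_space
      by eventually_elim (auto intro!: nn_integral_zero' simp: drop_bid_update indicator_def)
  qed
  finally have "?N \<in> null_sets (bid_measure {1..n})" using sets by auto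
  then have "AE v in bid_measure {1..n}. v \<notin> ?N" by (rule AE_not_in)
  then show ?thesis
    using AE_space by eventually_elim (use N drop_bid_in in auto)
qed

section \<open>Prices from revenue curves\<close>

text \<open>
  If the expected payment at every bid \<open>x \<ge> 1\<close> is \<open>q x\<close>, then the price is at most \<open>x\<close> with
  probability \<open>\<integral> dq(y)/y\<close> over \<open>[1, x]\<close>, which is \<open>price_cdf q x\<close> by integration by parts. Hence
  \<open>q\<close> comes from a random price iff \<open>\<integral> q(y)/y\<^sup>2 dy \<le> 1\<close>.
\<close>

definition revenue_curve :: "(real \<Rightarrow> real) \<Rightarrow> bool" where
  "revenue_curve q \<longleftrightarrow> mono q \<and> (\<forall>x. 0 \<le> q x) \<and>
     (\<integral>\<^sup>+ y\<in>{1..}. ennreal (q y / y\<^sup>2) \<partial>lborel) \<le> 1"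

definition price_cdf :: "(real \<Rightarrow> real) \<Rightarrow> real \<Rightarrow> real" where
  "price_cdf q x = enn2real (\<integral>\<^sup>+ y\<in>{1..}. ennreal (q (min x y) / y\<^sup>2) \<partial>lborel)"

text \<open>For \<open>c\<close> above all values of the distribution function the infimum of the
  empty set is the price \<infinity>, that is, no sale. This takes up the mass that is missing when
  the integral of the curve is below 1.\<close>

definition price_quantile :: "(real \<Rightarrow> real) \<Rightarrow> real \<Rightarrow> ennreal" where
  "price_quantile q c = Inf {ennreal x | x. 1 \<le> x \<and> c \<le> price_cdf q x}"

lemma nn_integral_inverse_square:
  assumes "0 < x"
  shows "(\<integral>\<^sup>+ y\<in>{x..}. ennreal (1 / y\<^sup>2) \<partial>lborel) = ennreal (1 / x)"
proof -
  have lim: "((\<lambda>y. - 1 / y) \<longlongrightarrow> 0) (at_top :: real filter)" by real_asymp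
  have der: "((\<lambda>y. - 1 / y) has_real_derivative 1 / y\<^sup>2) (at y)" if "x \<le> y" for y
    using assms that by (auto intro!: derivative_eq_intros simp: power2_eq_square)
  show ?thesis
    using nn_integral_FTC_atLeast[OF _ der _ lim] by simp
qed

lemma nn_integral_Icc_Ioi:
  fixes x :: real and f :: "real \<Rightarrow> ennreal"
  assumes "1 \<le> x" and [measurable]: "f \<in> borel_measurable borel"
  shows "(\<integral>\<^sup>+ y\<in>{1..}. f y \<partial>lborel) = (\<integral>\<^sup>+ y\<in>{1..x}. f y \<partial>lborel) + (\<integral>\<^sup>+ y\<in>{x..}. f y \<partial>lborel)"
proof -
  have "AE y in lborel. y \<noteq> x" by (rule AE_lborel_singleton)
  then have "(\<integral>\<^sup>+ y\<in>{1..}. f y \<partial>lborel) = (\<integral>\<^sup>+ y. f y * indicator {1..x} y + f y * indicator {x..} y \<partial>lborel)"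
    using assms(1) by (intro nn_integral_cong_AE) (auto elim!: eventually_mono simp: indicator_def)
  then show ?thesis by (subst (asm) nn_integral_add) auto
qed

context
  fixes q :: "real \<Rightarrow> real"
  assumes q: "revenue_curve q"
begin

lemma revenue_curve_nonneg: "0 \<le> q x" and revenue_curve_mono: "x \<le> y \<Longrightarrow> q x \<le> q y" and revenue_curve_measurable: "q \<in> borel_measurable borel"
  using q by (auto simp: revenue_curve_def mono_def intro: borel_measurable_mono)

lemma price_cdf_integral_le_1: "(\<integral>\<^sup>+ y\<in>{1..}. ennreal (q (min x y) / y\<^sup>2) \<partial>lborel) \<le> 1"
proof -
  have "(\<integral>\<^sup>+ y\<in>{1..}. ennreal (q (min x y) / y\<^sup>2) \<partial>lborel) \<le> (\<integral>\<^sup>+ y\<in>{1..}. ennreal (q y / y\<^sup>2) \<partial>lborel)"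
    by (intro nn_integral_mono mult_right_mono ennreal_leI divide_right_mono revenue_curve_mono) auto
  also have "\<dots> \<le> 1" using q by (simp add: revenue_curve_def)
  finally show ?thesis .
qed

lemma ennreal_price_cdf: "ennreal (price_cdf q x) = (\<integral>\<^sup>+ y\<in>{1..}. ennreal (q (min x y) / y\<^sup>2) \<partial>lborel)"
  unfolding price_cdf_def using price_cdf_integral_le_1[of x] by (intro ennreal_enn2real) (auto simp: top_unique less_top[symmetric])

lemma price_cdf_bounds: "0 \<le> price_cdf q x" "price_cdf q x \<le> 1"
  using price_cdf_integral_le_1[of x] unfolding ennreal_price_cdf[symmetric]
  by (auto simp: price_cdf_def)

lemma price_cdf_mono: "mono (price_cdf q)"
proof (rule monoI)
  fix x y :: real assume "x \<le> y"
  then have "ennreal (price_cdf q x) \<le> ennreal (price_cdf q y)" unfolding ennreal_price_cdf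
    by (intro nn_integral_mono mult_right_mono ennreal_leI divide_right_mono revenue_curve_mono) auto
  then show "price_cdf q x \<le> price_cdf q y" using price_cdf_bounds by simp
qed

lemma price_cdf_measurable: "price_cdf q \<in> borel_measurable borel"
  by (rule borel_measurable_mono[OF price_cdf_mono])

lemma price_cdf_eq:
  assumes "1 \<le> x"
  shows "ennreal (price_cdf q x) = ennreal (q x / x) + (\<integral>\<^sup>+ y\<in>{1..x}. ennreal (q y / y\<^sup>2) \<partial>lborel)"
proof -
  note [measurable] = revenue_curve_measurable price_cdf_measurable
  have "(\<integral>\<^sup>+ y\<in>{x..}. ennreal (q (min x y) / y\<^sup>2) \<partial>lborel) = (\<integral>\<^sup>+ y. ennreal (q x) * (ennreal (1 / y\<^sup>2) * indicator {x..} y) \<partial>lborel)"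
    using revenue_curve_nonneg by (intro nn_integral_cong) (auto simp: indicator_def min_absorb1 simp flip: ennreal_mult)
  also have "\<dots> = ennreal (q x / x)"
    using assms revenue_curve_nonneg[of x] by (simp add: nn_integral_cmult nn_integral_inverse_square flip: ennreal_mult)
  finally have 1: "(\<integral>\<^sup>+ y\<in>{x..}. ennreal (q (min x y) / y\<^sup>2) \<partial>lborel) = ennreal (q x / x)" .
  have 2: "(\<integral>\<^sup>+ y\<in>{1..x}. ennreal (q (min x y) / y\<^sup>2) \<partial>lborel) = (\<integral>\<^sup>+ y\<in>{1..x}. ennreal (q y / y\<^sup>2) \<partial>lborel)"
    by (intro nn_integral_cong) (auto simp: indicator_def min_absorb2)
  show ?thesis
    unfolding ennreal_price_cdf using assms by (subst nn_integral_Icc_Ioi) (auto simp: 1 2 add.commute)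
qed

text \<open>Insert \<open>price_cdf_eq\<close> and exchange the order of integration: the point
  \<open>z\<close> then collects \<open>q z / z\<close> and
  \<open>(x - z) * (q z / z\<^sup>2)\<close>, together \<open>x * (q z / z\<^sup>2)\<close>.\<close>

lemma nn_integral_price_cdf:
  assumes "1 \<le> x"
  shows "(\<integral>\<^sup>+ y\<in>{1..x}. ennreal (price_cdf q y) \<partial>lborel)
    = ennreal x * (\<integral>\<^sup>+ y\<in>{1..x}. ennreal (q y / y\<^sup>2) \<partial>lborel)"
proof -
  note [measurable] = revenue_curve_measurable price_cdf_measurable
  have "(\<integral>\<^sup>+ y\<in>{1..x}. ennreal (price_cdf q y) \<partial>lborel)
    = (\<integral>\<^sup>+ y. ennreal (q y / y) * indicator {1..x} y
        + (\<integral>\<^sup>+ z. ennreal (q z / z\<^sup>2) * indicator {1..x} z * indicator {z..x} y \<partial>lborel) \<partial>lborel)"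
  proof (intro nn_integral_cong)
    fix y :: real
    show "ennreal (price_cdf q y) * indicator {1..x} y = ennreal (q y / y) * indicator {1..x} y
        + (\<integral>\<^sup>+ z. ennreal (q z / z\<^sup>2) * indicator {1..x} z * indicator {z..x} y \<partial>lborel)"
    proof (cases "y \<in> {1..x}")
      case True
      then have "(\<integral>\<^sup>+ z. ennreal (q z / z\<^sup>2) * indicator {1..x} z * indicator {z..x} y \<partial>lborel)
        = (\<integral>\<^sup>+ z\<in>{1..y}. ennreal (q z / z\<^sup>2) \<partial>lborel)"
        by (intro nn_integral_cong) (auto simp: indicator_def)
      then show ?thesis using True by (simp add: price_cdf_eq)
    next
      case False
      then have "(\<integral>\<^sup>+ z. ennreal (q z / z\<^sup>2) * indicator {1..x} z * indicator {z..x} y \<partial>lborel) = 0"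
        by (intro nn_integral_zero') (auto simp: indicator_def)
      then show ?thesis using False by simp
    qed
  qed
  also have "\<dots> = (\<integral>\<^sup>+ y\<in>{1..x}. ennreal (q y / y) \<partial>lborel)
      + (\<integral>\<^sup>+ y. (\<integral>\<^sup>+ z. ennreal (q z / z\<^sup>2) * indicator {1..x} z * indicator {p. fst p \<le> snd p \<and> snd p \<le> x} (z, y) \<partial>lborel) \<partial>lborel)"
    by (subst nn_integral_add) (auto simp: indicator_def intro!: arg_cong2[where f = "(+)"] nn_integral_cong)
  also have "(\<integral>\<^sup>+ y. (\<integral>\<^sup>+ z. ennreal (q z / z\<^sup>2) * indicator {1..x} z * indicator {p. fst p \<le> snd p \<and> snd p \<le> x} (z, y) \<partial>lborel) \<partial>lborel)
    = (\<integral>\<^sup>+ z. (\<integral>\<^sup>+ y. ennreal (q z / z\<^sup>2) * indicator {1..x} z * indicator {p. fst p \<le> snd p \<and> snd p \<le> x} (z, y) \<partial>lborel) \<partial>lborel)"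
    by (rule lborel_pair.Fubini') measurable
  also have "\<dots> = (\<integral>\<^sup>+ z\<in>{1..x}. ennreal ((x - z) * (q z / z\<^sup>2)) \<partial>lborel)"
  proof (intro nn_integral_cong)
    fix z :: real
    have "(\<integral>\<^sup>+ y. ennreal (q z / z\<^sup>2) * indicator {1..x} z * indicator {p. fst p \<le> snd p \<and> snd p \<le> x} (z, y) \<partial>lborel)
      = (\<integral>\<^sup>+ y. ennreal (q z / z\<^sup>2) * indicator {1..x} z * indicator {z..x} y \<partial>lborel)"
      by (intro nn_integral_cong) (auto simp: indicator_def)
    also have "\<dots> = ennreal (q z / z\<^sup>2) * indicator {1..x} z * emeasure lborel {z..x}"
      by (simp add: nn_integral_cmult)
    also have "\<dots> = ennreal ((x - z) * (q z / z\<^sup>2)) * indicator {1..x} z"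
      using revenue_curve_nonneg[of z] by (auto simp: indicator_def mult.commute simp flip: ennreal_mult)
    finally show "(\<integral>\<^sup>+ y. ennreal (q z / z\<^sup>2) * indicator {1..x} z * indicator {p. fst p \<le> snd p \<and> snd p \<le> x} (z, y) \<partial>lborel)
      = ennreal ((x - z) * (q z / z\<^sup>2)) * indicator {1..x} z" .
  qed
  also have "(\<integral>\<^sup>+ y\<in>{1..x}. ennreal (q y / y) \<partial>lborel) + \<dots>
    = (\<integral>\<^sup>+ y. ennreal x * (ennreal (q y / y\<^sup>2) * indicator {1..x} y) \<partial>lborel)"
  proof (subst nn_integral_add[symmetric])
    show "(\<integral>\<^sup>+ y. ennreal (q y / y) * indicator {1..x} y + ennreal ((x - y) * (q y / y\<^sup>2)) * indicator {1..x} y \<partial>lborel)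
      = (\<integral>\<^sup>+ y. ennreal x * (ennreal (q y / y\<^sup>2) * indicator {1..x} y) \<partial>lborel)"
    proof (intro nn_integral_cong)
      fix y :: real
      have "q y / y + (x - y) * (q y / y\<^sup>2) = x * (q y / y\<^sup>2)" if "1 \<le> y"
        using that by (simp add: field_simps power2_eq_square)
      then show "ennreal (q y / y) * indicator {1..x} y + ennreal ((x - y) * (q y / y\<^sup>2)) * indicator {1..x} y
        = ennreal x * (ennreal (q y / y\<^sup>2) * indicator {1..x} y)"
        using revenue_curve_nonneg[of y] assms by (auto simp: indicator_def simp flip: ennreal_mult ennreal_plus)
    qed
  qed measurable
  also have "\<dots> = ennreal x * (\<integral>\<^sup>+ y\<in>{1..x}. ennreal (q y / y\<^sup>2) \<partial>lborel)"
    by (subst nn_integral_cmult) auto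
  finally show ?thesis .
qed

text \<open>\<open>E\<close> is the region under the quantile function over the coins up to
  \<open>price_cdf q x\<close>. Summed by coins, its area is at most the expected payment; summed by
  heights, it is \<open>x * price_cdf q x\<close> minus the integral of \<open>price_cdf q\<close>
  over \<open>[1, x]\<close>, which is \<open>q x\<close>. Equality may fail: where \<open>q\<close>
  jumps immediately to the right of \<open>x\<close>, the price \<open>x\<close> also goes to coins
  beyond \<open>price_cdf q x\<close>.\<close>

theorem price_quantile_revenue:
  assumes x: "1 \<le> x"
  shows "ennreal (q x) \<le> (\<integral>\<^sup>+ c\<in>{0<..1}. (if price_quantile q c \<le> ennreal x then price_quantile q c else 0) \<partial>lborel)"
proof -
  note [measurable] = revenue_curve_measurable price_cdf_measurable
  let ?H = "price_cdf q"
  \<comment> \<open>Heights below 1 count in full: prices start at 1, whereas the formula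
    \<open>price_cdf\<close> need not vanish below 1.\<close>
  define E where "E = {p :: real \<times> real. fst p \<in> {0<..?H x} \<and> snd p \<in> {0..x} \<and> (snd p < 1 \<or> ?H (snd p) < fst p)}"
  have "{p \<in> space (borel \<Otimes>\<^sub>M borel). 0 < fst p \<and> fst p \<le> ?H x \<and> 0 \<le> snd p \<and> snd p \<le> x
      \<and> (snd p < 1 \<or> ?H (snd p) < fst p)} \<in> sets (borel \<Otimes>\<^sub>M (borel :: real measure))"
    by measurable
  then have [measurable]: "E \<in> sets (borel \<Otimes>\<^sub>M borel)"
    unfolding E_def by (simp add: space_pair_measure conj_assoc)
  define A where "A = (\<integral>\<^sup>+ y. (\<integral>\<^sup>+ c. indicator E (c, y) \<partial>lborel) \<partial>lborel)"
  have "A = (\<integral>\<^sup>+ c. (\<integral>\<^sup>+ y. indicator E (c, y) \<partial>lborel) \<partial>lborel)"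
    unfolding A_def by (rule lborel_pair.Fubini') measurable
  also have "\<dots> \<le> (\<integral>\<^sup>+ c\<in>{0<..1}. (if price_quantile q c \<le> ennreal x then price_quantile q c else 0) \<partial>lborel)"
  proof (intro nn_integral_mono)
    fix c :: real
    show "(\<integral>\<^sup>+ y. indicator E (c, y) \<partial>lborel)
      \<le> (if price_quantile q c \<le> ennreal x then price_quantile q c else 0) * indicator {0<..1} c"
    proof (cases "c \<in> {0<..?H x}")
      case False
      then have "(\<integral>\<^sup>+ y. indicator E (c, y) \<partial>lborel) = 0"
        by (intro nn_integral_zero') (auto simp: E_def indicator_def)
      then show ?thesis by simp
    next
      case True
      then have "price_quantile q c \<le> ennreal x"
        unfolding price_quantile_def using x by (intro Inf_lower) auto
      moreover have "(\<integral>\<^sup>+ y. indicator E (c, y) \<partial>lborel) \<le> price_quantile q c"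
        unfolding price_quantile_def
      proof (intro Inf_greatest, safe)
        fix z assume z: "1 \<le> z" "c \<le> ?H z"
        have "(\<integral>\<^sup>+ y. indicator E (c, y) \<partial>lborel) \<le> (\<integral>\<^sup>+ y. indicator {0..z} y \<partial>lborel)"
        proof (intro nn_integral_mono)
          fix y
          have "y \<le> z" if "(c, y) \<in> E"
            using that z monoD[OF price_cdf_mono, of z y] by (force simp: E_def)
          then show "indicator E (c, y) \<le> (indicator {0..z} y :: ennreal)"
            by (auto simp: indicator_def E_def)
        qed
        also have "\<dots> = ennreal z" using z by simp
        finally show "(\<integral>\<^sup>+ y. indicator E (c, y) \<partial>lborel) \<le> ennreal z" .
      qed
      ultimately show ?thesis using True price_cdf_bounds(2)[of x] by simp
    qed
  qed
  finally have A_le: "A \<le> (\<integral>\<^sup>+ c\<in>{0<..1}. (if price_quantile q c \<le> ennreal x then price_quantile q c else 0) \<partial>lborel)" .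
  have inner: "(\<integral>\<^sup>+ c. indicator E (c, y) \<partial>lborel) + ennreal (?H y) * indicator {1..x} y
      = ennreal (?H x) * indicator {0..x} y" for y
  proof (cases "y \<in> {0..x}")
    case False
    then have "(\<integral>\<^sup>+ c. indicator E (c, y) \<partial>lborel) = 0"
      by (intro nn_integral_zero') (auto simp: E_def indicator_def)
    then show ?thesis using False by (auto simp: indicator_def)
  next
    case True
    define h where "h = (if y < 1 then 0 else ?H y)"
    have h: "0 \<le> h" "h \<le> ?H x"
      using True monoD[OF price_cdf_mono, of y x] price_cdf_bounds by (auto simp: h_def)
    have "(\<integral>\<^sup>+ c. indicator E (c, y) \<partial>lborel) = (\<integral>\<^sup>+ c. indicator {h<..?H x} c \<partial>lborel)"
      using True price_cdf_bounds(1)[of y]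
      by (intro nn_integral_cong) (auto simp: E_def h_def indicator_def)
    also have "\<dots> = ennreal (?H x - h)" using h by simp
    finally show ?thesis using True h
      by (cases "y < 1") (auto simp: h_def simp flip: ennreal_plus)
  qed
  have "A + (\<integral>\<^sup>+ y\<in>{1..x}. ennreal (?H y) \<partial>lborel) = (\<integral>\<^sup>+ y\<in>{0..x}. ennreal (?H x) \<partial>lborel)"
    unfolding A_def inner[symmetric] by (subst nn_integral_add) auto
  also have "\<dots> = ennreal x * ennreal (?H x)"
    using x by (simp add: nn_integral_cmult mult.commute)
  also have "\<dots> = ennreal (q x) + ennreal x * (\<integral>\<^sup>+ y\<in>{1..x}. ennreal (q y / y\<^sup>2) \<partial>lborel)"
    using x revenue_curve_nonneg[of x] by (simp add: price_cdf_eq distrib_left flip: ennreal_mult)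
  finally have "A + ennreal x * (\<integral>\<^sup>+ y\<in>{1..x}. ennreal (q y / y\<^sup>2) \<partial>lborel)
      = ennreal (q x) + ennreal x * (\<integral>\<^sup>+ y\<in>{1..x}. ennreal (q y / y\<^sup>2) \<partial>lborel)"
    unfolding nn_integral_price_cdf[OF x] .
  moreover have "(\<integral>\<^sup>+ y\<in>{1..x}. ennreal (q y / y\<^sup>2) \<partial>lborel) \<le> ennreal (?H x)"
    using x by (simp add: price_cdf_eq)
  then have "ennreal x * (\<integral>\<^sup>+ y\<in>{1..x}. ennreal (q y / y\<^sup>2) \<partial>lborel) \<noteq> \<infinity>"
    by (auto simp: ennreal_mult_eq_top_iff top_unique)
  ultimately have "A = ennreal (q x)"
    by (subst (asm) (1 2) add.commute) (simp add: ennreal_add_left_cancel)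
  then show ?thesis using A_le by simp
qed

end

text \<open>The strict comparison leaves room to move a witness up to a rational, so measurability
  of the price reduces to countably many events.\<close>

lemma price_quantile_less_iff:
  assumes "revenue_curve q"
  shows "price_quantile q c < t \<longleftrightarrow> (\<exists>x\<in>\<rat>. 1 \<le> x \<and> ennreal x < t \<and> c \<le> price_cdf q x)"
proof
  assume "price_quantile q c < t"
  then obtain x where x: "1 \<le> x" "c \<le> price_cdf q x" "ennreal x < t"
    unfolding price_quantile_def Inf_less_iff by auto
  then obtain y :: real where y: "x < y" "ennreal y < t"
  proof -
    obtain s where s: "ennreal x < s" "s < t" using dense[OF x(3)] by auto
    then obtain y where "s = ennreal y" "0 \<le> y" by (cases s) (auto simp: top_unique)
    then show ?thesis using that[of y] s x by (auto simp: ennreal_less_iff)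
  qed
  obtain z where z: "z \<in> \<rat>" "x < z" "z < y" using Rats_dense_in_real[OF y(1)] by auto
  have "price_cdf q x \<le> price_cdf q z" using z by (intro monoD[OF price_cdf_mono[OF assms]]) simp
  moreover have "ennreal z \<le> ennreal y" using z(3) by (simp add: ennreal_leI)
  then have "ennreal z < t" using y(2) by (rule le_less_trans)
  ultimately show "\<exists>x\<in>\<rat>. 1 \<le> x \<and> ennreal x < t \<and> c \<le> price_cdf q x"
    using z x by (intro bexI[of _ z]) auto
next
  assume "\<exists>x\<in>\<rat>. 1 \<le> x \<and> ennreal x < t \<and> c \<le> price_cdf q x"
  then show "price_quantile q c < t" unfolding price_quantile_def Inf_less_iff by blast
qed

section \<open>Necessity of the integral bound\<close>

lemma nn_integral_half_line:
  "(\<integral>\<^sup>+ x. h x \<partial>half_line) = (\<integral>\<^sup>+ x\<in>{1..}. h x \<partial>lborel)"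
  by (subst nn_integral_restrict_space) auto

lemma nn_integral_threshold_payment_le_1:
  "(\<integral>\<^sup>+ x. (if p \<le> ennreal x then p else 0) * ennreal (1 / x\<^sup>2) \<partial>half_line) \<le> 1"
proof (cases p)
  case (real a)
  \<comment> \<open>A price 0 earns nothing and is separated because the tail integral of
    \<open>1 / x\<^sup>2\<close> from 0 diverges. For a positive price below 1, extending the
    integral down to \<open>a\<close> only enlarges it.\<close>
  show ?thesis
  proof (cases "a = 0")
    case False
    with real have a: "0 < a" by simp
    have "(\<integral>\<^sup>+ x. (if p \<le> ennreal x then p else 0) * ennreal (1 / x\<^sup>2) \<partial>half_line)
      \<le> (\<integral>\<^sup>+ x. ennreal a * (ennreal (1 / x\<^sup>2) * indicator {a..} x) \<partial>lborel)"
      unfolding nn_integral_half_line using real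
      by (intro nn_integral_mono) (auto simp: indicator_def)
    also have "\<dots> = ennreal a * ennreal (1 / a)"
      using a by (simp add: nn_integral_cmult nn_integral_inverse_square)
    also have "\<dots> = 1" using a by (simp flip: ennreal_mult)
    finally show ?thesis .
  qed (use real in simp)
qed (simp add: top_unique)

definition expected_payment :: "nat \<Rightarrow> 'c measure \<Rightarrow> ('c \<Rightarrow> thresholds) \<Rightarrow> nat \<Rightarrow> (nat \<Rightarrow> real) \<Rightarrow> ennreal" where
  "expected_payment n C g i v = (\<integral>\<^sup>+ c. payment n (g c) v i \<partial>C)"

lemma payment_eq:
  "payment n p v i = (if p i (drop_bid n i v) \<le> ennreal (v i) then p i (drop_bid n i v) else 0)"
  by (simp add: payment_def wins_def)

context
  fixes n :: nat and C :: "'c measure" and g :: "'c \<Rightarrow> thresholds"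
  assumes auction: "randomized_truthful_auction n C g"
begin

lemma expected_revenue_eq:
  assumes "v \<in> bid_vectors {1..n}"
  shows "expected_revenue n C g v = (\<Sum>i=1..n. expected_payment n C g i v)"
  unfolding expected_revenue_def revenue_def expected_payment_def
proof (rule nn_integral_sum)
  fix i assume i: "i \<in> {1..n}"
  then have [measurable]: "(\<lambda>c. g c i (drop_bid n i v)) \<in> borel_measurable C"
    using auction drop_bid_in[OF assms, of i] by (auto simp: randomized_truthful_auction_def)
  show "(\<lambda>c. payment n (g c) v i) \<in> borel_measurable C" unfolding payment_eq by measurable
qed

text \<open>Prices are only Lebesgue measurable in bids and coins jointly. A Borel version agrees
  with them for almost all bids and then almost all coins, and it is accessible to Fubini.\<close>

lemma expected_payment_AE_eq:
  assumes i: "i \<in> {1..n}"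
  obtains p where "(\<lambda>(u, c). p u c) \<in> borel_measurable (bid_measure ({1..n} - {i}) \<Otimes>\<^sub>M C)"
    "AE v in bid_measure {1..n}. expected_payment n C g i v
      = (\<integral>\<^sup>+ c. (if p (drop_bid n i v) c \<le> ennreal (v i) then p (drop_bid n i v) c else 0) \<partial>C)"
proof -
  interpret C: prob_space C using auction by (simp add: randomized_truthful_auction_def)
  interpret B: sigma_finite_measure "bid_measure ({1..n} - {i})" by (rule sigma_finite_bids) simp
  interpret P: pair_sigma_finite "bid_measure ({1..n} - {i})" C ..
  have "(\<lambda>(u, c). g c i u) \<in> borel_measurable (completion (bid_measure ({1..n} - {i}) \<Otimes>\<^sub>M C))"
    using auction i by (simp add: randomized_truthful_auction_def)
  from completion_ex_borel_measurable[OF this] obtain p' where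
    [measurable]: "p' \<in> borel_measurable (bid_measure ({1..n} - {i}) \<Otimes>\<^sub>M C)" and
    ae: "AE z in bid_measure ({1..n} - {i}) \<Otimes>\<^sub>M C. (case z of (u, c) \<Rightarrow> g c i u) = p' z" by blast
  have "AE u in bid_measure ({1..n} - {i}). AE c in C. g c i u = p' (u, c)"
    using P.AE_pair[OF ae] by simp
  then have "AE v in bid_measure {1..n}. AE c in C. g c i (drop_bid n i v) = p' (drop_bid n i v, c)"
    by (rule AE_bids_drop[OF i])
  then have "AE v in bid_measure {1..n}. expected_payment n C g i v
      = (\<integral>\<^sup>+ c. (if p' (drop_bid n i v, c) \<le> ennreal (v i) then p' (drop_bid n i v, c) else 0) \<partial>C)"
    by eventually_elim
       (auto simp: expected_payment_def payment_eq intro!: nn_integral_cong_AE elim: eventually_mono)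
  then show ?thesis by (intro that[of "\<lambda>u c. p' (u, c)"]) simp_all
qed

text \<open>On the line over \<open>u\<close>, exchange coins and own bid: each outcome of the coins
  collects at most the weight of \<open>u\<close> by the equal revenue bound, and a line that misses
  \<open>S\<close> collects nothing.\<close>

lemma expected_payment_weighted_le:
  assumes i: "i \<in> {1..n}" and S: "S \<in> sets (completion (bid_measure {1..n}))"
  obtains E where "E \<in> borel_measurable (bid_measure {1..n})"
    "AE v in bid_measure {1..n}. expected_payment n C g i v = E v"
    "(\<integral>\<^sup>+ v\<in>S. E v * ennreal (weight {1..n} v) \<partial>bid_measure {1..n})
      \<le> (\<integral>\<^sup>+ u\<in>projection n i S. ennreal (weight ({1..n} - {i}) u) \<partial>bid_measure ({1..n} - {i}))"
proof -
  interpret C: prob_space C using auction by (simp add: randomized_truthful_auction_def)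
  interpret CL: pair_sigma_finite half_line C ..
  obtain p where p: "(\<lambda>(u, c). p u c) \<in> borel_measurable (bid_measure ({1..n} - {i}) \<Otimes>\<^sub>M C)"
    and ae: "AE v in bid_measure {1..n}. expected_payment n C g i v
      = (\<integral>\<^sup>+ c. (if p (drop_bid n i v) c \<le> ennreal (v i) then p (drop_bid n i v) c else 0) \<partial>C)"
    using expected_payment_AE_eq[OF i] by blast
  define E where "E v = (\<integral>\<^sup>+ c. (if p (drop_bid n i v) c \<le> ennreal (v i) then p (drop_bid n i v) c else 0) \<partial>C)" for v
  have [measurable]: "(\<lambda>v. v i) \<in> borel_measurable (bid_measure {1..n})" using i by (rule measurable_bid)
  have pm [measurable]: "(\<lambda>z. p (drop_bid n i (fst z)) (snd z)) \<in> borel_measurable (bid_measure {1..n} \<Otimes>\<^sub>M C)"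
    using measurable_compose[OF _ p, of "\<lambda>z. (drop_bid n i (fst z), snd z)" "bid_measure {1..n} \<Otimes>\<^sub>M C"] by (simp add: case_prod_unfold)
  have E [measurable]: "E \<in> borel_measurable (bid_measure {1..n})"
    unfolding E_def by (rule C.borel_measurable_nn_integral) (simp add: case_prod_unfold)
  \<comment> \<open>A Borel set equal to \<open>S\<close> almost everywhere; as a subset of
    \<open>S\<close> it meets only lines over the projection.\<close>
  define S' where "S' = main_part (bid_measure {1..n}) S"
  have S' [measurable]: "S' \<in> sets (bid_measure {1..n})" and sub: "S' \<subseteq> S"
    and S'_ae: "AE v in bid_measure {1..n}. v \<in> S' \<longleftrightarrow> v \<in> S"
    using S AE_in_main_part[OF S] main_part_null_part_Un[OF S] by (auto simp: S'_def simp del: main_part_null_part_Un)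
  define K where "K u = (\<integral>\<^sup>+ x. E (u(i := x)) * ennreal (weight {1..n} (u(i := x))) * indicator S' (u(i := x)) \<partial>half_line)" for u
  have K [measurable]: "K \<in> borel_measurable (bid_measure ({1..n} - {i}))"
  proof -
    have "(\<lambda>z. case z of (u, x) \<Rightarrow> (\<lambda>v. E v * ennreal (weight {1..n} v) * indicator S' v) (u(i := x)))
        \<in> borel_measurable (bid_measure ({1..n} - {i}) \<Otimes>\<^sub>M half_line)"
      using measurable_compose[OF measurable_update_bid[OF i], of "\<lambda>v. E v * ennreal (weight {1..n} v) * indicator S' v" borel]
      by (simp add: case_prod_unfold)
    from half_line.borel_measurable_nn_integral_fst[OF this] show ?thesis by (simp add: K_def[abs_def])
  qed
  have K_le: "K u \<le> ennreal (weight ({1..n} - {i}) u)" if u: "u \<in> bid_vectors ({1..n} - {i})" for u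
  proof -
    have pu [measurable]: "p u \<in> borel_measurable C"
      using measurable_compose[OF measurable_Pair1' p, of u] u by simp
    have id [measurable]: "(\<lambda>x. x) \<in> borel_measurable half_line"
      by (auto intro: measurable_restrict_space1)
    have [measurable]: "fst \<in> borel_measurable (half_line \<Otimes>\<^sub>M C)"
      by (rule measurable_compose[OF measurable_fst id])
    have [measurable]: "(\<lambda>z. p u (snd z)) \<in> borel_measurable (half_line \<Otimes>\<^sub>M C)"
      by (rule measurable_compose[OF measurable_snd pu])
    have "K u \<le> (\<integral>\<^sup>+ x. ennreal (weight ({1..n} - {i}) u) *
        ((\<integral>\<^sup>+ c. (if p u c \<le> ennreal x then p u c else 0) * ennreal (1 / x\<^sup>2) \<partial>C)) \<partial>half_line)"
      unfolding K_def
    proof (intro nn_integral_mono)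
      fix x assume "x \<in> space half_line"
      have "weight {1..n} (u(i := x)) = weight ({1..n} - {i}) u * (1 / x\<^sup>2)"
        using i by (intro weight_update) auto
      then have w: "ennreal (weight {1..n} (u(i := x))) = ennreal (weight ({1..n} - {i}) u) * ennreal (1 / x\<^sup>2)"
        using weight_pos[OF u] by (simp only:) (intro ennreal_mult; simp)
      have E_eq: "E (u(i := x)) = (\<integral>\<^sup>+ c. (if p u c \<le> ennreal x then p u c else 0) \<partial>C)"
        unfolding E_def drop_bid_update[OF u] by simp
      have "E (u(i := x)) * ennreal (weight {1..n} (u(i := x)))
        = ennreal (weight ({1..n} - {i}) u) *
          (\<integral>\<^sup>+ c. (if p u c \<le> ennreal x then p u c else 0) * ennreal (1 / x\<^sup>2) \<partial>C)"
        unfolding w E_eq by (subst nn_integral_multc) (measurable, simp only: mult_ac)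
      then show "E (u(i := x)) * ennreal (weight {1..n} (u(i := x))) * indicator S' (u(i := x))
        \<le> ennreal (weight ({1..n} - {i}) u) *
          (\<integral>\<^sup>+ c. (if p u c \<le> ennreal x then p u c else 0) * ennreal (1 / x\<^sup>2) \<partial>C)"
        by (cases "u(i := x) \<in> S'") simp_all
    qed
    also have "\<dots> = ennreal (weight ({1..n} - {i}) u) * (\<integral>\<^sup>+ x. (\<integral>\<^sup>+ c. (if p u c \<le> ennreal x then p u c else 0) * ennreal (1 / x\<^sup>2) \<partial>C) \<partial>half_line)"
      by (rule nn_integral_cmult) measurable
    also have "(\<integral>\<^sup>+ x. (\<integral>\<^sup>+ c. (if p u c \<le> ennreal x then p u c else 0) * ennreal (1 / x\<^sup>2) \<partial>C) \<partial>half_line)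
      = (\<integral>\<^sup>+ c. (\<integral>\<^sup>+ x. (if p u c \<le> ennreal x then p u c else 0) * ennreal (1 / x\<^sup>2) \<partial>half_line) \<partial>C)"
      by (rule CL.Fubini'[symmetric]) measurable
    also have "\<dots> \<le> (\<integral>\<^sup>+ c. 1 \<partial>C)"
      by (intro nn_integral_mono nn_integral_threshold_payment_le_1)
    finally show ?thesis by (simp add: C.emeasure_space_1 mult_left_mono)
  qed
  have "(\<integral>\<^sup>+ v\<in>S. E v * ennreal (weight {1..n} v) \<partial>bid_measure {1..n})
    = (\<integral>\<^sup>+ v. E v * ennreal (weight {1..n} v) * indicator S' v \<partial>bid_measure {1..n})"
    using S'_ae by (intro nn_integral_cong_AE) (auto elim!: eventually_mono simp: indicator_def)
  also have "\<dots> = (\<integral>\<^sup>+ u. K u \<partial>bid_measure ({1..n} - {i}))"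
    unfolding K_def by (rule nn_integral_bids_split[OF i]) measurable
  \<comment> \<open>The projection of a Lebesgue measurable set need not be measurable. The integral
    is a supremum over simple functions below the integrand, so the pointwise comparison still
    suffices.\<close>
  also have "\<dots> \<le> (\<integral>\<^sup>+ u\<in>projection n i S. ennreal (weight ({1..n} - {i}) u) \<partial>bid_measure ({1..n} - {i}))"
  proof (intro nn_integral_mono)
    fix u assume "u \<in> space (bid_measure ({1..n} - {i}))"
    then have u: "u \<in> bid_vectors ({1..n} - {i})" by simp
    show "K u \<le> ennreal (weight ({1..n} - {i}) u) * indicator (projection n i S) u"
    proof (cases "u \<in> projection n i S")
      case False
      then have "u(i := x) \<notin> S'" for x using u sub by (auto simp: projection_def)
      then have "K u = 0" by (simp add: K_def)
      then show ?thesis by simp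
    qed (use K_le[OF u] in simp)
  qed
  finally show ?thesis using that E ae unfolding E_def[symmetric] by blast
qed

theorem competitive_imp_integral_bound:
  assumes ratio: "has_competitive_ratio n C g f r" and r: "0 < r"
    and f: "\<And>v. v \<in> bid_vectors {1..n} \<Longrightarrow> 0 \<le> f v"
    and S: "S \<in> sets (completion (bid_measure {1..n}))"
  shows "(\<integral>\<^sup>+ v\<in>S. ennreal (f v * weight {1..n} v) \<partial>completion (bid_measure {1..n}))
    \<le> ennreal r * (\<Sum>i=1..n. \<integral>\<^sup>+ u\<in>projection n i S. ennreal (weight ({1..n} - {i}) u)
        \<partial>completion (bid_measure ({1..n} - {i})))"
proof -
  let ?M = "bid_measure {1..n}"
  have "\<forall>i\<in>{1..n}. \<exists>E. E \<in> borel_measurable ?M \<and> (AE v in ?M. expected_payment n C g i v = E v) \<and>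
    (\<integral>\<^sup>+ v\<in>S. E v * ennreal (weight {1..n} v) \<partial>?M)
      \<le> (\<integral>\<^sup>+ u\<in>projection n i S. ennreal (weight ({1..n} - {i}) u) \<partial>bid_measure ({1..n} - {i}))"
    by (intro ballI, rule expected_payment_weighted_le[OF _ S]) blast+
  then obtain E where *: "\<forall>i\<in>{1..n}. E i \<in> borel_measurable ?M \<and> (AE v in ?M. expected_payment n C g i v = E i v) \<and>
    (\<integral>\<^sup>+ v\<in>S. E i v * ennreal (weight {1..n} v) \<partial>?M)
      \<le> (\<integral>\<^sup>+ u\<in>projection n i S. ennreal (weight ({1..n} - {i}) u) \<partial>bid_measure ({1..n} - {i}))"
    by (elim bchoice[elim_format] exE)
  have E [measurable]: "\<And>i. i \<in> {1..n} \<Longrightarrow> E i \<in> borel_measurable ?M"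
    and ae: "\<And>i. i \<in> {1..n} \<Longrightarrow> AE v in ?M. expected_payment n C g i v = E i v"
    and le: "\<And>i. i \<in> {1..n} \<Longrightarrow> (\<integral>\<^sup>+ v\<in>S. E i v * ennreal (weight {1..n} v) \<partial>?M)
      \<le> (\<integral>\<^sup>+ u\<in>projection n i S. ennreal (weight ({1..n} - {i}) u) \<partial>bid_measure ({1..n} - {i}))"
    using * by blast+
  have meas: "(\<lambda>v. E i v * ennreal (weight {1..n} v) * indicator S v) \<in> borel_measurable (completion ?M)"
    if "i \<in> {1..n}" for i
    using E[OF that] S by (intro borel_measurable_times_ennreal borel_measurable_indicator) (auto intro: measurable_completion)
  have "AE v in ?M. \<forall>i\<in>{1..n}. expected_payment n C g i v = E i v"
    using ae by (intro AE_finite_allI) auto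
  then have "AE v in ?M. ennreal (f v * weight {1..n} v) * indicator S v
      \<le> ennreal r * (\<Sum>i=1..n. E i v * ennreal (weight {1..n} v) * indicator S v)"
    using AE_space
  proof eventually_elim
    case (elim v)
    then have v: "v \<in> bid_vectors {1..n}" by simp
    have "ennreal (f v) \<le> ennreal r * expected_revenue n C g v"
      using ratio v unfolding has_competitive_ratio_def by blast
    also have "expected_revenue n C g v = (\<Sum>i=1..n. E i v)"
      unfolding expected_revenue_eq[OF v] using elim by (intro sum.cong) auto
    finally have "ennreal (f v) \<le> ennreal r * (\<Sum>i=1..n. E i v)" .
    then have "ennreal (f v) * (ennreal (weight {1..n} v) * indicator S v)
        \<le> ennreal r * (\<Sum>i=1..n. E i v) * (ennreal (weight {1..n} v) * indicator S v)"
      by (rule mult_right_mono) simp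
    then show ?case
      using f[OF v] weight_pos[OF v] by (simp add: ennreal_mult sum_distrib_right mult.assoc)
  qed
  then have "(\<integral>\<^sup>+ v\<in>S. ennreal (f v * weight {1..n} v) \<partial>completion ?M)
    \<le> (\<integral>\<^sup>+ v. ennreal r * (\<Sum>i=1..n. E i v * ennreal (weight {1..n} v) * indicator S v) \<partial>completion ?M)"
    by (intro nn_integral_mono_AE AE_completion) simp
  also have "\<dots> = ennreal r * (\<integral>\<^sup>+ v. (\<Sum>i=1..n. E i v * ennreal (weight {1..n} v) * indicator S v) \<partial>completion ?M)"
    by (intro nn_integral_cmult borel_measurable_sum meas)
  also have "(\<integral>\<^sup>+ v. (\<Sum>i=1..n. E i v * ennreal (weight {1..n} v) * indicator S v) \<partial>completion ?M)
      = (\<Sum>i=1..n. \<integral>\<^sup>+ v\<in>S. E i v * ennreal (weight {1..n} v) \<partial>completion ?M)"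
    by (intro nn_integral_sum meas)
  also have "ennreal r * (\<Sum>i=1..n. \<integral>\<^sup>+ v\<in>S. E i v * ennreal (weight {1..n} v) \<partial>completion ?M)
    \<le> ennreal r * (\<Sum>i=1..n. \<integral>\<^sup>+ u\<in>projection n i S. ennreal (weight ({1..n} - {i}) u)
        \<partial>completion (bid_measure ({1..n} - {i})))"
    unfolding nn_integral_completion by (intro mult_left_mono sum_mono le) auto
  finally show ?thesis .
qed

end

section \<open>Selecting an almost everywhere convergent sequence\<close>

text \<open>Quantitative strict convexity: the defect at the midpoint is the squared difference of
  \<open>exp (- x / 2)\<close>, so near-minimality controls an L2 distance between these
  functions.\<close>

lemma exp_midpoint_gap:
  fixes a b :: real
  shows "exp (- a) + exp (- b) - 2 * exp (- ((a + b) / 2)) = (exp (- a / 2) - exp (- b / 2))\<^sup>2"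
proof -
  have 1: "exp (- x) = (exp (- x / 2))\<^sup>2" for x :: real
    by (simp add: power2_eq_square flip: exp_add)
  have 2: "exp (- ((a + b) / 2)) = exp (- a / 2) * exp (- b / 2)"
    by (simp add: field_simps flip: exp_add)
  show ?thesis unfolding 2 1[of a] 1[of b] by (simp add: power2_eq_square algebra_simps)
qed

text \<open>
  Near-minimizers of a strictly convex functional over nested midpoint-convex sets are Cauchy.
  The functional \<open>exp (- x)\<close> is bounded, so no integrability of the functions is needed.
\<close>

theorem nested_midpoint_convex_AE_convergent:
  fixes M :: "nat \<Rightarrow> 'x measure" and D :: "nat \<Rightarrow> 'q set" and e :: "nat \<Rightarrow> 'q \<Rightarrow> 'x \<Rightarrow> real"
  assumes prob: "\<And>j. prob_space (M j)"
    and nested: "\<And>m. D (Suc m) \<subseteq> D m" and ne: "\<And>m. D m \<noteq> {}"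
    and meas: "\<And>m j q. q \<in> D m \<Longrightarrow> e j q \<in> borel_measurable (M j)"
    and nonneg: "\<And>m j q x. q \<in> D m \<Longrightarrow> x \<in> space (M j) \<Longrightarrow> 0 \<le> e j q x"
    and mid: "\<And>m a b. a \<in> D m \<Longrightarrow> b \<in> D m \<Longrightarrow>
      \<exists>c\<in>D m. \<forall>j. \<forall>x\<in>space (M j). e j c x = (e j a x + e j b x) / 2"
  obtains q where "\<And>k. q k \<in> D k"
    "\<And>j. AE x in M j. convergent (\<lambda>k. exp (- e j (q k) x / 2))"
proof -
  interpret prob_space "M j" for j by (rule prob)
  define \<phi> where "\<phi> j q = (\<integral>x. exp (- e j q x) \<partial>M j)" for j q
  \<comment> \<open>A single functional treats all countably many \<open>e j\<close> at once; the
    weights make the sum finite and later cost only a factor \<open>2^j\<close>.\<close>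
  define \<Phi> where "\<Phi> q = (\<Sum>j. (1/2)^j * \<phi> j q)" for q
  have antimono: "D m \<subseteq> D l" if "l \<le> m" for l m using that nested by (rule lift_Suc_antimono_le[rotated])
  have int: "integrable (M j) (\<lambda>x. exp (- e j q x))" "integrable (M j) (\<lambda>x. exp (- e j q x / 2))"
    if "q \<in> D m" for j m q
    using meas[OF that, of j] nonneg[OF that, of _ j]
    by (auto intro!: integrable_const_bound[where B = 1] AE_I2)
  have \<phi>: "0 \<le> \<phi> j q" "\<phi> j q \<le> 1" if "q \<in> D m" for j m q
  proof -
    show "0 \<le> \<phi> j q" unfolding \<phi>_def by (rule Bochner_Integration.integral_nonneg) auto
    have "\<phi> j q \<le> (\<integral>x. 1 \<partial>M j)"
      unfolding \<phi>_def using int(1)[OF that] nonneg[OF that] by (intro Bochner_Integration.integral_mono) auto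
    then show "\<phi> j q \<le> 1" by (simp add: prob_space)
  qed
  have summ: "summable (\<lambda>j. (1/2)^j * \<phi> j q)" if "q \<in> D m" for m q
    using \<phi>[OF that] by (intro summable_comparison_test'[OF summable_geometric[of "1/2 :: real"], of 0])
      (auto simp: mult_left_le)
  have \<Phi>0: "0 \<le> \<Phi> q" if "q \<in> D m" for m q
    unfolding \<Phi>_def using \<phi>[OF that] by (intro suminf_nonneg summ[OF that]) auto
  define I where "I m = Inf (\<Phi> ` D m)" for m
  have bdd: "bdd_below (\<Phi> ` D m)" for m using \<Phi>0 by (intro bdd_belowI[of _ 0]) auto
  have I_le: "I m \<le> \<Phi> q" if "q \<in> D m" for m q
    unfolding I_def using that bdd by (intro cInf_lower) auto
  have "incseq I"
    unfolding I_def using antimono ne bdd by (intro incseq_SucI cInf_superset_mono) (auto simp: nested image_mono)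
  moreover have "I m \<le> 2" for m
  proof -
    obtain q where q: "q \<in> D m" using ne by auto
    have "\<Phi> q \<le> (\<Sum>j. (1/2)^j * 1)"
      unfolding \<Phi>_def using \<phi>[OF q] by (intro suminf_le summ[OF q]) (auto intro!: summable_geometric)
    then show ?thesis using I_le[OF q] by (simp add: suminf_geometric)
  qed
  ultimately obtain L where L: "I \<longlonglongrightarrow> L" "\<And>m. I m \<le> L"
    using incseq_convergent[of I 2] by blast
  \<comment> \<open>The tolerance \<open>(1/4)^k\<close> bounds squared distances; its root
    \<open>(1/2)^k\<close> is summable.\<close>
  have "\<exists>m\<ge>k. L - (1/4)^k < I m" for k
  proof -
    have "eventually (\<lambda>m. L - (1/4)^k < I m) sequentially"
      using L(1) by (intro order_tendstoD(1)) auto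
    then have "eventually (\<lambda>m. k \<le> m \<and> L - (1/4)^k < I m) sequentially"
      using eventually_ge_at_top[of k] by eventually_elim simp
    then show ?thesis using eventually_happens'[OF sequentially_bot] by blast
  qed
  then obtain m where m: "\<And>k. k \<le> m k" "\<And>k. L - (1/4)^k < I (m k)" by metis
  have "\<exists>q\<in>D (m k). \<Phi> q < L + (1/4)^k" for k
  proof -
    have "I (m k) < L + (1/4)^k" using L(2)[of "m k"] by (smt (verit) zero_less_power zero_less_divide_1_iff)
    then show ?thesis
      unfolding I_def using ne bdd by (subst (asm) cInf_less_iff) auto
  qed
  then obtain q where q: "\<And>k. q k \<in> D (m k)" "\<And>k. \<Phi> (q k) < L + (1/4)^k" by metis
  define d where "d j k x = exp (- e j (q (Suc k)) x / 2) - exp (- e j (q k) x / 2)" for j k x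
  have int_d: "integrable (M j) (\<lambda>x. (d j k x)\<^sup>2)" "integrable (M j) (\<lambda>x. \<bar>d j k x\<bar>)" for j k
  proof -
    have 1: "d j k \<in> borel_measurable (M j)"
      unfolding d_def using meas[OF q(1)[of k], of j] meas[OF q(1)[of "Suc k"], of j] by measurable
    have 2: "\<bar>d j k x\<bar> \<le> 1" if "x \<in> space (M j)" for x
    proof -
      have "0 \<le> e j (q (Suc k)) x" "0 \<le> e j (q k) x" using nonneg[OF q(1) that] by auto
      then have "exp (- e j (q (Suc k)) x / 2) \<le> 1" "exp (- e j (q k) x / 2) \<le> 1" by auto
      then show ?thesis unfolding d_def by (smt (verit) exp_gt_zero)
    qed
    show "integrable (M j) (\<lambda>x. (d j k x)\<^sup>2)" "integrable (M j) (\<lambda>x. \<bar>d j k x\<bar>)"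
      using 1 2 by (auto intro!: integrable_const_bound[where B = 1] AE_I2 simp: power_le_one abs_square_le_1)
  qed
  have gap: "(1/2)^j * (\<integral>x. (d j k x)\<^sup>2 \<partial>M j) \<le> 4 * (1/4)^k" for j k
  proof -
    \<comment> \<open>\<open>m\<close> need not be monotone; the larger of the two sets contains
      both points and hence their midpoint.\<close>
    define l where "l = min (m k) (m (Suc k))"
    have ql: "q k \<in> D l" "q (Suc k) \<in> D l" 
      using q(1)[of k] q(1)[of "Suc k"] antimono[of l "m k"] antimono[of l "m (Suc k)"] by (auto simp: l_def)
    from mid[OF ql(2) ql(1)] obtain c where c: "c \<in> D l"
      "\<And>j x. x \<in> space (M j) \<Longrightarrow> e j c x = (e j (q (Suc k)) x + e j (q k) x) / 2" by auto
    have eq: "\<phi> j (q (Suc k)) + \<phi> j (q k) - 2 * \<phi> j c = (\<integral>x. (d j k x)\<^sup>2 \<partial>M j)" for j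
    proof -
      have "(\<integral>x. (d j k x)\<^sup>2 \<partial>M j)
        = (\<integral>x. exp (- e j (q (Suc k)) x) + exp (- e j (q k) x) - 2 * exp (- e j c x) \<partial>M j)"
        by (intro Bochner_Integration.integral_cong) (simp_all only: d_def exp_midpoint_gap[symmetric] c(2))
      then show ?thesis
        unfolding \<phi>_def using int(1)[OF ql(1)] int(1)[OF ql(2)] int(1)[OF c(1)] by simp
    qed
    let ?a = "\<lambda>j. (1/2)^j * \<phi> j (q (Suc k)) + (1/2)^j * \<phi> j (q k) - 2 * ((1/2)^j * \<phi> j c)"
    have a: "?a j = (1/2)^j * (\<integral>x. (d j k x)\<^sup>2 \<partial>M j)" for j
      unfolding eq[symmetric] by (simp add: algebra_simps)
    have "?a sums (\<Phi> (q (Suc k)) + \<Phi> (q k) - 2 * \<Phi> c)"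
      unfolding \<Phi>_def by (intro sums_add sums_diff sums_mult summable_sums summ[OF ql(1)] summ[OF ql(2)] summ[OF c(1)])
    then have "(\<Sum>j. ?a j) = \<Phi> (q (Suc k)) + \<Phi> (q k) - 2 * \<Phi> c" and s: "summable ?a"
      by (auto simp: sums_iff)
    moreover have "0 \<le> ?a j" for j unfolding a by simp
    then have "sum ?a {j} \<le> (\<Sum>j. ?a j)" by (intro sum_le_suminf s ballI) simp_all
    then have "?a j \<le> (\<Sum>j. ?a j)" by simp
    moreover have "L - (1/4)^k < \<Phi> c"
    proof -
      have "L - (1/4)^k < I l"
      proof -
        have "0 \<le> (1/4 :: real) ^ k" by simp
        then have "L - (1/4)^k < I (m (Suc k))" using m(2)[of "Suc k"] unfolding power_Suc by linarith
        then show ?thesis using m(2)[of k] by (simp add: l_def min_def)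
      qed
      then show ?thesis using I_le[OF c(1)] by simp
    qed
    ultimately show ?thesis
      using q(2)[of k] q(2)[of "Suc k"] a[of j] zero_le_power[of "1/4 :: real" k]
      unfolding power_Suc by linarith
  qed
  have conv: "AE x in M j. convergent (\<lambda>k. exp (- e j (q k) x / 2))" for j
  proof -
    have int_abs: "(\<integral>x. \<bar>d j k x\<bar> \<partial>M j) \<le> (2 * 2^j + 1/2) * (1/2)^k" for k
    proof -
      \<comment> \<open>From L2 to L1 by
        \<open>\<bar>t\<bar> \<le> 2^k / 2 * t\<^sup>2 + (1/2)^k / 2\<close>, balanced for a squared
        norm of order \<open>(1/4)^k\<close>.\<close>
      have "(\<integral>x. \<bar>d j k x\<bar> \<partial>M j) \<le> (\<integral>x. 2^k / 2 * (d j k x)\<^sup>2 + (1/2)^k / 2 \<partial>M j)"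
      proof (intro Bochner_Integration.integral_mono int_d)
        fix x
        have "0 \<le> (2^k * \<bar>d j k x\<bar> - 1)\<^sup>2" by simp
        then have "2 * 2^k * \<bar>d j k x\<bar> \<le> (2^k)\<^sup>2 * (d j k x)\<^sup>2 + 1"
          by (simp add: power2_eq_square algebra_simps)
        then show "\<bar>d j k x\<bar> \<le> 2^k / 2 * (d j k x)\<^sup>2 + (1/2)^k / 2"
          by (simp add: field_simps power2_eq_square)
      qed (use int_d in simp)
      also have "\<dots> = 2^k / 2 * (\<integral>x. (d j k x)\<^sup>2 \<partial>M j) + (1/2)^k / 2"
        using int_d by (simp add: prob_space)
      also have "\<dots> \<le> 2^k / 2 * (4 * (1/4)^k * 2^j) + (1/2)^k / 2"
        using gap[of j k] by (intro add_right_mono mult_left_mono) (auto simp: field_simps)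
      also have "\<dots> = (2 * 2^j + 1/2) * (1/2)^k"
      proof -
        have "(2::real)^k * (1/4)^k = (1/2)^k" by (simp flip: power_mult_distrib)
        then show ?thesis by (simp add: algebra_simps) 
      qed
      finally show ?thesis .
    qed
    have "(\<integral>\<^sup>+ x. (\<Sum>k. ennreal \<bar>d j k x\<bar>) \<partial>M j) = (\<Sum>k. \<integral>\<^sup>+ x. ennreal \<bar>d j k x\<bar> \<partial>M j)"
      using int_d by (intro nn_integral_suminf) auto
    also have "\<dots> = (\<Sum>k. ennreal (\<integral>x. \<bar>d j k x\<bar> \<partial>M j))"
      using int_d by (intro suminf_cong nn_integral_eq_integral) auto
    also have "\<dots> \<le> (\<Sum>k. ennreal ((2 * 2^j + 1/2) * (1/2)^k))"
      by (intro suminf_le ennreal_leI int_abs) auto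
    also have "\<dots> = ennreal (\<Sum>k. (2 * 2^j + 1/2) * (1/2)^k)"
      by (intro suminf_ennreal2 summable_mult summable_geometric) auto
    also have "\<dots> < \<infinity>" by simp
    finally have "AE x in M j. (\<Sum>k. ennreal \<bar>d j k x\<bar>) \<noteq> \<infinity>"
      using int_d by (intro nn_integral_PInf_AE) auto
    then show ?thesis
    proof eventually_elim
      case (elim x)
      then have "summable (\<lambda>k. \<bar>d j k x\<bar>)"
        by (intro summable_suminf_not_top) auto
      then have "summable (\<lambda>k. d j k x)" by (rule summable_rabs_cancel)
      then have "convergent (\<lambda>n. \<Sum>k<n. d j k x)" by (simp add: summable_iff_convergent)
      then have "convergent (\<lambda>n. exp (- e j (q n) x / 2) - exp (- e j (q 0) x / 2))"
        unfolding d_def sum_lessThan_telescope[of "\<lambda>k. exp (- e j (q k) x / 2)"] .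
      from convergent_add[OF this convergent_const[of "exp (- e j (q 0) x / 2)"]]
      show ?case by simp
    qed
  qed
  have "q k \<in> D k" for k using q(1) antimono[OF m(1)] by blast
  then show ?thesis using that conv by blast
qed

section \<open>Limits of revenue curves\<close>

text \<open>The index set may be uncountable, so compactness of the product of intervals does not
  provide a convergent subsequence, only a proper filter finer than
  \<open>sequentially\<close>.\<close>

lemma pointwise_cluster:
  fixes q :: "nat \<Rightarrow> 'z \<Rightarrow> real"
  assumes B: "\<And>k z. q k z \<in> {0..B z}"
  obtains f G where "G \<noteq> bot" "G \<le> sequentially" "\<And>z. ((\<lambda>k. q k z) \<longlongrightarrow> f z) G"
proof -
  have "compactin (product_topology (\<lambda>_. euclidean) UNIV) (PiE UNIV (\<lambda>z. {0..B z}))"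
    by (simp add: compactin_PiE)
  then have "compact (PiE UNIV (\<lambda>z. {0..B z}))"
    by (simp only: euclidean_product_topology compactin_euclidean_iff)
  moreover have "eventually (\<lambda>g. g \<in> PiE UNIV (\<lambda>z. {0..B z})) (filtermap q sequentially)"
    using B by (simp add: eventually_filtermap PiE_iff)
  moreover have "filtermap q sequentially \<noteq> bot" by (simp add: filtermap_bot_iff)
  ultimately obtain f where f: "inf (nhds f) (filtermap q sequentially) \<noteq> bot"
    unfolding compact_filter by blast
  define G where "G = inf sequentially (filtercomap q (nhds f))"
  have "G \<noteq> bot"
  proof
    assume "G = bot"
    then have "eventually (\<lambda>_. False) G" by simp
    then obtain P R where PR: "eventually P sequentially" "eventually R (nhds f)" "\<And>k. P k \<Longrightarrow> R (q k) \<Longrightarrow> False"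
      unfolding G_def eventually_inf eventually_filtercomap by blast
    have "eventually (\<lambda>g. \<exists>k. P k \<and> g = q k) (filtermap q sequentially)"
      unfolding eventually_filtermap using PR(1) by (auto elim: eventually_mono)
    then have "eventually (\<lambda>_. False) (inf (nhds f) (filtermap q sequentially))"
      unfolding eventually_inf using PR(2,3) by blast
    then show False using f by (simp add: eventually_False)
  qed
  moreover have "G \<le> sequentially" by (simp add: G_def)
  moreover have "((\<lambda>k. q k z) \<longlongrightarrow> f z) G" for z
  proof -
    have "filterlim q (nhds f) G"
      unfolding G_def by (intro filterlim_mono[OF filterlim_filtercomap]) auto
    moreover have "continuous_on UNIV (\<lambda>g :: 'z \<Rightarrow> real. g z)"
      by (rule continuous_on_product_coordinates)
    then have "open ((\<lambda>g :: 'z \<Rightarrow> real. g z) -` S)" if "open S" for S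
      using that by (intro open_vimage)
    ultimately show ?thesis
      by (intro topological_tendstoI) (use topological_tendstoD in fastforce)
  qed
  ultimately show ?thesis using that by blast
qed

section \<open>The integral constraint under pointwise limits of monotone curves\<close>

lemma mono_AE_isCont:
  fixes f :: "real \<Rightarrow> real"
  assumes "mono f"
  shows "AE y in lborel. isCont f y"
proof -
  have "{y. \<not> isCont f y} \<in> null_sets lborel"
    by (intro countable_imp_null_set_lborel mono_ctble_discont assms)
  from AE_not_in[OF this] show ?thesis by simp
qed

definition grid_floor :: "nat \<Rightarrow> real \<Rightarrow> real" where
  "grid_floor N y = of_int \<lfloor>real N * y\<rfloor> / real N"

lemma grid_floor_le: "0 < N \<Longrightarrow> grid_floor N y \<le> y"
  and grid_floor_gt: "0 < N \<Longrightarrow> y - 1 / real N < grid_floor N y"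
proof -
  assume N: "0 < N"
  have "of_int \<lfloor>real N * y\<rfloor> \<le> real N * y" "real N * y - 1 < of_int \<lfloor>real N * y\<rfloor>" by linarith+
  moreover have "(real N * y - 1) / real N = y - 1 / real N" using N by (simp add: diff_divide_distrib)
  ultimately show "grid_floor N y \<le> y" "y - 1 / real N < grid_floor N y"
    unfolding grid_floor_def using N
    by (simp add: pos_divide_le_eq mult.commute, metis divide_strict_right_mono of_nat_0_less_iff)
qed

lemma grid_floor_lim: "(\<lambda>N. grid_floor N y) \<longlonglongrightarrow> y"
proof (rule tendsto_sandwich)
  show "eventually (\<lambda>N. y - 1 / real N \<le> grid_floor N y) sequentially"
    using eventually_gt_at_top[of 0] by eventually_elim (simp add: grid_floor_gt less_imp_le)
  show "eventually (\<lambda>N. grid_floor N y \<le> y) sequentially"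
    using eventually_gt_at_top[of 0] by eventually_elim (simp add: grid_floor_le)
  show "(\<lambda>N. y - 1 / real N) \<longlonglongrightarrow> y" by real_asymp
qed simp

lemma grid_floor_finite: "finite (grid_floor N ` {1..<real N})"
proof -
  have "grid_floor N ` {1..<real N} \<subseteq> (\<lambda>j. of_int j / real N) ` {0..int N * int N}"
  proof
    fix z assume "z \<in> grid_floor N ` {1..<real N}"
    then obtain y where y: "1 \<le> y" "y < real N" "z = grid_floor N y" by auto
    have "real N * y \<le> real N * real N" using y by (intro mult_left_mono) auto
    then have "\<lfloor>real N * y\<rfloor> \<le> int N * int N" by (simp add: floor_le_iff)
    moreover have "0 \<le> \<lfloor>real N * y\<rfloor>" using y by simp
    ultimately show "z \<in> (\<lambda>j. of_int j / real N) ` {0..int N * int N}"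
      using y by (auto simp: grid_floor_def)
  qed
  then show ?thesis by (rule finite_subset) simp
qed

lemma grid_floor_measurable [measurable]: "grid_floor N \<in> borel_measurable borel"
  unfolding grid_floor_def by measurable

text \<open>
  The filter \<open>G\<close> need not be countably generated, so Fatou's lemma is not available along \<open>G\<close>; on
  a finite grid the pointwise limit is uniform, and the grid is refined afterwards.
\<close>

lemma revenue_curve_limit:
  fixes q :: "nat \<Rightarrow> real \<Rightarrow> real" and f :: "real \<Rightarrow> real" and c :: "nat \<Rightarrow> real"
  assumes G: "G \<noteq> bot" and lim: "\<And>x. ((\<lambda>k. q k x) \<longlongrightarrow> f x) G"
    and q: "\<And>k. mono (q k)" "\<And>k x. 0 \<le> q k x"
    and load: "\<And>k. (\<integral>\<^sup>+ y\<in>{1..}. ennreal (q k y / y\<^sup>2) \<partial>lborel) \<le> ennreal (c k)" and c: "(c \<longlongrightarrow> 1) G"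
  shows "revenue_curve f"
proof -
  have f_mono: "mono f"
    by (rule monoI) (auto intro!: tendsto_le[OF G lim lim] always_eventually monoD[OF q(1)])
  have f_nonneg: "0 \<le> f x" for x
    by (rule tendsto_lowerbound[OF lim _ G]) (simp add: q)
  have f_meas [measurable]: "f \<in> borel_measurable borel" by (rule borel_measurable_mono[OF f_mono])
  have q_meas [measurable]: "q k \<in> borel_measurable borel" for k by (rule borel_measurable_mono[OF q(1)])
  have grid: "(\<integral>\<^sup>+ y\<in>{1..<real N}. ennreal (f (grid_floor N y) / y\<^sup>2) \<partial>lborel) \<le> 1" if N: "0 < N" for N
  proof (rule ennreal_le_epsilon)
    fix \<epsilon> :: real assume \<epsilon>: "0 < \<epsilon>"
    have "eventually (\<lambda>k. \<forall>z\<in>grid_floor N ` {1..<real N}. f z - \<epsilon> / 2 < q k z) G"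
      using grid_floor_finite \<epsilon> by (intro eventually_ball_finite ballI order_tendstoD(1)[OF lim]) auto
    moreover have "eventually (\<lambda>k. c k < 1 + \<epsilon> / 2) G"
      using \<epsilon> by (intro order_tendstoD(2)[OF c]) auto
    ultimately have "eventually (\<lambda>k. c k < 1 + \<epsilon> / 2 \<and> (\<forall>z\<in>grid_floor N ` {1..<real N}. f z - \<epsilon> / 2 < q k z)) G"
      by eventually_elim blast
    then obtain k where k: "c k < 1 + \<epsilon> / 2" "\<And>y. 1 \<le> y \<Longrightarrow> y < real N \<Longrightarrow> f (grid_floor N y) - \<epsilon> / 2 < q k (grid_floor N y)"
      using eventually_happens'[OF G] by fastforce
    have "(\<integral>\<^sup>+ y\<in>{1..<real N}. ennreal (f (grid_floor N y) / y\<^sup>2) \<partial>lborel)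
      \<le> (\<integral>\<^sup>+ y. ennreal (q k y / y\<^sup>2) * indicator {1..} y + ennreal (\<epsilon> / 2) * (ennreal (1 / y\<^sup>2) * indicator {1..} y) \<partial>lborel)"
    proof (intro nn_integral_mono)
      fix y :: real
      show "ennreal (f (grid_floor N y) / y\<^sup>2) * indicator {1..<real N} y
        \<le> ennreal (q k y / y\<^sup>2) * indicator {1..} y + ennreal (\<epsilon> / 2) * (ennreal (1 / y\<^sup>2) * indicator {1..} y)"
      proof (cases "y \<in> {1..<real N}")
        case True
        \<comment> \<open>Rounding down is the right direction: the monotone \<open>q k\<close> is
          at least as large at \<open>y\<close> as at the grid point below it.\<close>
        then have "f (grid_floor N y) \<le> q k y + \<epsilon> / 2"
          using k(2)[of y] monoD[OF q(1), of "grid_floor N y" y k] grid_floor_le[OF N, of y] by auto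
        then have "f (grid_floor N y) / y\<^sup>2 \<le> (q k y + \<epsilon> / 2) / y\<^sup>2" by (rule divide_right_mono) simp
        then have "ennreal (f (grid_floor N y) / y\<^sup>2) \<le> ennreal (q k y / y\<^sup>2 + \<epsilon> / 2 * (1 / y\<^sup>2))"
          by (intro ennreal_leI) (simp add: add_divide_distrib)
        also have "\<dots> = ennreal (q k y / y\<^sup>2) + ennreal (\<epsilon> / 2) * ennreal (1 / y\<^sup>2)"
          using q(2)[of k y] \<epsilon> by (subst ennreal_plus) (auto simp: ennreal_mult[symmetric])
        finally show ?thesis using True by simp
      qed simp
    qed
    also have "\<dots> = (\<integral>\<^sup>+ y\<in>{1..}. ennreal (q k y / y\<^sup>2) \<partial>lborel) + ennreal (\<epsilon> / 2)"
      using nn_integral_inverse_square[of 1] by (subst nn_integral_add) (auto simp: nn_integral_cmult)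
    also have "\<dots> \<le> ennreal (c k) + ennreal (\<epsilon> / 2)" by (intro add_right_mono load)
    also have "\<dots> \<le> ennreal (1 + \<epsilon> / 2) + ennreal (\<epsilon> / 2)" using k(1) by (intro add_right_mono ennreal_leI) auto
    also have "\<dots> = 1 + ennreal \<epsilon>" using \<epsilon> by (simp flip: ennreal_plus ennreal_1)
    finally show "(\<integral>\<^sup>+ y\<in>{1..<real N}. ennreal (f (grid_floor N y) / y\<^sup>2) \<partial>lborel) \<le> 1 + ennreal \<epsilon>" .
  qed
  \<comment> \<open>Refining the grid runs along a sequence, where Fatou applies; the rounded values
    converge at the continuity points of \<open>f\<close>, that is, almost everywhere.\<close>
  have "(\<integral>\<^sup>+ y\<in>{1..}. ennreal (f y / y\<^sup>2) \<partial>lborel)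
    \<le> (\<integral>\<^sup>+ y. liminf (\<lambda>N. ennreal (f (grid_floor N y) / y\<^sup>2) * indicator {1..<real N} y) \<partial>lborel)"
  proof (rule nn_integral_mono_AE)
    show "AE y in lborel. ennreal (f y / y\<^sup>2) * indicator {1..} y
      \<le> liminf (\<lambda>N. ennreal (f (grid_floor N y) / y\<^sup>2) * indicator {1..<real N} y)"
      using mono_AE_isCont[OF f_mono]
    proof eventually_elim
      case (elim y)
      show ?case
      proof (cases "1 \<le> y")
        case True
        have "(\<lambda>N. f (grid_floor N y)) \<longlonglongrightarrow> f y"
          using elim grid_floor_lim by (rule isCont_tendsto_compose)
        then have "(\<lambda>N. ennreal (f (grid_floor N y) / y\<^sup>2)) \<longlonglongrightarrow> ennreal (f y / y\<^sup>2)"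
          using True by (intro tendsto_ennrealI tendsto_divide) auto
        moreover have "eventually (\<lambda>N. ennreal (f (grid_floor N y) / y\<^sup>2) * indicator {1..<real N} y
            = ennreal (f (grid_floor N y) / y\<^sup>2)) sequentially"
        proof -
          obtain N0 :: nat where "y < real N0" using reals_Archimedean2 by blast
          then show ?thesis using True
            by (intro eventually_sequentiallyI[of N0]) (auto simp: indicator_def)
        qed
        ultimately have "(\<lambda>N. ennreal (f (grid_floor N y) / y\<^sup>2) * indicator {1..<real N} y) \<longlonglongrightarrow> ennreal (f y / y\<^sup>2)"
          by (subst tendsto_cong)
        then have "liminf (\<lambda>N. ennreal (f (grid_floor N y) / y\<^sup>2) * indicator {1..<real N} y) = ennreal (f y / y\<^sup>2)"
          by (intro lim_imp_Liminf) auto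
        then show ?thesis using True by simp
      qed simp
    qed
  qed
  also have "\<dots> \<le> liminf (\<lambda>N. \<integral>\<^sup>+ y\<in>{1..<real N}. ennreal (f (grid_floor N y) / y\<^sup>2) \<partial>lborel)"
    by (rule nn_integral_liminf) measurable
  also have "\<dots> \<le> liminf (\<lambda>N. 1)"
    by (intro Liminf_mono eventually_sequentiallyI[of 1] grid) auto
  also have "\<dots> = 1" by (simp add: Liminf_const)
  finally show ?thesis using f_mono f_nonneg by (simp add: revenue_curve_def)
qed

text \<open>Solutions with two defects that fade as \<open>m\<close> grows: lines may be overloaded
  by \<open>1 / Suc m\<close>, and only bids up to \<open>m\<close> are covered, since a finite grid
  controls only a bounded box. In this form the sets are nested and closed under midpoints.\<close>

definition approx_curves ::
  "nat \<Rightarrow> ((nat \<Rightarrow> real) \<Rightarrow> real) \<Rightarrow> nat \<Rightarrow> (nat \<Rightarrow> (nat \<Rightarrow> real) \<Rightarrow> real \<Rightarrow> real) set" where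
  "approx_curves n F m = {Q.
     (\<forall>i\<in>{1..n}. \<forall>x. (\<lambda>u. Q i u x) \<in> borel_measurable (bid_measure ({1..n} - {i}))) \<and>
     (\<forall>i\<in>{1..n}. \<forall>u\<in>bid_vectors ({1..n} - {i}). mono (Q i u) \<and> (\<forall>x. 0 \<le> Q i u x) \<and>
        (\<integral>\<^sup>+ y\<in>{1..}. ennreal (Q i u y / y\<^sup>2) \<partial>lborel) \<le> ennreal (1 + 1 / Suc m)) \<and>
     (\<forall>v\<in>bid_vectors {1..n}. (\<forall>k\<in>{1..n}. v k \<le> real m) \<longrightarrow>
        F v \<le> (\<Sum>i=1..n. Q i (drop_bid n i v) (v i)))}"

lemma approx_curves_measurable:
  "Q \<in> approx_curves n F m \<Longrightarrow> i \<in> {1..n} \<Longrightarrow>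
    (\<lambda>u. Q i u x) \<in> borel_measurable (bid_measure ({1..n} - {i}))"
  by (simp add: approx_curves_def)

lemma approx_curves_line:
  assumes "Q \<in> approx_curves n F m" "i \<in> {1..n}" "u \<in> bid_vectors ({1..n} - {i})"
  shows "mono (Q i u)" "0 \<le> Q i u x"
    "(\<integral>\<^sup>+ y\<in>{1..}. ennreal (Q i u y / y\<^sup>2) \<partial>lborel) \<le> ennreal (1 + 1 / Suc m)"
  using assms unfolding approx_curves_def by blast+

lemma approx_curves_cover:
  assumes "Q \<in> approx_curves n F m" "v \<in> bid_vectors {1..n}" "\<And>k. k \<in> {1..n} \<Longrightarrow> v k \<le> real m"
  shows "F v \<le> (\<Sum>i=1..n. Q i (drop_bid n i v) (v i))"
  using assms unfolding approx_curves_def by blast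

lemma approx_curves_Suc: "approx_curves n F (Suc m) \<subseteq> approx_curves n F m"
proof -
  have "ennreal (1 + 1 / Suc (Suc m)) \<le> ennreal (1 + 1 / Suc m)"
    by (intro ennreal_leI add_left_mono divide_left_mono) auto
  then show ?thesis unfolding approx_curves_def by (fastforce intro: order_trans)
qed

lemma approx_curves_midpoint:
  assumes "Q \<in> approx_curves n F m" "Q' \<in> approx_curves n F m"
  shows "(\<lambda>i u x. (Q i u x + Q' i u x) / 2) \<in> approx_curves n F m"
proof -
  let ?R = "\<lambda>i u x. (Q i u x + Q' i u x) / 2"
  have "(\<lambda>u. ?R i u x) \<in> borel_measurable (bid_measure ({1..n} - {i}))" if "i \<in> {1..n}" for i x
    using approx_curves_measurable[OF assms(1) that] approx_curves_measurable[OF assms(2) that] by simp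
  moreover have "mono (?R i u) \<and> (\<forall>x. 0 \<le> ?R i u x) \<and>
        (\<integral>\<^sup>+ y\<in>{1..}. ennreal (?R i u y / y\<^sup>2) \<partial>lborel) \<le> ennreal (1 + 1 / Suc m)"
    if "i \<in> {1..n}" "u \<in> bid_vectors ({1..n} - {i})" for i u
  proof -
    have Q: "mono (Q i u)" "\<And>x. 0 \<le> Q i u x"
        "(\<integral>\<^sup>+ y\<in>{1..}. ennreal (Q i u y / y\<^sup>2) \<partial>lborel) \<le> ennreal (1 + 1 / Suc m)"
      and Q': "mono (Q' i u)" "\<And>x. 0 \<le> Q' i u x"
        "(\<integral>\<^sup>+ y\<in>{1..}. ennreal (Q' i u y / y\<^sup>2) \<partial>lborel) \<le> ennreal (1 + 1 / Suc m)"
      using approx_curves_line[OF assms(1) that] approx_curves_line[OF assms(2) that] by blast+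
    have [measurable]: "Q i u \<in> borel_measurable borel" "Q' i u \<in> borel_measurable borel"
      using Q Q' by (auto intro: borel_measurable_mono)
    have R_mono: "mono (?R i u)"
      using Q(1) Q'(1) by (auto simp: mono_def intro!: divide_right_mono add_mono)
    have "(\<integral>\<^sup>+ y\<in>{1..}. ennreal (?R i u y / y\<^sup>2) \<partial>lborel) =
      (\<integral>\<^sup>+ y. ennreal (1/2) * (ennreal (Q i u y / y\<^sup>2) * indicator {1..} y)
         + ennreal (1/2) * (ennreal (Q' i u y / y\<^sup>2) * indicator {1..} y) \<partial>lborel)"
    proof (intro nn_integral_cong)
      fix y :: real
      have "?R i u y / y\<^sup>2 = 1/2 * (Q i u y / y\<^sup>2) + 1/2 * (Q' i u y / y\<^sup>2)"
        by (simp add: add_divide_distrib)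
      then have "ennreal (?R i u y / y\<^sup>2) = ennreal (1/2) * ennreal (Q i u y / y\<^sup>2) + ennreal (1/2) * ennreal (Q' i u y / y\<^sup>2)"
        using Q(2)[of y] Q'(2)[of y] by (simp only: ennreal_plus ennreal_mult divide_nonneg_nonneg mult_nonneg_nonneg
            zero_le_power2 zero_le_divide_1_iff zero_le_numeral)
      then show "ennreal (?R i u y / y\<^sup>2) * indicator {1..} y = ennreal (1/2) * (ennreal (Q i u y / y\<^sup>2) * indicator {1..} y)
         + ennreal (1/2) * (ennreal (Q' i u y / y\<^sup>2) * indicator {1..} y)"
        by (auto simp: indicator_def)
    qed
    also have "\<dots> = ennreal (1/2) * (\<integral>\<^sup>+ y\<in>{1..}. ennreal (Q i u y / y\<^sup>2) \<partial>lborel)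
         + ennreal (1/2) * (\<integral>\<^sup>+ y\<in>{1..}. ennreal (Q' i u y / y\<^sup>2) \<partial>lborel)"
      by (subst nn_integral_add) (auto simp: nn_integral_cmult)
    also have "\<dots> \<le> ennreal (1/2) * ennreal (1 + 1 / Suc m) + ennreal (1/2) * ennreal (1 + 1 / Suc m)"
      using Q(3) Q'(3) by (intro add_mono mult_left_mono) auto
    also have "\<dots> = ennreal (1 + 1 / Suc m)"
    proof -
      have c: "0 \<le> 1 + 1 / real (Suc m)" by simp
      then have "ennreal (1/2) * ennreal (1 + 1 / Suc m) = ennreal ((1 + 1 / Suc m) / 2)"
        by (subst ennreal_mult[symmetric]) auto
      then show ?thesis using c by (simp only: ennreal_plus[symmetric] divide_nonneg_nonneg zero_le_numeral field_sum_of_halves)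
    qed
    finally show ?thesis using R_mono Q(2) Q'(2) by simp
  qed
  moreover have "F v \<le> (\<Sum>i=1..n. ?R i (drop_bid n i v) (v i))"
    if "v \<in> bid_vectors {1..n}" "\<forall>k\<in>{1..n}. v k \<le> real m" for v
  proof -
    have "F v \<le> (\<Sum>i=1..n. Q i (drop_bid n i v) (v i))" "F v \<le> (\<Sum>i=1..n. Q' i (drop_bid n i v) (v i))"
      using approx_curves_cover[OF assms(1) that(1)] approx_curves_cover[OF assms(2) that(1)] that(2) by blast+
    then show ?thesis by (simp add: sum.distrib sum_divide_distrib[symmetric])
  qed
  ultimately show ?thesis unfolding approx_curves_def by blast
qed

text \<open>Above \<open>x\<close> the curve stays at or above \<open>q x\<close>, and
  \<open>1 / y\<^sup>2\<close> has mass \<open>1 / x\<close> there. The resulting bound, uniform in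
  the curve, supplies the compact product for \<open>pointwise_cluster\<close>.\<close>

lemma revenue_curve_bound:
  assumes "mono q" "\<And>x. 0 \<le> q x" "(\<integral>\<^sup>+ y\<in>{1..}. ennreal (q y / y\<^sup>2) \<partial>lborel) \<le> ennreal c" "0 \<le> c"
  shows "q x \<le> c * max 1 x"
proof -
  let ?x = "max 1 x"
  have "ennreal (q ?x / ?x) = (\<integral>\<^sup>+ y. ennreal (q ?x) * (ennreal (1 / y\<^sup>2) * indicator {?x..} y) \<partial>lborel)"
    using assms(2)[of ?x] nn_integral_inverse_square[of ?x] by (simp add: nn_integral_cmult flip: ennreal_mult)
  also have "\<dots> \<le> (\<integral>\<^sup>+ y\<in>{1..}. ennreal (q y / y\<^sup>2) \<partial>lborel)"
  proof (intro nn_integral_mono)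
    fix y :: real
    show "ennreal (q ?x) * (ennreal (1 / y\<^sup>2) * indicator {?x..} y) \<le> ennreal (q y / y\<^sup>2) * indicator {1..} y"
      using monoD[OF assms(1), of ?x y] assms(2)
      by (auto simp: indicator_def divide_right_mono simp flip: ennreal_mult intro!: ennreal_leI)
  qed
  also have "\<dots> \<le> ennreal c" by fact
  finally have "q ?x / ?x \<le> c" using assms(4) by (simp add: ennreal_le_iff)
  then have "q ?x \<le> c * ?x" by (simp add: pos_divide_le_eq)
  then show ?thesis using monoD[OF assms(1), of x ?x] by simp
qed

text \<open>As the weight is positive on bid vectors, this probability measure has the null sets of
  the bid measure, so statements almost everywhere carry over.\<close>

lemma prob_space_weighted_bids:
  assumes "finite J"
  shows "prob_space (density (bid_measure J) (\<lambda>u. ennreal (weight J u)))"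
proof
  have "emeasure (density (bid_measure J) (\<lambda>u. ennreal (weight J u))) (space (bid_measure J))
    = (\<integral>\<^sup>+ u. ennreal (weight J u) * indicator (space (bid_measure J)) u \<partial>bid_measure J)"
    using measurable_weight sets.top[of "bid_measure J"] by (intro emeasure_density) auto
  also have "\<dots> = (\<integral>\<^sup>+ u. (\<Prod>k\<in>J. ennreal (1 / (u k)\<^sup>2)) \<partial>bid_measure J)"
    by (intro nn_integral_cong) (auto simp: weight_def prod_ennreal)
  also have "\<dots> = (\<Prod>k\<in>J. \<integral>\<^sup>+ x. ennreal (1 / x\<^sup>2) \<partial>half_line)"
    unfolding bid_measure_def using assms
    by (rule half_lines.product_nn_integral_prod) (rule measurable_restrict_space1, measurable)
  also have "(\<integral>\<^sup>+ x. ennreal (1 / x\<^sup>2) \<partial>half_line) = 1"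
    using nn_integral_inverse_square[of 1] by (subst nn_integral_restrict_space) auto
  finally show "emeasure (density (bid_measure J) (\<lambda>u. ennreal (weight J u)))
      (space (density (bid_measure J) (\<lambda>u. ennreal (weight J u)))) = 1" by simp
qed

lemma borel_measurable_completion_AE:
  fixes h :: "'a \<Rightarrow> real"
  assumes h': "h' \<in> borel_measurable M" and ae: "AE x in M. h x = h' x"
  shows "h \<in> borel_measurable (completion M)"
proof (rule measurableI)
  fix A :: "real set" assume A: "A \<in> sets borel"
  show "h -` A \<inter> space (completion M) \<in> sets (completion M)"
  proof (rule completion.in_sets_AE)
    show "AE x in completion M. (x \<in> h' -` A \<inter> space M) = (x \<in> h -` A \<inter> space (completion M))"
      using AE_completion[OF ae] by eventually_elim auto
    show "h' -` A \<inter> space M \<in> sets (completion M)" using measurable_sets[OF h' A] by simp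
  qed auto
qed simp

text \<open>Two limits of one sequence are combined. The cluster point satisfies the inequalities at
  every bid vector, but need not be measurable; the limit almost everywhere on a rational slice is
  measurable, but says nothing on a null set. Where the sequence converges, the two agree.\<close>

theorem revenue_curves_exist:
  assumes ne: "\<And>m. approx_curves n F m \<noteq> {}" and n: "1 \<le> n"
  obtains Q where
    "\<And>i u. i \<in> {1..n} \<Longrightarrow> u \<in> bid_vectors ({1..n} - {i}) \<Longrightarrow> revenue_curve (Q i u)"
    "\<And>i x. i \<in> {1..n} \<Longrightarrow> x \<in> \<rat> \<Longrightarrow>
      (\<lambda>u. Q i u x) \<in> borel_measurable (completion (bid_measure ({1..n} - {i})))"
    "\<And>v. v \<in> bid_vectors {1..n} \<Longrightarrow> F v \<le> (\<Sum>i=1..n. Q i (drop_bid n i v) (v i))"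
proof -
  define S :: "(nat \<times> real) set" where "S = {1..n} \<times> \<rat>"
  have S: "countable S" "S \<noteq> {}"
    using n Rats_0 countable_rat by (auto simp: S_def)
  define p where "p = from_nat_into S"
  have p: "fst (p j) \<in> {1..n}" for j
    using from_nat_into[OF S(2), of j] by (auto simp: p_def S_def)
  define M where "M j = density (bid_measure ({1..n} - {fst (p j)})) (\<lambda>u. ennreal (weight ({1..n} - {fst (p j)}) u))" for j
  have M: "prob_space (M j)" for j unfolding M_def by (rule prob_space_weighted_bids) simp
  have M_space: "space (M j) = bid_vectors ({1..n} - {fst (p j)})" for j by (simp add: M_def)
  define D where "D = approx_curves n F"
  define e where "e j Q u = Q (fst (p j)) u (snd (p j))" for j and Q :: "nat \<Rightarrow> (nat \<Rightarrow> real) \<Rightarrow> real \<Rightarrow> real" and u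
  obtain q where q: "\<And>k. q k \<in> D k"
    and ae: "\<And>j. AE x in M j. convergent (\<lambda>k. exp (- e j (q k) x / 2))"
  proof (rule nested_midpoint_convex_AE_convergent[of M D e])
    show "e j Q \<in> borel_measurable (M j)" if "Q \<in> D m" for m j Q
      using approx_curves_measurable[OF that[unfolded D_def] p[of j]] by (simp add: e_def[abs_def] M_def)
    show "0 \<le> e j Q u" if "Q \<in> D m" "u \<in> space (M j)" for m j Q u
      using approx_curves_line(2)[OF that(1)[unfolded D_def] p[of j]] that(2) by (simp add: e_def M_space)
    show "\<exists>c\<in>D m. \<forall>j. \<forall>x\<in>space (M j). e j c x = (e j a x + e j b x) / 2" if "a \<in> D m" "b \<in> D m" for m a b
      using approx_curves_midpoint[OF that[unfolded D_def]] unfolding D_def e_def by (intro bexI) auto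
  qed (use M ne approx_curves_Suc in \<open>auto simp: D_def\<close>)
  have qm: "(\<lambda>u. q k i u x) \<in> borel_measurable (bid_measure ({1..n} - {i}))" if "i \<in> {1..n}" for i x k
    using approx_curves_measurable[OF q[of k, unfolded D_def] that] .
  have qc: "mono (q k i u)" "0 \<le> q k i u x"
    "(\<integral>\<^sup>+ y\<in>{1..}. ennreal (q k i u y / y\<^sup>2) \<partial>lborel) \<le> ennreal (1 + 1 / Suc k)"
    if "i \<in> {1..n}" "u \<in> bid_vectors ({1..n} - {i})" for i u x k
    using approx_curves_line[OF q[of k, unfolded D_def] that] by blast+
  \<comment> \<open>Zero at inadmissible arguments, so that one bound holds on the whole index set;
    its factor 2 dominates every \<open>1 + 1 / Suc k\<close>.\<close>
  define q' where "q' k z = (case z of (i, u, x) \<Rightarrow>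
    if i \<in> {1..n} \<and> u \<in> bid_vectors ({1..n} - {i}) then q k i u x else 0)" for k z
  define bound :: "nat \<times> (nat \<Rightarrow> real) \<times> real \<Rightarrow> real"
    where "bound z = 2 * max 1 (snd (snd z))" for z
  have q'_bound: "q' k z \<in> {0..bound z}" for k z
  proof -
    obtain i u x where z: "z = (i, u, x)" by (cases z)
    have "q k i u x \<le> (1 + 1 / Suc k) * max 1 x" if "i \<in> {1..n}" "u \<in> bid_vectors ({1..n} - {i})"
      using qc[OF that] by (intro revenue_curve_bound) auto
    moreover have "(1 + 1 / Suc k) * max 1 x \<le> 2 * max 1 x" by (intro mult_right_mono) auto
    ultimately show ?thesis using qc(2) by (auto simp: q'_def bound_def z intro: order_trans)
  qed
  obtain Q' G where G: "G \<noteq> bot" "G \<le> sequentially" and lim': "\<And>z. ((\<lambda>k. q' k z) \<longlongrightarrow> Q' z) G"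
    by (rule pointwise_cluster[of q' bound, OF q'_bound]) blast
  define Q where "Q i u x = Q' (i, u, x)" for i u x
  have lim: "((\<lambda>k. q k i u x) \<longlongrightarrow> Q i u x) G" if "i \<in> {1..n}" "u \<in> bid_vectors ({1..n} - {i})" for i u x
    using lim'[of "(i, u, x)"] that by (simp add: q'_def Q_def)
  show ?thesis
  proof (rule that[of Q])
    fix i u assume iu: "i \<in> {1..n}" "u \<in> bid_vectors ({1..n} - {i})"
    have "(\<lambda>k. 1 + 1 / real (Suc k)) \<longlonglongrightarrow> 1" by real_asymp
    from revenue_curve_limit[OF G(1) lim[OF iu] qc[OF iu] tendsto_mono[OF G(2) this]]
    show "revenue_curve (Q i u)" .
  next
    fix i x assume i: "i \<in> {1..n}" and x: "x \<in> (\<rat> :: real set)"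
    then have "(i, x) \<in> S" by (simp add: S_def)
    then obtain j where j: "p j = (i, x)" unfolding p_def using from_nat_into_surj[OF S(1)] by blast
    let ?B = "bid_measure ({1..n} - {i})"
    have "AE u in ?B. 0 < ennreal (weight ({1..n} - {i}) u) \<longrightarrow> convergent (\<lambda>k. exp (- q k i u x / 2))"
      using ae[of j] unfolding M_def e_def j fst_conv snd_conv by (subst (asm) AE_density) auto
    \<comment> \<open>The convergence concerns \<open>exp (- q / 2)\<close>, which the logarithm
      inverts. A limit along the sequence is Borel measurable, and almost everywhere it equals the
      limit along \<open>G\<close>.\<close>
    then have "AE u in ?B. Q i u x = - 2 * ln (lim (\<lambda>k. exp (- q k i u x / 2)))"
      using AE_space
    proof eventually_elim
      case (elim u)
      then have u: "u \<in> bid_vectors ({1..n} - {i})" by simp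
      have "(\<lambda>k. exp (- q k i u x / 2)) \<longlonglongrightarrow> lim (\<lambda>k. exp (- q k i u x / 2))"
        using elim weight_pos[OF u] by (simp add: convergent_LIMSEQ_iff)
      then have "((\<lambda>k. exp (- q k i u x / 2)) \<longlongrightarrow> lim (\<lambda>k. exp (- q k i u x / 2))) G"
        using G(2) by (rule tendsto_mono[rotated])
      moreover have "((\<lambda>k. exp (- q k i u x / 2)) \<longlongrightarrow> exp (- Q i u x / 2)) G"
        by (intro tendsto_intros lim i u) simp
      ultimately have "lim (\<lambda>k. exp (- q k i u x / 2)) = exp (- Q i u x / 2)"
        using tendsto_unique[OF G(1)] by blast
      then show ?case by simp
    qed
    moreover have "(\<lambda>u. - 2 * ln (lim (\<lambda>k. exp (- q k i u x / 2)))) \<in> borel_measurable ?B"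
      using qm[OF i] by measurable
    ultimately show "(\<lambda>u. Q i u x) \<in> borel_measurable (completion ?B)"
      by (intro borel_measurable_completion_AE) auto
  next
    fix v assume v: "v \<in> bid_vectors {1..n}"
    obtain N :: nat where N: "Max (v ` {1..n}) < real N" using reals_Archimedean2 by blast
    have "((\<lambda>k. \<Sum>i=1..n. q k i (drop_bid n i v) (v i)) \<longlongrightarrow> (\<Sum>i=1..n. Q i (drop_bid n i v) (v i))) G"
      using v by (intro tendsto_sum lim drop_bid_in) auto
    moreover have "eventually (\<lambda>k. F v \<le> (\<Sum>i=1..n. q k i (drop_bid n i v) (v i))) G"
    proof (rule filter_leD[OF G(2) eventually_sequentiallyI[of N]])
      fix k assume "N \<le> k"
      have "v i \<le> real k" if "i \<in> {1..n}" for i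
      proof -
        have "v i \<le> Max (v ` {1..n})" using that by (intro Max_ge) auto
        then show ?thesis using N \<open>N \<le> k\<close> by linarith
      qed
      then show "F v \<le> (\<Sum>i=1..n. q k i (drop_bid n i v) (v i))"
        by (intro approx_curves_cover[OF q[of k, unfolded D_def] v])
    qed
    ultimately show "F v \<le> (\<Sum>i=1..n. Q i (drop_bid n i v) (v i))"
      by (rule tendsto_lowerbound[OF _ _ G(1)])
  qed
qed

section \<open>Approximate revenue curves from the integral bound\<close>

text \<open>The cap at \<open>N\<close> makes the last cell an unbounded ray, so finitely many cells
  partition \<open>[1, \<infinity>)\<close> and their weights sum to 1. \<open>corner h j\<close> is
  the left end of cell \<open>j\<close>.\<close>

definition cell_index :: "real \<Rightarrow> nat \<Rightarrow> real \<Rightarrow> nat" where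
  "cell_index h N x = min N (nat \<lfloor>(x - 1) / h\<rfloor>)"

definition corner :: "real \<Rightarrow> nat \<Rightarrow> real" where
  "corner h j = 1 + h * real j"

definition cell_weight :: "real \<Rightarrow> nat \<Rightarrow> nat \<Rightarrow> real" where
  "cell_weight h N j = enn2real (\<integral>\<^sup>+ x\<in>{x. 1 \<le> x \<and> cell_index h N x = j}. ennreal (1 / x\<^sup>2) \<partial>lborel)"

definition cell_of :: "real \<Rightarrow> nat \<Rightarrow> nat set \<Rightarrow> (nat \<Rightarrow> real) \<Rightarrow> nat \<Rightarrow> nat" where
  "cell_of h N J u = (\<lambda>k\<in>J. cell_index h N (u k))"

context
  fixes h :: real and N :: nat
  assumes h: "0 < h"
begin

lemma cell_index_le: "cell_index h N x \<le> N"
  by (simp add: cell_index_def)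

lemma cell_index_mono: "x \<le> y \<Longrightarrow> cell_index h N x \<le> cell_index h N y"
  unfolding cell_index_def using h
  by (intro min.mono nat_mono floor_mono divide_right_mono) auto

lemma corner_cell_index_le:
  assumes "1 \<le> x"
  shows "corner h (cell_index h N x) \<le> x"
proof -
  have "0 \<le> (x - 1) / h" using assms h by simp
  then have "real (nat \<lfloor>(x - 1) / h\<rfloor>) \<le> (x - 1) / h" by (simp add: of_nat_nat)
  then have "real (cell_index h N x) \<le> (x - 1) / h"
    unfolding cell_index_def by (meson min.cobounded2 of_nat_le_iff order_trans)
  then show ?thesis unfolding corner_def using h by (simp add: field_simps)
qed

text \<open>Adding \<open>h\<close> moves into the next cell, whose left end is at least
  \<open>x\<close>; the cap at \<open>N\<close> would spoil this for \<open>x\<close> beyond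
  \<open>corner h N\<close>.\<close>

lemma le_corner_cell_index_shift:
  assumes "1 \<le> x" "x \<le> corner h N"
  shows "x \<le> corner h (cell_index h N (x + h))"
proof (cases "N \<le> nat \<lfloor>(x + h - 1) / h\<rfloor>")
  case True then show ?thesis using assms(2) by (simp add: cell_index_def min_def)
next
  case False
  have "(x + h - 1) / h = (x - 1) / h + 1" using h by (simp add: field_simps)
  moreover have "0 \<le> (x - 1) / h" using assms(1) h by simp
  ultimately have "(x - 1) / h \<le> real (nat \<lfloor>(x + h - 1) / h\<rfloor>)" by linarith
  then show ?thesis using False h by (simp add: cell_index_def corner_def field_simps)
qed

lemma cell_index_measurable [measurable]: "cell_index h N \<in> borel \<rightarrow>\<^sub>M count_space UNIV"
  unfolding cell_index_def by measurable

lemma corner_mono: "i \<le> j \<Longrightarrow> corner h i \<le> corner h j"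
  using h by (simp add: corner_def)

lemma ennreal_cell_weight:
  "ennreal (cell_weight h N j) = (\<integral>\<^sup>+ x\<in>{x. 1 \<le> x \<and> cell_index h N x = j}. ennreal (1 / x\<^sup>2) \<partial>lborel)"
proof -
  have "(\<integral>\<^sup>+ x\<in>{x. 1 \<le> x \<and> cell_index h N x = j}. ennreal (1 / x\<^sup>2) \<partial>lborel)
    \<le> (\<integral>\<^sup>+ x\<in>{1..}. ennreal (1 / x\<^sup>2) \<partial>lborel)"
    by (intro nn_integral_mono) (auto simp: indicator_def)
  then have "(\<integral>\<^sup>+ x\<in>{x. 1 \<le> x \<and> cell_index h N x = j}. ennreal (1 / x\<^sup>2) \<partial>lborel) \<le> 1"
    using nn_integral_inverse_square[of 1] by simp
  then show ?thesis
    unfolding cell_weight_def by (intro ennreal_enn2real) (auto simp: top_unique less_top[symmetric])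
qed

lemma cell_weight_nonneg: "0 \<le> cell_weight h N j"
  by (simp add: cell_weight_def)

lemma cell_weight_pos:
  assumes "j \<le> N"
  shows "0 < cell_weight h N j"
proof -
  let ?a = "corner h j" and ?b = "corner h (Suc j)"
  have ab: "1 \<le> ?a" "?a < ?b" using h by (simp_all add: corner_def)
  have index: "cell_index h N x = j" if "x \<in> {?a..<?b}" for x
  proof -
    have "real j \<le> (x - 1) / h" "(x - 1) / h < real j + 1"
      using that h by (auto simp: corner_def field_simps)
    then have "\<lfloor>(x - 1) / h\<rfloor> = int j" by linarith
    then show ?thesis using assms by (simp add: cell_index_def)
  qed
  have "0 < ennreal (1 / ?b\<^sup>2) * ennreal (?b - ?a)" using ab by (simp flip: ennreal_mult)
  also have "\<dots> = (\<integral>\<^sup>+ x. ennreal (1 / ?b\<^sup>2) * indicator {?a..<?b} x \<partial>lborel)"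
    using ab by (simp add: nn_integral_cmult)
  also have "\<dots> \<le> (\<integral>\<^sup>+ x\<in>{x. 1 \<le> x \<and> cell_index h N x = j}. ennreal (1 / x\<^sup>2) \<partial>lborel)"
  proof (intro nn_integral_mono)
    fix x
    show "ennreal (1 / ?b\<^sup>2) * indicator {?a..<?b} x \<le> ennreal (1 / x\<^sup>2) * indicator {x. 1 \<le> x \<and> cell_index h N x = j} x"
    proof (cases "x \<in> {?a..<?b}")
      case True
      then have "1 \<le> x" "x \<le> ?b" using ab by auto
      then have "1 / ?b\<^sup>2 \<le> 1 / x\<^sup>2" by (intro divide_left_mono power_mono) auto
      then show ?thesis using True index[OF True] \<open>1 \<le> x\<close> by (simp add: ennreal_leI)
    qed simp
  qed
  finally show ?thesis unfolding ennreal_cell_weight[symmetric] by simp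
qed

lemma nn_integral_cell_index:
  assumes "\<And>j. 0 \<le> \<phi> j"
  shows "(\<integral>\<^sup>+ x\<in>{1..}. ennreal (\<phi> (cell_index h N x) / x\<^sup>2) \<partial>lborel)
    = ennreal (\<Sum>j\<le>N. cell_weight h N j * \<phi> j)"
proof -
  have "(\<integral>\<^sup>+ x\<in>{1..}. ennreal (\<phi> (cell_index h N x) / x\<^sup>2) \<partial>lborel)
    = (\<integral>\<^sup>+ x. (\<Sum>j\<le>N. ennreal (\<phi> j) * (ennreal (1 / x\<^sup>2) * indicator {x. 1 \<le> x \<and> cell_index h N x = j} x)) \<partial>lborel)"
  proof (intro nn_integral_cong)
    fix x :: real
    have "(\<Sum>j\<le>N. ennreal (\<phi> j) * (ennreal (1 / x\<^sup>2) * indicator {x. 1 \<le> x \<and> cell_index h N x = j} x))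
      = (\<Sum>j\<in>{cell_index h N x}. ennreal (\<phi> j) * (ennreal (1 / x\<^sup>2) * indicator {1..} x))"
      using cell_index_le[of x] by (intro sum.mono_neutral_cong_right) (auto simp: indicator_def)
    also have "\<dots> = ennreal (\<phi> (cell_index h N x) / x\<^sup>2) * indicator {1..} x"
      using assms by (cases "1 \<le> x") (simp_all add: ennreal_mult[symmetric])
    finally show "ennreal (\<phi> (cell_index h N x) / x\<^sup>2) * indicator {1..} x
      = (\<Sum>j\<le>N. ennreal (\<phi> j) * (ennreal (1 / x\<^sup>2) * indicator {x. 1 \<le> x \<and> cell_index h N x = j} x))"
      by (rule sym)
  qed
  also have "\<dots> = (\<Sum>j\<le>N. \<integral>\<^sup>+ x. ennreal (\<phi> j) * (ennreal (1 / x\<^sup>2) * indicator {x. 1 \<le> x \<and> cell_index h N x = j} x) \<partial>lborel)"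
    by (intro nn_integral_sum) measurable
  also have "\<dots> = (\<Sum>j\<le>N. ennreal (\<phi> j) * ennreal (cell_weight h N j))"
    unfolding ennreal_cell_weight by (intro sum.cong refl nn_integral_cmult) measurable
  also have "\<dots> = ennreal (\<Sum>j\<le>N. cell_weight h N j * \<phi> j)"
    using assms cell_weight_nonneg by (simp add: ennreal_mult[symmetric] sum_ennreal mult.commute)
  finally show ?thesis .
qed

lemma cell_weight_sum: "(\<Sum>j\<le>N. cell_weight h N j) = 1"
proof -
  have "ennreal (\<Sum>j\<le>N. cell_weight h N j) = 1"
    using nn_integral_cell_index[of "\<lambda>_. 1"] nn_integral_inverse_square[of 1] by simp
  then show ?thesis by (simp add: ennreal_eq_1)
qed

lemma cell_of_in: "cell_of h N J u \<in> PiE J (\<lambda>_. {..N})"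
  by (auto simp: cell_of_def cell_index_le)

lemma cell_of_mono: "u \<le> v \<Longrightarrow> cell_of h N J u \<le> cell_of h N J v"
  by (auto simp: cell_of_def le_fun_def intro: cell_index_mono)

lemma cell_of_eq_iff:
  "c \<in> PiE J (\<lambda>_. {..N}) \<Longrightarrow> cell_of h N J u = c \<longleftrightarrow> (\<forall>k\<in>J. cell_index h N (u k) = c k)"
  by (auto simp: cell_of_def fun_eq_iff PiE_def extensional_def)

lemma sets_cell:
  assumes "finite J"
  shows "{u \<in> space (bid_measure J). \<forall>k\<in>J. cell_index h N (u k + s) = c k} \<in> sets (bid_measure J)"
proof (rule sets.sets_Collect_finite_All[OF _ assms])
  fix k assume "k \<in> J"
  then have [measurable]: "(\<lambda>u. u k) \<in> borel_measurable (bid_measure J)" by (rule measurable_bid)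
  show "{u \<in> space (bid_measure J). cell_index h N (u k + s) = c k} \<in> sets (bid_measure J)"
    by measurable
qed

lemma measurable_cell_of:
  assumes "finite J"
  shows "(\<lambda>u. cell_of h N J (\<lambda>k. u k + s)) \<in> bid_measure J \<rightarrow>\<^sub>M count_space (PiE J (\<lambda>_. {..N}))"
proof (subst measurable_count_space_eq2)
  show "finite (PiE J (\<lambda>_. {..N}))" using assms by (intro finite_PiE) auto
  have "(\<lambda>u. cell_of h N J (\<lambda>k. u k + s)) -` {c} \<inter> space (bid_measure J)
      = {u \<in> space (bid_measure J). \<forall>k\<in>J. cell_index h N (u k + s) = c k}" if "c \<in> PiE J (\<lambda>_. {..N})" for c
    by (rule set_eqI) (simp add: cell_of_eq_iff[OF that] conj_commute)
  then show "(\<lambda>u. cell_of h N J (\<lambda>k. u k + s)) \<in> space (bid_measure J) \<rightarrow> PiE J (\<lambda>_. {..N}) \<and>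
    (\<forall>c\<in>PiE J (\<lambda>_. {..N}). (\<lambda>u. cell_of h N J (\<lambda>k. u k + s)) -` {c} \<inter> space (bid_measure J) \<in> sets (bid_measure J))"
    using sets_cell[OF assms] cell_of_in by auto
qed

lemma nn_integral_cell:
  assumes J: "finite J" and c: "c \<in> PiE J (\<lambda>_. {..N})"
  shows "(\<integral>\<^sup>+ u. ennreal (weight J u) * indicator {u. cell_of h N J u = c} u \<partial>bid_measure J)
    = ennreal (\<Prod>k\<in>J. cell_weight h N (c k))"
proof -
  let ?f = "\<lambda>k x. ennreal (1 / x\<^sup>2) * indicator {x. cell_index h N x = c k} x"
  have "(\<integral>\<^sup>+ u. ennreal (weight J u) * indicator {u. cell_of h N J u = c} u \<partial>bid_measure J)
    = (\<integral>\<^sup>+ u. (\<Prod>k\<in>J. ?f k (u k)) \<partial>bid_measure J)"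
  proof (intro nn_integral_cong)
    fix u
    have "(\<Prod>k\<in>J. indicator {x. cell_index h N x = c k} (u k) :: ennreal) = indicator {u. cell_of h N J u = c} u"
      using J by (auto simp: indicator_def cell_of_eq_iff[OF c] prod_zero_iff)
    then show "ennreal (weight J u) * indicator {u. cell_of h N J u = c} u = (\<Prod>k\<in>J. ?f k (u k))"
      by (simp add: prod.distrib weight_def prod_ennreal)
  qed
  also have "\<dots> = (\<Prod>k\<in>J. \<integral>\<^sup>+ x. ?f k x \<partial>half_line)"
    unfolding bid_measure_def
    by (rule half_lines.product_nn_integral_prod[OF J]) (rule measurable_restrict_space1, measurable)
  also have "\<dots> = (\<Prod>k\<in>J. ennreal (cell_weight h N (c k)))"
    unfolding ennreal_cell_weight
    by (intro prod.cong refl) (subst nn_integral_restrict_space, auto intro!: nn_integral_cong simp: indicator_def)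
  also have "\<dots> = ennreal (\<Prod>k\<in>J. cell_weight h N (c k))"
    using cell_weight_nonneg by (rule prod_ennreal)
  finally show ?thesis .
qed

lemma nn_integral_cells:
  assumes J: "finite J" and T: "T \<subseteq> PiE J (\<lambda>_. {..N})" and \<phi>: "\<And>c. 0 \<le> \<phi> c"
  shows "(\<integral>\<^sup>+ u\<in>{u. cell_of h N J u \<in> T}. ennreal (\<phi> (cell_of h N J u) * weight J u) \<partial>bid_measure J)
    = ennreal (\<Sum>c\<in>T. \<phi> c * (\<Prod>k\<in>J. cell_weight h N (c k)))"
proof -
  have fin: "finite T" using T by (rule finite_subset) (use J in \<open>auto intro: finite_PiE\<close>)
  have ind: "(indicator {u. cell_of h N J u = c} :: _ \<Rightarrow> ennreal) \<in> borel_measurable (bid_measure J)" if "c \<in> T" for c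
  proof -
    have "{u \<in> space (bid_measure J). cell_of h N J u = c} \<in> sets (bid_measure J)"
      using sets_cell[OF J, of 0 c] cell_of_eq_iff[of c J] T that by auto
    then show ?thesis by (simp add: borel_measurable_indicator_iff Int_def conj_commute)
  qed
  have "(\<integral>\<^sup>+ u\<in>{u. cell_of h N J u \<in> T}. ennreal (\<phi> (cell_of h N J u) * weight J u) \<partial>bid_measure J)
    = (\<integral>\<^sup>+ u. (\<Sum>c\<in>T. ennreal (\<phi> c) * (ennreal (weight J u) * indicator {u. cell_of h N J u = c} u)) \<partial>bid_measure J)"
  proof (intro nn_integral_cong)
    fix u assume "u \<in> space (bid_measure J)"
    then have w: "0 < weight J u" by (simp add: weight_pos)
    show "ennreal (\<phi> (cell_of h N J u) * weight J u) * indicator {u. cell_of h N J u \<in> T} u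
      = (\<Sum>c\<in>T. ennreal (\<phi> c) * (ennreal (weight J u) * indicator {u. cell_of h N J u = c} u))"
    proof (cases "cell_of h N J u \<in> T")
      case True
      then have "(\<Sum>c\<in>T. ennreal (\<phi> c) * (ennreal (weight J u) * indicator {u. cell_of h N J u = c} u))
        = (\<Sum>c\<in>{cell_of h N J u}. ennreal (\<phi> c) * ennreal (weight J u))"
        using fin by (intro sum.mono_neutral_cong_right) (auto simp: indicator_def)
      then show ?thesis using True w \<phi> by (simp add: ennreal_mult)
    next
      case False
      then have "(\<Sum>c\<in>T. ennreal (\<phi> c) * (ennreal (weight J u) * indicator {u. cell_of h N J u = c} u)) = 0"
        by (intro sum.neutral) (auto simp: indicator_def)
      then show ?thesis using False by simp
    qed
  qed
  also have "\<dots> = (\<Sum>c\<in>T. \<integral>\<^sup>+ u. ennreal (\<phi> c) * (ennreal (weight J u) * indicator {u. cell_of h N J u = c} u) \<partial>bid_measure J)"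
    using ind measurable_weight by (intro nn_integral_sum) auto
  also have "\<dots> = (\<Sum>c\<in>T. ennreal (\<phi> c) * ennreal (\<Prod>k\<in>J. cell_weight h N (c k)))"
  proof (intro sum.cong refl)
    fix c assume c: "c \<in> T"
    show "(\<integral>\<^sup>+ u. ennreal (\<phi> c) * (ennreal (weight J u) * indicator {u. cell_of h N J u = c} u) \<partial>bid_measure J)
      = ennreal (\<phi> c) * ennreal (\<Prod>k\<in>J. cell_weight h N (c k))"
      using ind[OF c] measurable_weight nn_integral_cell[OF J, of c] T c
      by (subst nn_integral_cmult) auto
  qed
  also have "\<dots> = ennreal (\<Sum>c\<in>T. \<phi> c * (\<Prod>k\<in>J. cell_weight h N (c k)))"
    using \<phi> cell_weight_nonneg
    by (simp add: ennreal_mult[symmetric] prod_nonneg sum_ennreal)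
  finally show ?thesis .
qed

end

section \<open>From the integral bound to approximate curves\<close>

lemma cell_of_update:
  "i \<in> J \<Longrightarrow> cell_of h N J (u(i := x)) = (cell_of h N (J - {i}) u)(i := cell_index h N x)"
  by (auto simp: cell_of_def restrict_def fun_eq_iff)

definition corner_point :: "nat \<Rightarrow> real \<Rightarrow> (nat \<Rightarrow> nat) \<Rightarrow> nat \<Rightarrow> real" where
  "corner_point n h c = (\<lambda>k\<in>{1..n}. corner h (c k))"

lemma corner_point_in: "0 < h \<Longrightarrow> corner_point n h c \<in> bid_vectors {1..n}"
  by (auto simp: corner_point_def bid_vectors_def corner_def)

context
  fixes n :: nat and f :: "(nat \<Rightarrow> real) \<Rightarrow> real" and r :: real
  assumes n: "n \<ge> 1"
    and f_nonneg: "\<And>v. v \<in> bid_vectors {1..n} \<Longrightarrow> f v \<ge> 0"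
    and f_mono: "mono_on (bid_vectors {1..n}) f"
    and r: "r > 0"
    and bound: "\<And>S. S \<in> sets (completion (bid_measure {1..n})) \<Longrightarrow> upward_closed n S \<Longrightarrow>
      (\<integral>\<^sup>+ v\<in>S. ennreal (f v * weight {1..n} v) \<partial>completion (bid_measure {1..n}))
        \<le> ennreal r * (\<Sum>i=1..n. \<integral>\<^sup>+ u\<in>projection n i S. ennreal (weight ({1..n} - {i}) u)
            \<partial>completion (bid_measure ({1..n} - {i})))"
begin

text \<open>Let \<open>S\<close> be the union of the cells in \<open>T\<close>. The demand at a
  lower corner is at most \<open>f\<close> on the whole cell, so the grid sum is below the integral
  over \<open>S\<close>; and the projections of \<open>S\<close> lie in the cells of the faces of
  \<open>T\<close>.\<close>

lemma grid_hall:
  assumes h: "0 < h"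
  shows "grid_market_hall {1..n} {..N} (cell_weight h N) (\<lambda>c. f (corner_point n h c) / r)"
proof -
  interpret grid_market "{1..n}" "{..N}" "cell_weight h N" "\<lambda>c. f (corner_point n h c) / r"
  proof
    show "mono (\<lambda>c. f (corner_point n h c) / r)"
    proof (intro monoI divide_right_mono mono_onD[OF f_mono] corner_point_in h)
      fix c d :: "nat \<Rightarrow> nat" assume "c \<le> d"
      then show "corner_point n h c \<le> corner_point n h d"
        using corner_mono[OF h] by (auto simp: corner_point_def le_fun_def)
    qed (use r in auto)
    show "0 \<le> f (corner_point n h c) / r" for c
      using f_nonneg[OF corner_point_in[OF h]] r by simp
  qed (use n h cell_weight_pos cell_weight_sum in auto)
  show ?thesis
  proof
    fix T assume T: "T \<subseteq> cells {1..n}" and up: "\<And>c d. c \<in> T \<Longrightarrow> d \<in> cells {1..n} \<Longrightarrow> c \<le> d \<Longrightarrow> d \<in> T"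
    define S where "S = {v \<in> bid_vectors {1..n}. cell_of h N {1..n} v \<in> T}"
    have "v \<in> S" if "u \<in> S" "v \<in> bid_vectors {1..n}" "u \<le> v" for u v
      using up[of "cell_of h N {1..n} u" "cell_of h N {1..n} v"] that
        cell_of_in[OF h, of N "{1..n}" v] cell_of_mono[OF h that(3)] by (simp add: S_def)
    moreover have "S \<subseteq> bid_vectors {1..n}" by (simp add: S_def)
    ultimately have S_up: "upward_closed n S" unfolding upward_closed_def by blast
    have "(\<lambda>v. cell_of h N {1..n} (\<lambda>k. v k + 0)) -` T \<inter> space (bid_measure {1..n}) \<in> sets (bid_measure {1..n})"
      using T by (intro measurable_sets[OF measurable_cell_of[OF h]]) auto
    then have S_sets: "S \<in> sets (bid_measure {1..n})"
      by (simp add: S_def vimage_def Int_def conj_commute)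
    have "ennreal (\<Sum>c\<in>T. f (corner_point n h c) * W {1..n} c)
      = (\<integral>\<^sup>+ v\<in>{v. cell_of h N {1..n} v \<in> T}.
          ennreal (f (corner_point n h (cell_of h N {1..n} v)) * weight {1..n} v) \<partial>bid_measure {1..n})"
      unfolding W_def using T f_nonneg[OF corner_point_in[OF h]]
      by (subst nn_integral_cells[OF h]) auto
    also have "\<dots> \<le> (\<integral>\<^sup>+ v\<in>S. ennreal (f v * weight {1..n} v) \<partial>bid_measure {1..n})"
    proof (intro nn_integral_mono)
      fix v assume "v \<in> space (bid_measure {1..n})"
      then have v: "v \<in> bid_vectors {1..n}" by simp
      have "1 \<le> v k" if "k \<in> {1..n}" for k using v that by (auto simp: bid_vectors_def PiE_iff)
      then have "corner_point n h (cell_of h N {1..n} v) k \<le> v k" for k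
        using v corner_cell_index_le[OF h, of "v k"]
        by (cases "k \<in> {1..n}") (auto simp: corner_point_def cell_of_def bid_vectors_def PiE_def extensional_def)
      then have "corner_point n h (cell_of h N {1..n} v) \<le> v" by (rule le_funI)
      then have "f (corner_point n h (cell_of h N {1..n} v)) \<le> f v"
        using v by (intro mono_onD[OF f_mono] corner_point_in h)
      then show "ennreal (f (corner_point n h (cell_of h N {1..n} v)) * weight {1..n} v)
          * indicator {v. cell_of h N {1..n} v \<in> T} v \<le> ennreal (f v * weight {1..n} v) * indicator S v"
        using weight_pos[OF v] v by (auto simp: S_def indicator_def intro!: ennreal_leI mult_right_mono)
    qed
    also have "\<dots> \<le> ennreal r * (\<Sum>i=1..n. \<integral>\<^sup>+ u\<in>projection n i S. ennreal (weight ({1..n} - {i}) u) \<partial>bid_measure ({1..n} - {i}))"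
      using bound[OF sets_completionI_sets[OF S_sets] S_up] by (simp add: nn_integral_completion)
    also have "\<dots> \<le> ennreal r * (\<Sum>i=1..n. ennreal (\<Sum>u\<in>face i T. W ({1..n} - {i}) u))"
    proof (intro mult_left_mono sum_mono)
      fix i assume i: "i \<in> {1..n}"
      have "(\<integral>\<^sup>+ u\<in>projection n i S. ennreal (weight ({1..n} - {i}) u) \<partial>bid_measure ({1..n} - {i}))
        \<le> (\<integral>\<^sup>+ u\<in>{u. cell_of h N ({1..n} - {i}) u \<in> face i T}. ennreal (1 * weight ({1..n} - {i}) u) \<partial>bid_measure ({1..n} - {i}))"
      proof (intro nn_integral_mono)
        fix u
        have "cell_of h N ({1..n} - {i}) u \<in> face i T" if "u \<in> projection n i S"
        proof -
          from that obtain x where "cell_of h N {1..n} (u(i := x)) \<in> T" by (auto simp: projection_def S_def)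
          then have "(cell_of h N ({1..n} - {i}) u)(i := cell_index h N x) \<in> T" by (simp only: cell_of_update[OF i])
          then show ?thesis using cell_of_in[OF h] cell_index_le[OF h] by (auto simp: face_def)
        qed
        then show "ennreal (weight ({1..n} - {i}) u) * indicator (projection n i S) u
          \<le> ennreal (1 * weight ({1..n} - {i}) u) * indicator {u. cell_of h N ({1..n} - {i}) u \<in> face i T} u"
          by (auto simp: indicator_def)
      qed
      also have "\<dots> = ennreal (\<Sum>u\<in>face i T. 1 * (\<Prod>k\<in>{1..n} - {i}. cell_weight h N (u k)))"
        by (rule nn_integral_cells[OF h]) (auto simp: face_def)
      finally show "(\<integral>\<^sup>+ u\<in>projection n i S. ennreal (weight ({1..n} - {i}) u) \<partial>bid_measure ({1..n} - {i}))
        \<le> ennreal (\<Sum>u\<in>face i T. W ({1..n} - {i}) u)" by (simp add: W_def)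
    qed simp
    also have "\<dots> = ennreal (r * (\<Sum>i=1..n. \<Sum>u\<in>face i T. W ({1..n} - {i}) u))"
      using r cell_weight_nonneg[OF h]
      by (simp add: sum_ennreal sum_nonneg W_def prod_nonneg ennreal_mult)
    finally have "(\<Sum>c\<in>T. f (corner_point n h c) * W {1..n} c) \<le> r * (\<Sum>i=1..n. \<Sum>u\<in>face i T. W ({1..n} - {i}) u)"
      using r cell_weight_nonneg[OF h] by (subst (asm) ennreal_le_iff) (auto intro!: mult_nonneg_nonneg sum_nonneg prod_nonneg simp: W_def)
    then show "(\<Sum>c\<in>T. f (corner_point n h c) / r * W {1..n} c) \<le> (\<Sum>i=1..n. \<Sum>u\<in>face i T. W ({1..n} - {i}) u)"
      using r by (simp add: sum_divide_distrib[symmetric] pos_divide_le_eq mult.commute)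
  qed
qed

text \<open>
  Evaluating the grid shares one cell higher compensates for rounding the bids down; in the
  loads this costs a factor \<open>(1 + h)\<^sup>2\<close>.
\<close>

theorem approx_curves_nonempty: "approx_curves n (\<lambda>v. f v / r) m \<noteq> {}"
proof -
  \<comment> \<open>From \<open>(1 + h)^3 \<le> 1 + 7 * h\<close> for \<open>h \<le> 1\<close>: two
    factors pay for the shift of the bids, the third is the tolerance of
    \<open>balanced_shares_exist\<close>.\<close>
  define h :: real where "h = 1 / (7 * real (Suc m))"
  have h: "0 < h" "h \<le> 1" by (auto simp: h_def)
  have cube: "(1 + h)\<^sup>2 * (1 + h) \<le> 1 + 1 / Suc m"
  proof -
    have "h * h \<le> h" "h * h * h \<le> h" using h by (auto intro: mult_left_le mult_le_one simp: mult_left_le_one_le)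
    then have "(1 + h)\<^sup>2 * (1 + h) \<le> 1 + 7 * h" by (simp add: power2_eq_square algebra_simps)
    also have "\<dots> = 1 + 1 / Suc m" by (simp add: h_def del: of_nat_Suc)
    finally show ?thesis .
  qed
  obtain N :: nat where "real m / h < real N" using reals_Archimedean2 by blast
  then have N: "real m \<le> corner h N" using h by (simp add: corner_def field_simps)
  interpret grid_market_hall "{1..n}" "{..N}" "cell_weight h N" "\<lambda>c. f (corner_point n h c) / r"
    by (rule grid_hall[OF h(1)])
  obtain q where q0: "\<And>i u x. 0 \<le> q i u x" and q_mono: "\<And>i u. mono (q i u)"
    and q_sum: "\<And>c. c \<in> cells {1..n} \<Longrightarrow> (\<Sum>i\<in>{1..n}. q i (restrict c ({1..n} - {i})) (c i)) = f (corner_point n h c) / r"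
    and q_load: "\<And>i u. i \<in> {1..n} \<Longrightarrow> u \<in> cells ({1..n} - {i}) \<Longrightarrow> (\<Sum>x\<le>N. cell_weight h N x * q i u x) \<le> 1 + h"
    by (rule balanced_shares_exist[OF h(1)]) blast
  define Q where "Q i u x = q i (cell_of h N ({1..n} - {i}) (\<lambda>k. u k + h)) (cell_index h N (x + h))" for i u x
  have "Q \<in> approx_curves n (\<lambda>v. f v / r) m"
    unfolding approx_curves_def
  proof (intro CollectI conjI ballI allI impI)
    fix i x assume "i \<in> {1..n}"
    show "(\<lambda>u. Q i u x) \<in> borel_measurable (bid_measure ({1..n} - {i}))"
      unfolding Q_def by (rule measurable_compose[OF measurable_cell_of[OF h(1)]]) auto
  next
    fix i u assume i: "i \<in> {1..n}" and u: "u \<in> bid_vectors ({1..n} - {i})"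
    show "mono (Q i u)"
      unfolding Q_def by (intro monoI monoD[OF q_mono] cell_index_mono h) simp
    show "0 \<le> Q i u x" for x by (simp add: Q_def q0)
    define \<phi> where "\<phi> = q i (cell_of h N ({1..n} - {i}) (\<lambda>k. u k + h))"
    have [measurable]: "(\<lambda>y. \<phi> (cell_index h N y)) \<in> borel_measurable borel"
      by (rule measurable_compose[OF cell_index_measurable[OF h(1)]]) simp_all
    have "(\<integral>\<^sup>+ y\<in>{1..}. ennreal (Q i u y / y\<^sup>2) \<partial>lborel)
      \<le> (\<integral>\<^sup>+ y. ennreal ((1 + h)\<^sup>2) * (ennreal (\<phi> (cell_index h N (h + 1 * y)) / (h + 1 * y)\<^sup>2) * indicator {1..} (h + 1 * y)) \<partial>lborel)"
    proof (intro nn_integral_mono)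
      fix y :: real
      show "ennreal (Q i u y / y\<^sup>2) * indicator {1..} y
        \<le> ennreal ((1 + h)\<^sup>2) * (ennreal (\<phi> (cell_index h N (h + 1 * y)) / (h + 1 * y)\<^sup>2) * indicator {1..} (h + 1 * y))"
      proof (cases "1 \<le> y")
        case True
        \<comment> \<open>Because \<open>y \<ge> 1\<close>, moving the density to the shifted point
          costs at most the factor \<open>(1 + h)\<^sup>2\<close>. The form \<open>h + 1 * y\<close>
          in the integrals prepares the affine substitution.\<close>
        have "h + y \<le> (1 + h) * y" using True h mult_left_mono[of 1 y h] by (simp add: algebra_simps)
        then have "(h + y)\<^sup>2 \<le> ((1 + h) * y)\<^sup>2" using True h by (intro power_mono) auto
        then have "(h + y)\<^sup>2 / y\<^sup>2 \<le> (1 + h)\<^sup>2"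
          using True by (subst pos_divide_le_eq) (simp_all only: power_mult_distrib, simp)
        then have "1 / y\<^sup>2 \<le> (1 + h)\<^sup>2 / (h + y)\<^sup>2"
          using True h by (intro mult_imp_le_div_pos) auto
        then have "Q i u y * (1 / y\<^sup>2) \<le> Q i u y * ((1 + h)\<^sup>2 / (h + y)\<^sup>2)"
          by (intro mult_left_mono) (auto simp: Q_def q0)
        then have "Q i u y / y\<^sup>2 \<le> (1 + h)\<^sup>2 * (\<phi> (cell_index h N (h + y)) / (h + y)\<^sup>2)"
          by (simp add: Q_def \<phi>_def add.commute mult.commute)
        then show ?thesis using True h q0 by (simp add: \<phi>_def ennreal_mult[symmetric] ennreal_leI)
      qed simp
    qed
    also have "\<dots> = ennreal ((1 + h)\<^sup>2) * (\<integral>\<^sup>+ y. ennreal (\<phi> (cell_index h N (h + 1 * y)) / (h + 1 * y)\<^sup>2) * indicator {1..} (h + 1 * y) \<partial>lborel)"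
      by (rule nn_integral_cmult) measurable
    also have "(\<integral>\<^sup>+ y. ennreal (\<phi> (cell_index h N (h + 1 * y)) / (h + 1 * y)\<^sup>2) * indicator {1..} (h + 1 * y) \<partial>lborel)
      = (\<integral>\<^sup>+ y. ennreal (\<phi> (cell_index h N y) / y\<^sup>2) * indicator {1..} y \<partial>lborel)"
      by (subst nn_integral_real_affine[where c = 1 and t = h]) auto
    also have "\<dots> = ennreal (\<Sum>j\<le>N. cell_weight h N j * \<phi> j)"
      by (rule nn_integral_cell_index[OF h(1)]) (simp add: \<phi>_def q0)
    also have "ennreal ((1 + h)\<^sup>2) * \<dots> \<le> ennreal ((1 + h)\<^sup>2) * ennreal (1 + h)"
      unfolding \<phi>_def by (intro mult_left_mono ennreal_leI q_load[OF i] cell_of_in[OF h(1)]) auto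
    also have "\<dots> = ennreal ((1 + h)\<^sup>2 * (1 + h))" using h by (intro ennreal_mult[symmetric]) auto
    also have "\<dots> \<le> ennreal (1 + 1 / Suc m)" by (intro ennreal_leI cube)
    finally show "(\<integral>\<^sup>+ y\<in>{1..}. ennreal (Q i u y / y\<^sup>2) \<partial>lborel) \<le> ennreal (1 + 1 / Suc m)" .
  next
    fix v assume v: "v \<in> bid_vectors {1..n}" and le: "\<forall>k\<in>{1..n}. v k \<le> real m"
    let ?c = "cell_of h N {1..n} (\<lambda>k. v k + h)"
    \<comment> \<open>The lower corner of the shifted cell dominates \<open>v\<close>, so the shares
      there cover \<open>f v\<close> by monotonicity.\<close>
    have "v \<le> corner_point n h ?c"
    proof (rule le_funI)
      fix k
      show "v k \<le> corner_point n h ?c k"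
      proof (cases "k \<in> {1..n}")
        case True
        then have "1 \<le> v k" using v by (auto simp: bid_vectors_def PiE_iff)
        then have "v k \<le> corner h (cell_index h N (v k + h))"
          using le N True h by (intro le_corner_cell_index_shift) (auto intro: order_trans)
        then show ?thesis using True by (simp add: corner_point_def cell_of_def)
      qed (use v in \<open>auto simp: corner_point_def bid_vectors_def PiE_def extensional_def\<close>)
    qed
    then have "f v / r \<le> f (corner_point n h ?c) / r"
      using r v h by (intro divide_right_mono mono_onD[OF f_mono] corner_point_in) auto
    also have "\<dots> = (\<Sum>i\<in>{1..n}. q i (restrict ?c ({1..n} - {i})) (?c i))"
      by (rule q_sum[symmetric]) (rule cell_of_in[OF h(1)])
    also have "\<dots> = (\<Sum>i=1..n. Q i (drop_bid n i v) (v i))"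
    proof (intro sum.cong refl)
      fix i assume i: "i \<in> {1..n}"
      have "restrict ?c ({1..n} - {i}) = cell_of h N ({1..n} - {i}) (\<lambda>k. drop_bid n i v k + h)"
        by (auto simp: cell_of_def drop_bid_def restrict_def fun_eq_iff)
      then show "q i (restrict ?c ({1..n} - {i})) (?c i) = Q i (drop_bid n i v) (v i)"
        using i by (simp add: Q_def cell_of_def)
    qed
    finally show "f v / r \<le> (\<Sum>i=1..n. Q i (drop_bid n i v) (v i))" .
  qed
  then show ?thesis by blast
qed

end

section \<open>Auctions from revenue curves\<close>

text \<open>Monotonicity gives the upper bound, continuity from the left along rationals the lower
  one. A countable supremum inherits measurability in parameters.\<close>

lemma SUP_rationals_eq_isCont:
  fixes g :: "real \<Rightarrow> real"
  assumes "mono g" "isCont g y"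
  shows "(SUP z\<in>\<rat>. if z \<le> y then ennreal (g z) else 0) = ennreal (g y)"
proof (rule antisym)
  show "(SUP z\<in>\<rat>. if z \<le> y then ennreal (g z) else 0) \<le> ennreal (g y)"
    using assms(1) by (intro SUP_least) (auto intro!: ennreal_leI dest: monoD)
  show "ennreal (g y) \<le> (SUP z\<in>\<rat>. if z \<le> y then ennreal (g z) else 0)"
  proof (rule dense_le)
    fix t assume t: "t < ennreal (g y)"
    then obtain s where s: "t = ennreal s" "0 \<le> s" "s < g y"
      by (cases t) (auto simp: ennreal_less_iff)
    have "(g \<longlongrightarrow> g y) (at y)" using assms(2) by (simp add: isCont_def)
    then have "eventually (\<lambda>z. s < g z) (at y)" using s(3) by (rule order_tendstoD(1))
    then obtain d where d: "0 < d" "\<And>z. z \<noteq> y \<Longrightarrow> dist z y < d \<Longrightarrow> s < g z"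
      unfolding eventually_at by blast
    obtain z where z: "z \<in> \<rat>" "y - d < z" "z < y" using Rats_dense_in_real[of "y - d" y] d by auto
    then have "s < g z" using d(2)[of z] by (simp add: dist_real_def)
    then have "t \<le> (if z \<le> y then ennreal (g z) else 0)" using s z by (simp add: ennreal_leI)
    also have "\<dots> \<le> (SUP z\<in>\<rat>. if z \<le> y then ennreal (g z) else 0)" using z(1) by (rule SUP_upper)
    finally show "t \<le> (SUP z\<in>\<rat>. if z \<le> y then ennreal (g z) else 0)" .
  qed
qed

text \<open>
  Measurability is known at rational bids only; a monotone curve is determined by these almost
  everywhere.
\<close>

lemma price_cdf_measurable_parameter:
  assumes q: "\<And>u. u \<in> space M \<Longrightarrow> mono (q u)"
    and meas: "\<And>x. x \<in> \<rat> \<Longrightarrow> (\<lambda>u. q u x) \<in> borel_measurable M" and x: "x \<in> \<rat>"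
  shows "(\<lambda>u. price_cdf (q u) x) \<in> borel_measurable M"
proof -
  \<comment> \<open>Jointly measurable in \<open>u\<close> and \<open>y\<close>; for rational
    \<open>z\<close> the argument \<open>min x z\<close> is rational again.\<close>
  define h where "h p = (SUP z\<in>\<rat>. if z \<le> snd p then ennreal (q (fst p) (min x z)) else 0)" for p
  have [measurable]: "h \<in> borel_measurable (M \<Otimes>\<^sub>M lborel)"
    unfolding h_def
  proof (intro borel_measurable_SUP countable_rat)
    fix z :: real assume z: "z \<in> \<rat>"
    then have "min x z \<in> \<rat>" using x by (simp add: min_def)
    then have [measurable]: "(\<lambda>p. q (fst p) (min x z)) \<in> borel_measurable (M \<Otimes>\<^sub>M lborel)"
      using measurable_compose[OF measurable_fst meas] by blast
    show "(\<lambda>p. if z \<le> snd p then ennreal (q (fst p) (min x z)) else 0) \<in> borel_measurable (M \<Otimes>\<^sub>M lborel)"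
      by measurable
  qed
  have "(\<lambda>u. enn2real (\<integral>\<^sup>+ y. h (u, y) * ennreal (1 / y\<^sup>2) * indicator {1..} y \<partial>lborel)) \<in> borel_measurable M"
    by measurable
  moreover have "price_cdf (q u) x = enn2real (\<integral>\<^sup>+ y. h (u, y) * ennreal (1 / y\<^sup>2) * indicator {1..} y \<partial>lborel)"
    if "u \<in> space M" for u
  proof -
    have g: "mono (\<lambda>y. q u (min x y))"
      using q[OF that] by (auto simp: mono_def min_le_iff_disj)
    have "AE y in lborel. ennreal (q u (min x y) / y\<^sup>2) * indicator {1..} y
        = h (u, y) * ennreal (1 / y\<^sup>2) * indicator {1..} y"
      using mono_AE_isCont[OF g]
    proof eventually_elim
      case (elim y)
      then have "h (u, y) = ennreal (q u (min x y))"
        unfolding h_def using SUP_rationals_eq_isCont[OF g] by simp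
      then show ?case by (simp add: ennreal_mult''[symmetric])
    qed
    then show ?thesis unfolding price_cdf_def by (intro arg_cong[where f = enn2real] nn_integral_cong_AE)
  qed
  ultimately show ?thesis by (simp cong: measurable_cong)
qed

text \<open>Needed since the curves are only Lebesgue measurable in the bids of the others. The
  preimage of a null set \<open>N\<close> is \<open>N \<times> space C\<close>, which is
  null.\<close>

lemma measurable_fst_completion:
  assumes "sigma_finite_measure M" "sigma_finite_measure C"
  shows "fst \<in> completion (M \<Otimes>\<^sub>M C) \<rightarrow>\<^sub>M completion M"
proof (rule completion.measurable_completion2)
  interpret M: sigma_finite_measure M by fact
  interpret C: sigma_finite_measure C by fact
  show "fst \<in> completion (M \<Otimes>\<^sub>M C) \<rightarrow>\<^sub>M M" by (rule measurable_completion) simp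
  show "null_sets M \<subseteq> null_sets (distr (completion (M \<Otimes>\<^sub>M C)) M fst)"
  proof
    fix N assume N: "N \<in> null_sets M"
    then have Ns: "N \<in> sets M" by auto
    have "N \<times> space C \<in> null_sets (M \<Otimes>\<^sub>M C)"
      using N C.emeasure_pair_measure_Times[of N M "space C"] by (auto simp: null_sets_def)
    moreover have "fst -` N \<inter> space (M \<Otimes>\<^sub>M C) = N \<times> space C"
      using sets.sets_into_space[OF Ns] by (auto simp: space_pair_measure)
    ultimately have "fst -` N \<inter> space (completion (M \<Otimes>\<^sub>M C)) \<in> null_sets (completion (M \<Otimes>\<^sub>M C))"
      by (simp add: null_sets_completionI)
    then show "N \<in> null_sets (distr (completion (M \<Otimes>\<^sub>M C)) M fst)"
      using Ns by (simp add: null_sets_distr_iff measurable_completion)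
  qed
qed

abbreviation coins :: "real measure" where
  "coins \<equiv> restrict_space lborel {0<..1}"

lemma prob_space_coins: "prob_space coins"
  by (rule prob_space_restrict_space) auto

lemma price_quantile_measurable:
  assumes q: "\<And>z. z \<in> space N \<Longrightarrow> revenue_curve (q z)"
    and cdf: "\<And>x. x \<in> \<rat> \<Longrightarrow> (\<lambda>z. price_cdf (q z) x) \<in> borel_measurable N"
    and c [measurable]: "c \<in> borel_measurable N"
  shows "(\<lambda>z. price_quantile (q z) (c z)) \<in> borel_measurable N"
proof (rule borel_measurableI_less)
  fix t :: ennreal
  have "{z \<in> space N. price_quantile (q z) (c z) < t}
    = (\<Union>x\<in>{x\<in>\<rat>. 1 \<le> x \<and> ennreal x < t}. {z \<in> space N. c z \<le> price_cdf (q z) x})"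
    using price_quantile_less_iff[OF q] by auto
  also have "\<dots> \<in> sets N"
  proof (rule sets.countable_UN'')
    show "countable {x \<in> \<rat>. 1 \<le> x \<and> ennreal x < t}"
      by (rule countable_subset[OF _ countable_rat]) auto
    fix x :: real assume "x \<in> {x \<in> \<rat>. 1 \<le> x \<and> ennreal x < t}"
    then have [measurable]: "(\<lambda>z. price_cdf (q z) x) \<in> borel_measurable N" using cdf by simp
    show "{z \<in> space N. c z \<le> price_cdf (q z) x} \<in> sets N" by measurable
  qed
  finally show "{z \<in> space N. price_quantile (q z) (c z) < t} \<in> sets N" .
qed

text \<open>All bidders share the same coin \<open>c\<close>: expected revenue is additive, so the
  correlation of the prices is harmless and one uniform coin suffices.\<close>

theorem auction_of_revenue_curves:
  fixes Q :: "nat \<Rightarrow> (nat \<Rightarrow> real) \<Rightarrow> real \<Rightarrow> real"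
  assumes curve: "\<And>i u. i \<in> {1..n} \<Longrightarrow> u \<in> bid_vectors ({1..n} - {i}) \<Longrightarrow> revenue_curve (Q i u)"
    and meas: "\<And>i x. i \<in> {1..n} \<Longrightarrow> x \<in> \<rat> \<Longrightarrow>
      (\<lambda>u. Q i u x) \<in> borel_measurable (completion (bid_measure ({1..n} - {i})))"
    and cover: "\<And>v. v \<in> bid_vectors {1..n} \<Longrightarrow> f v / r \<le> (\<Sum>i=1..n. Q i (drop_bid n i v) (v i))"
    and r: "0 < r"
  defines "g \<equiv> \<lambda>c i u. price_quantile (Q i u) c"
  shows "randomized_truthful_auction n coins g" "has_competitive_ratio n coins g f r"
proof -
  interpret C: prob_space coins by (rule prob_space_coins)
  have c_meas: "(\<lambda>c. c) \<in> borel_measurable coins" by (rule measurable_restrict_space1) simp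
  have fix_u: "(\<lambda>c. g c i u) \<in> borel_measurable coins" if "i \<in> {1..n}" "u \<in> bid_vectors ({1..n} - {i})" for i u
    unfolding g_def using curve[OF that] c_meas by (intro price_quantile_measurable) auto
  have joint: "(\<lambda>(u, c). g c i u) \<in> borel_measurable (completion (bid_measure ({1..n} - {i}) \<Otimes>\<^sub>M coins))"
    if i: "i \<in> {1..n}" for i
  proof -
    let ?B = "bid_measure ({1..n} - {i})"
    have "(\<lambda>z. price_quantile (Q i (fst z)) (snd z)) \<in> borel_measurable (completion (?B \<Otimes>\<^sub>M coins))"
    proof (rule price_quantile_measurable)
      show "revenue_curve (Q i (fst z))" if "z \<in> space (completion (?B \<Otimes>\<^sub>M coins))" for z
        using that i by (auto simp: space_pair_measure intro: curve)
      show "snd \<in> borel_measurable (completion (?B \<Otimes>\<^sub>M coins))"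
        by (rule measurable_completion, rule measurable_compose[OF measurable_snd c_meas])
      show "(\<lambda>z. price_cdf (Q i (fst z)) x) \<in> borel_measurable (completion (?B \<Otimes>\<^sub>M coins))" if "x \<in> \<rat>" for x
      proof (rule measurable_compose[OF measurable_fst_completion])
        show "(\<lambda>u. price_cdf (Q i u) x) \<in> borel_measurable (completion ?B)"
          using curve[OF i] meas[OF i] that
          by (intro price_cdf_measurable_parameter) (auto simp: revenue_curve_def)
        show "sigma_finite_measure ?B" by (rule sigma_finite_bids) simp
      qed unfold_locales
    qed
    then show ?thesis by (simp add: g_def case_prod_unfold)
  qed
  show auction: "randomized_truthful_auction n coins g"
    unfolding randomized_truthful_auction_def using prob_space_coins joint fix_u by blast
  show "has_competitive_ratio n coins g f r"
    unfolding has_competitive_ratio_def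
  proof
    fix v assume v: "v \<in> bid_vectors {1..n}"
    have "ennreal (Q i (drop_bid n i v) (v i)) \<le> expected_payment n coins g i v" if i: "i \<in> {1..n}" for i
    proof -
      have u: "drop_bid n i v \<in> bid_vectors ({1..n} - {i})" by (rule drop_bid_in[OF v])
      have "1 \<le> v i" using v i by (auto simp: bid_vectors_def PiE_iff)
      from price_quantile_revenue[OF curve[OF i u] this]
      show ?thesis
        unfolding expected_payment_def payment_eq g_def by (subst nn_integral_restrict_space) auto
    qed
    then have "(\<Sum>i=1..n. ennreal (Q i (drop_bid n i v) (v i))) \<le> expected_revenue n coins g v"
      unfolding expected_revenue_eq[OF auction v] by (rule sum_mono)
    moreover have "(\<Sum>i=1..n. ennreal (Q i (drop_bid n i v) (v i))) = ennreal (\<Sum>i=1..n. Q i (drop_bid n i v) (v i))"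
      using curve drop_bid_in[OF v] by (intro sum_ennreal) (auto simp: revenue_curve_def)
    ultimately have "ennreal (f v / r) \<le> expected_revenue n coins g v"
      using ennreal_leI[OF cover[OF v]] by simp
    then have "ennreal r * ennreal (f v / r) \<le> ennreal r * expected_revenue n coins g v"
      by (rule mult_left_mono) simp
    then show "ennreal (f v) \<le> ennreal r * expected_revenue n coins g v"
      using r by (simp add: ennreal_mult'[symmetric])
  qed
qed

text \<open>An existential cannot range over types of coins. The equivalence is therefore stated for
  real coins, and the second conjunct reduces an arbitrary type \<open>'c\<close> to them: the
  integral bound follows from an auction with any coins, and it yields one with a uniform
  coin.\<close>

theorem theorem1:
  fixes n :: nat and f :: "(nat \<Rightarrow> real) \<Rightarrow> real" and r :: real
  assumes "n \<ge> 1"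
    and "\<And>v. v \<in> bid_vectors {1..n} \<Longrightarrow> f v \<ge> 0"
    and "mono_on (bid_vectors {1..n}) f"
    and "r > 0"
  shows "((\<exists>(C :: real measure) g.
              randomized_truthful_auction n C g \<and> has_competitive_ratio n C g f r) \<longleftrightarrow>
          (\<forall>S \<in> sets (completion (bid_measure {1..n})). upward_closed n S \<longrightarrow>
              (\<integral>\<^sup>+ v\<in>S. ennreal (f v * weight {1..n} v) \<partial>completion (bid_measure {1..n}))
              \<le> ennreal r * (\<Sum>i=1..n.
                  \<integral>\<^sup>+ u\<in>projection n i S. ennreal (weight ({1..n} - {i}) u)
                    \<partial>completion (bid_measure ({1..n} - {i}))))) \<and>
         ((\<exists>(C :: 'c measure) g.
              randomized_truthful_auction n C g \<and> has_competitive_ratio n C g f r) \<longrightarrow>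
          (\<exists>(C :: real measure) g.
              randomized_truthful_auction n C g \<and> has_competitive_ratio n C g f r))"
proof (intro conjI iffI impI)
  let ?bound = "\<forall>S \<in> sets (completion (bid_measure {1..n})). upward_closed n S \<longrightarrow>
      (\<integral>\<^sup>+ v\<in>S. ennreal (f v * weight {1..n} v) \<partial>completion (bid_measure {1..n}))
      \<le> ennreal r * (\<Sum>i=1..n. \<integral>\<^sup>+ u\<in>projection n i S. ennreal (weight ({1..n} - {i}) u)
          \<partial>completion (bid_measure ({1..n} - {i})))"
  have sufficient: "\<exists>(C :: real measure) g. randomized_truthful_auction n C g \<and> has_competitive_ratio n C g f r"
    if bound: ?bound
  proof -
    have ne: "approx_curves n (\<lambda>v. f v / r) m \<noteq> {}" for m
      using bound by (intro approx_curves_nonempty assms) auto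
    obtain Q where Q: "\<And>i u. i \<in> {1..n} \<Longrightarrow> u \<in> bid_vectors ({1..n} - {i}) \<Longrightarrow> revenue_curve (Q i u)"
      "\<And>i x. i \<in> {1..n} \<Longrightarrow> x \<in> \<rat> \<Longrightarrow>
        (\<lambda>u. Q i u x) \<in> borel_measurable (completion (bid_measure ({1..n} - {i})))"
      "\<And>v. v \<in> bid_vectors {1..n} \<Longrightarrow> f v / r \<le> (\<Sum>i=1..n. Q i (drop_bid n i v) (v i))"
      by (rule revenue_curves_exist[OF ne assms(1)]) blast
    from auction_of_revenue_curves[OF Q assms(4)] show ?thesis by blast
  qed
  then show "\<exists>(C :: real measure) g. randomized_truthful_auction n C g \<and> has_competitive_ratio n C g f r"
    if ?bound using that .
  show ?bound
    if "\<exists>(C :: real measure) g. randomized_truthful_auction n C g \<and> has_competitive_ratio n C g f r"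
    using that competitive_imp_integral_bound assms by blast
  show "\<exists>(C :: real measure) g. randomized_truthful_auction n C g \<and> has_competitive_ratio n C g f r"
    if "\<exists>(C :: 'c measure) g. randomized_truthful_auction n C g \<and> has_competitive_ratio n C g f r"
  proof (rule sufficient)
    show ?bound using that competitive_imp_integral_bound assms by blast
  qed
qed

end
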